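(* Let $N\ge 1$, let $q$ be a generic parameter and $s=(s_1,\dots,s_N)$ indeterminates. Let $f^{B_N{\rm Toda}}(x|s|q)$ be the $B_N$ $q$-Toda function and $f^{A_{N-1}{\rm Toda}}(x|s|q)$ the $A_{N-1}$ $q$-Toda function defined in the context. Then \[ f^{B_N{\rm Toda}}(x_1,\ldots,x_N|s_1,\ldots,s_N|q)=\sum_{\theta=(\theta_1,\ldots,\theta_N)\in \mathbb{Z}^N_{\geq 0}}e^{B_N/A_{N-1}}_{\theta}(s|q) \cdot \prod_{i=1}^N x_i^{-\theta_i} \cdot f^{A_{N-1}{\rm Toda}}(x_1,\ldots ,x_N|q^{-\theta_1}s_1,\ldots ,q^{-\theta_N}s_N|q), \] where \[ e^{B_N/A_{N-1}}_{\theta}(s|q):=\prod_{k=1}^N\frac{q^{(N-k+1)\theta_k}}{(q;q)_{\theta_k}(q/s_k^2;q)_{\theta_k}}\prod_{1\leq i<j\leq N}\frac{1}{(q s_j/s_i;q)_{\theta_i}\,(q^{\theta_j-\theta_i} q s_i/s_j;q)_{\theta_i}}\cdot\frac{(q/s_is_j;q)_{\theta_i+\theta_j}}{(q/s_is_j;q)_{\theta_i}\,(q/s_is_j;q)_{\theta_j}}. \]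
   Context: Notation: $(a;q)_n:=\prod_{k=1}^n(1-q^{k-1}a)$. For $x=(x_1,\dots,x_N)$, $T_{q,x_i}$ is the operator $T_{q,x_i}f(x_1,\ldots,x_N)=f(x_1,\ldots,qx_i,\ldots,x_N)$. $A_{N-1}$ $q$-Toda function: let $\mathsf{M}^{(N)}$ be the set of $N\times N$ strictly upper triangular matrices $\boldsymbol\theta=(\theta_{i,j})$ with entries in $\mathbb{Z}_{\ge0}$ ($\theta_{k,l}=0$ if $k\ge l$). Define \[ c^{\rm Toda}_N(\boldsymbol{\theta};s;q)=\prod_{k=2}^{N}\prod_{1\leq i\leq j\leq k-1}\frac{1}{(q^{\sum_{a=k+1}^N(\theta_{i,a}-\theta_{j+1,a})}qs_{j+1}/s_i;q)_{\theta_{i,k}}}\cdot\frac{q^{\theta_{i,k}}}{(q^{\theta_{j,k}-\theta_{i,k}-\sum_{a=k+1}^N(\theta_{i,a}-\theta_{j,a})}q s_i/s_j;q)_{\theta_{i,k}}} \] and \[ f^{A_{N-1}{\rm Toda}}(x|s|q)=\sum_{\boldsymbol{\theta}\in\mathsf{M}^{(N)}}c^{\rm Toda}_N(\boldsymbol{\theta};s;q)\prod_{1\leq i<j \leq N} (x_j/x_i)^{\theta_{i,j}}\in\mathbb{Q}(s,q)[[x_2/x_1,\ldots,x_N/x_{N-1}]]. \] In the formula, $f^{A_{N-1}{\rm Toda}}(x|q^{-\theta_1}s_1,\dots,q^{-\theta_N}s_N|q)$ means this series with $s_i$ replaced by $q^{-\theta_i}s_i$. $B_N$ $q$-Toda function: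 on $\Lambda^{B_N}:=\mathbb{Q}(s,q)[[x_2/x_1,\ldots,x_N/x_{N-1},1/x_N]]$ define \[ \mathsf{D}^{B_N{\rm Toda}}(x|s|q)=\sum_{i=1}^{N-1}s_i (1-x_{i+1}/x_i)T_{q,x_i}+s_N (1-1/x_N)T_{q,x_N}+s_1^{-1}T_{q,x_1}^{-1}+\sum_{i=2}^N s_i^{-1} (1-x_i/x_{i-1})T_{q,x_i}^{-1}. \] $f^{B_N{\rm Toda}}(x|s|q)$ is the unique element of $\Lambda^{B_N}$ satisfying $\mathsf{D}^{B_N{\rm Toda}}(x|s|q)f^{B_N{\rm Toda}}=\sum_{i=1}^N(s_i+s_i^{-1})f^{B_N{\rm Toda}}$ and whose constant term (coefficient of the monomial $1$ in the $x_i$) equals $1$. *)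

theory Defs
  imports Complex_Main "HOL-Library.Groups_Big_Fun"
begin

text \<open>Conventions. Variables x_1..x_N, parameters s_1..s_N (s :: nat => 'a, indices 1..N).
A formal series in the x_i is a coefficient function F :: (nat => int) => 'a, where
F e is the coefficient of the monomial prod_{k=1..N} x_k^(e k).
The field Q(s,q) is represented by an arbitrary field of characteristic 0 containing
elements q, s_1..s_N that are algebraically independent over Z.\<close>

definition qpoch :: "'a::field \<Rightarrow> 'a \<Rightarrow> nat \<Rightarrow> 'a" where
  "qpoch a q n = (\<Prod>k<n. 1 - q ^ k * a)"

definition int_poly_eval :: "nat \<Rightarrow> ((nat \<Rightarrow> nat) \<Rightarrow> int) \<Rightarrow> (nat \<Rightarrow> 'a::field) \<Rightarrow> 'a" where
  "int_poly_eval n P v = Sum_any (\<lambda>m. of_int (P m) * (\<Prod>k\<le>n. v k ^ m k))"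

definition alg_indep :: "nat \<Rightarrow> (nat \<Rightarrow> 'a::field) \<Rightarrow> bool" where
  "alg_indep n v \<longleftrightarrow>
     (\<forall>P. finite {m. P m \<noteq> 0} \<and> (\<forall>m. P m \<noteq> 0 \<longrightarrow> (\<forall>k>n. m k = 0))
          \<and> int_poly_eval n P v = 0 \<longrightarrow> P = (\<lambda>_. 0))"

text \<open>Exponent vector of x_j/x_i, and of 1/x_N.\<close>
definition xr :: "nat \<Rightarrow> nat \<Rightarrow> nat \<Rightarrow> int" where
  "xr i j = (\<lambda>k. (if k = j then 1 else 0) - (if k = i then 1 else 0))"

definition xinv :: "nat \<Rightarrow> nat \<Rightarrow> int" where
  "xinv n = (\<lambda>k. if k = n then -1 else 0)"

definition mulmon :: "(nat \<Rightarrow> int) \<Rightarrow> ((nat \<Rightarrow> int) \<Rightarrow> 'a) \<Rightarrow> ((nat \<Rightarrow> int) \<Rightarrow> 'a)" where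
  "mulmon m F = (\<lambda>e. F (\<lambda>k. e k - m k))"

definition Tq :: "'a::field \<Rightarrow> nat \<Rightarrow> ((nat \<Rightarrow> int) \<Rightarrow> 'a) \<Rightarrow> ((nat \<Rightarrow> int) \<Rightarrow> 'a)" where
  "Tq q i F = (\<lambda>e. q powi (e i) * F e)"

definition Tqinv :: "'a::field \<Rightarrow> nat \<Rightarrow> ((nat \<Rightarrow> int) \<Rightarrow> 'a) \<Rightarrow> ((nat \<Rightarrow> int) \<Rightarrow> 'a)" where
  "Tqinv q i F = (\<lambda>e. q powi (- e i) * F e)"

text \<open>Exponent vector of the monomial u^c, u_i = x_{i+1}/x_i (i<N), u_N = 1/x_N.\<close>
definition expB :: "nat \<Rightarrow> (nat \<Rightarrow> nat) \<Rightarrow> nat \<Rightarrow> int" where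
  "expB N c = (\<lambda>k. (\<Sum>i\<in>{1..<N}. int (c i) * xr i (i+1) k) + int (c N) * xinv N k)"

text \<open>Lambda^{B_N} = Q(s,q)[[x_2/x_1,...,x_N/x_{N-1},1/x_N]]\<close>
definition LambdaB :: "nat \<Rightarrow> ((nat \<Rightarrow> int) \<Rightarrow> 'a::zero) set" where
  "LambdaB N = {F. \<forall>e. F e \<noteq> 0 \<longrightarrow> (\<exists>c. e = expB N c)}"

definition DB :: "nat \<Rightarrow> (nat \<Rightarrow> 'a::field) \<Rightarrow> 'a \<Rightarrow> ((nat \<Rightarrow> int) \<Rightarrow> 'a) \<Rightarrow> ((nat \<Rightarrow> int) \<Rightarrow> 'a)" where
  "DB N s q F = (\<lambda>e.
      (\<Sum>i\<in>{1..N-1}. s i * (Tq q i F e - mulmon (xr i (i+1)) (Tq q i F) e))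
    + s N * (Tq q N F e - mulmon (xinv N) (Tq q N F) e)
    + inverse (s 1) * Tqinv q 1 F e
    + (\<Sum>i\<in>{2..N}. inverse (s i) * (Tqinv q i F e - mulmon (xr (i-1) i) (Tqinv q i F) e)))"

definition fB :: "nat \<Rightarrow> (nat \<Rightarrow> 'a::field) \<Rightarrow> 'a \<Rightarrow> ((nat \<Rightarrow> int) \<Rightarrow> 'a)" where
  "fB N s q = (THE F. F \<in> LambdaB N
       \<and> DB N s q F = (\<lambda>e. (\<Sum>i\<in>{1..N}. s i + inverse (s i)) * F e)
       \<and> F (\<lambda>_. 0) = 1)"

definition Mset :: "nat \<Rightarrow> (nat \<Rightarrow> nat \<Rightarrow> nat) set" where
  "Mset N = {\<theta>. \<forall>i j. \<not> (1 \<le> i \<and> i < j \<and> j \<le> N) \<longrightarrow> \<theta> i j = 0}"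

definition xexpA :: "nat \<Rightarrow> (nat \<Rightarrow> nat \<Rightarrow> nat) \<Rightarrow> nat \<Rightarrow> int" where
  "xexpA N \<theta> = (\<lambda>k. \<Sum>i\<in>{1..N}. \<Sum>j\<in>{i<..N}. int (\<theta> i j) * xr i j k)"

definition cToda :: "nat \<Rightarrow> (nat \<Rightarrow> nat \<Rightarrow> nat) \<Rightarrow> (nat \<Rightarrow> 'a::field) \<Rightarrow> 'a \<Rightarrow> 'a" where
  "cToda N \<theta> s q = (\<Prod>k\<in>{2..N}. \<Prod>i\<in>{1..k-1}. \<Prod>j\<in>{i..k-1}.
      (1 / qpoch (q powi (\<Sum>a\<in>{k<..N}. int (\<theta> i a) - int (\<theta> (j+1) a)) * q * s (j+1) / s i) q (\<theta> i k))
    * (q ^ \<theta> i k / qpoch (q powi (int (\<theta> j k) - int (\<theta> i k)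
                                   - (\<Sum>a\<in>{k<..N}. int (\<theta> i a) - int (\<theta> j a))) * q * s i / s j) q (\<theta> i k)))"

text \<open>f^{A_{N-1} Toda}: coefficient of x^e is the (finite) sum of c^Toda over all theta
with prod (x_j/x_i)^theta_ij = x^e.\<close>
definition fA :: "nat \<Rightarrow> (nat \<Rightarrow> 'a::field) \<Rightarrow> 'a \<Rightarrow> ((nat \<Rightarrow> int) \<Rightarrow> 'a)" where
  "fA N s q = (\<lambda>e. Sum_any (\<lambda>\<theta>. if \<theta> \<in> Mset N \<and> xexpA N \<theta> = e then cToda N \<theta> s q else 0))"

definition Vset :: "nat \<Rightarrow> (nat \<Rightarrow> nat) set" where
  "Vset N = {\<theta>. \<forall>k. k \<notin> {1..N} \<longrightarrow> \<theta> k = 0}"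

definition eBA :: "nat \<Rightarrow> (nat \<Rightarrow> nat) \<Rightarrow> (nat \<Rightarrow> 'a::field) \<Rightarrow> 'a \<Rightarrow> 'a" where
  "eBA N \<theta> s q =
     (\<Prod>k\<in>{1..N}. q ^ ((N - k + 1) * \<theta> k) / (qpoch q q (\<theta> k) * qpoch (q / (s k)^2) q (\<theta> k)))
   * (\<Prod>i\<in>{1..N}. \<Prod>j\<in>{i<..N}.
        1 / (qpoch (q * s j / s i) q (\<theta> i) * qpoch (q powi (int (\<theta> j) - int (\<theta> i)) * q * s i / s j) q (\<theta> i))
      * (qpoch (q / (s i * s j)) q (\<theta> i + \<theta> j)
         / (qpoch (q / (s i * s j)) q (\<theta> i) * qpoch (q / (s i * s j)) q (\<theta> j))))"

end

theory Submission
  imports Defs "HOL-Computational_Algebra.Polynomial"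
begin

text \<open>Deleting the last column of \<open>\<theta>\<close> gives a branching of \<open>f\<^sup>A\<close> from \<open>n + 1\<close> to \<open>n\<close> variables of
  the same shape as the claimed branching of \<open>f\<^sup>B\<close>. In both cases the Toda operator in the larger
  rank is the one of \<open>A\<close>-type in \<open>n\<close> variables plus terms that are diagonal, plus one boundary term
  containing multiplication by \<open>1 / x\<^sub>n\<close>. That multiplication acts on \<open>f\<^sup>A\<close> by a Pieri rule
  \<open>f\<^sup>A(x | s) / x\<^sub>n = \<Sum>\<^sub>k b\<^sub>k(s) f\<^sup>A(x | \<dots>, s\<^sub>k / q, \<dots>) / x\<^sub>k\<close>, so each eigenvalue equation, and the Pieri
  rule itself, becomes a recursion for the branching coefficients. After division by the coefficient
  at \<open>\<theta>\<close> all these recursions are instances of Lagrange interpolation: at the nodes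
  \<open>t\<^sub>i = q\<^bsup>-\<theta>\<^sub>i\<^esup> s\<^sub>i\<close> for the two \<open>A\<close>-type operators, at the nodes \<open>s\<^sub>i\<close> for the Pieri rule, and at
  the nodes \<open>t\<^sub>i + 1 / t\<^sub>i\<close> for type \<open>B\<close>.\<close>

section \<open>Lagrange interpolation\<close>

text \<open>The type B operator is the sum of the two first-order type A operators (one with the
  shifts T_i, one with their inverses) minus the term (s_N / x_N) T_N, so f^A has to be an
  eigenfunction of both. Their boundary terms differ when the rank grows: the inverse operator
  produces plain multiplication by 1 / x_n, the other one produces (1 / x_n) T_n, as does type B.
  The expansion of (1 / x_n) T_n f^A comes from the Pieri rule through a commutator that uses the
  eigenvalue equation of the same rank. This fixes the logical order: the Pieri rule follows in
  every rank directly from the branching, whereas the eigenvalue equations go by induction on the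
  rank. In each case the coefficients of the functions x^(-\<theta>) f^A(x | q^(-\<theta>) s) are
  compared one by one. This shows that the right side solves the type B equation. Identifying it
  with f^B requires uniqueness, where the obstacle is resonance: another monomial could have the
  same diagonal eigenvalue as 1. Algebraic independence of q and the s_i excludes that.\<close>

lemma degree_prod_linear_le:
  fixes p :: "'b \<Rightarrow> 'a::field poly"
  assumes "finite J" "\<And>j. j \<in> J \<Longrightarrow> degree (p j) \<le> 1"
  shows "degree (\<Prod>j\<in>J. p j) \<le> card J"
proof -
  have "degree (\<Prod>j\<in>J. p j) \<le> (\<Sum>j\<in>J. degree (p j))"
    using degree_prod_sum_le[OF assms(1), of p] by (simp add: o_def)
  also have "\<dots> \<le> (\<Sum>j\<in>J. 1)" using assms(2) by (rule sum_mono)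
  finally show ?thesis by simp
qed

lemma lagrange_interpolation:
  fixes p :: "'a::field poly" and y :: "'b \<Rightarrow> 'a"
  assumes fin: "finite I" and inj: "inj_on y I" and deg: "degree p < card I"
  shows "p = (\<Sum>i\<in>I. smult (poly p (y i) / (\<Prod>j\<in>I-{i}. y i - y j)) (\<Prod>j\<in>I-{i}. [:- y j, 1:]))"
    (is "_ = ?R")
proof -
  have nz: "(\<Prod>j\<in>I-{i}. y i - y j) \<noteq> 0" if "i \<in> I" for i
    using that inj fin by (auto simp: inj_on_def)
  have "poly p x = poly ?R x" if x: "x \<in> y ` I" for x
  proof -
    obtain k where k: "k \<in> I" "x = y k" using x by auto
    have "poly ?R x = (\<Sum>i\<in>I. poly p (y i) / (\<Prod>j\<in>I-{i}. y i - y j) * (\<Prod>j\<in>I-{i}. y k - y j))"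
      by (simp add: poly_sum poly_prod k)
    also have "\<dots> = (\<Sum>i\<in>I. if i = k then poly p (y k) else 0)"
      using k nz fin by (intro sum.cong) auto
    finally show ?thesis using k fin by simp
  qed
  moreover have "degree ?R < card I"
  proof -
    have "degree ?R \<le> card I - 1"
    proof (rule degree_sum_le[OF fin])
      fix i assume "i \<in> I"
      have "degree (\<Prod>j\<in>I-{i}. [:- y j, 1:]) \<le> card (I - {i})"
        by (rule degree_prod_linear_le) (use fin in auto)
      then show "degree (smult (poly p (y i) / (\<Prod>j\<in>I-{i}. y i - y j)) (\<Prod>j\<in>I-{i}. [:- y j, 1:])) \<le> card I - 1"
        using order.trans[OF degree_smult_le] \<open>i \<in> I\<close> by (simp add: card_Diff_singleton)
    qed
    then show ?thesis using deg by linarith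
  qed
  ultimately show ?thesis
    using deg card_image[OF inj] by (intro poly_eqI_degree[of "y ` I"]) simp_all
qed

lemma coeff_prod_linear_top:
  fixes y :: "'b \<Rightarrow> 'a::field"
  assumes "finite J"
  shows "coeff (\<Prod>j\<in>J. [:- y j, 1:]) (card J) = 1"
  using assms
proof (induction J rule: finite_induct)
  case (insert a J)
  have "degree (\<Prod>j\<in>J. [:- y j, 1:]) \<le> card J"
    by (rule degree_prod_linear_le) (use insert in auto)
  then have "coeff (\<Prod>j\<in>J. [:- y j, 1:]) (Suc (card J)) = 0"
    by (simp add: coeff_eq_0)
  then show ?case using insert by simp
qed simp

lemma coeff_prod_linear_second:
  fixes y :: "'b \<Rightarrow> 'a::field"
  assumes "finite J" "card J = Suc m"
  shows "coeff (\<Prod>j\<in>J. [:- y j, 1:]) m = - (\<Sum>j\<in>J. y j)"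
  using assms
proof (induction J arbitrary: m rule: finite_induct)
  case (insert a J)
  have c: "card J = m" using insert by simp
  have top: "coeff (\<Prod>j\<in>J. [:- y j, 1:]) m = 1"
    using coeff_prod_linear_top[OF insert(1), of y] c by simp
  show ?case
  proof (cases m)
    case 0
    then have "J = {}" using c insert by simp
    then show ?thesis using 0 by simp
  next
    case (Suc l)
    have "coeff (\<Prod>j\<in>J. [:- y j, 1:]) l = - (\<Sum>j\<in>J. y j)"
      using insert.IH[of l] c Suc by simp
    then show ?thesis using insert top Suc by simp
  qed
qed simp

text \<open>Both products are monic of degree \<open>card I\<close>, so their difference has smaller
  degree and is interpolated exactly at the \<open>y i\<close>, where the second product vanishes.
  Its top coefficient and its value at 0 give the two sums that follow.\<close>

lemma lagrange_prod_diff: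
  fixes y w :: "'b \<Rightarrow> 'a::field"
  assumes fin: "finite I" and inj: "inj_on y I"
  shows "(\<Prod>j\<in>I. [:- w j, 1:]) - (\<Prod>j\<in>I. [:- y j, 1:]) =
    (\<Sum>i\<in>I. smult ((\<Prod>j\<in>I. y i - w j) / (\<Prod>j\<in>I-{i}. y i - y j)) (\<Prod>j\<in>I-{i}. [:- y j, 1:]))"
proof (cases "I = {}")
  case False
  define p where "p = (\<Prod>j\<in>I. [:- w j, 1:]) - (\<Prod>j\<in>I. [:- y j, 1:])"
  have "degree p \<le> card I"
    unfolding p_def by (intro degree_diff_le degree_prod_linear_le fin) auto
  moreover have "coeff p (card I) = 0"
    by (simp add: p_def coeff_prod_linear_top fin)
  moreover have "card I > 0" using False fin by (simp add: card_gt_0_iff)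
  ultimately have "degree p < card I"
    by (metis degree_0 le_neq_implies_less leading_coeff_0_iff)
  moreover have "poly p (y i) = (\<Prod>j\<in>I. y i - w j)" if "i \<in> I" for i
    using that fin by (auto simp: p_def poly_prod)
  ultimately show ?thesis
    using lagrange_interpolation[OF fin inj, of p] unfolding p_def by simp
qed simp

lemma lagrange_sum_diff:
  fixes y w :: "'b \<Rightarrow> 'a::field"
  assumes fin: "finite I" and inj: "inj_on y I"
  shows "(\<Sum>i\<in>I. (\<Prod>j\<in>I. y i - w j) / (\<Prod>j\<in>I-{i}. y i - y j)) = (\<Sum>i\<in>I. y i) - (\<Sum>i\<in>I. w i)"
proof (cases "I = {}")
  case False
  then obtain m where m: "card I = Suc m" using fin by (metis card_gt_0_iff gr0_conv_Suc)
  have "coeff (\<Prod>j\<in>I-{i}. [:- y j, 1:]) m = 1" if "i \<in> I" for i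
    using coeff_prod_linear_top[of "I-{i}" y] that fin m by simp
  then show ?thesis
    using arg_cong[OF lagrange_prod_diff[OF fin inj, of w], of "\<lambda>p. coeff p m"]
    by (simp add: coeff_prod_linear_second[OF fin m] coeff_sum)
qed simp

text \<open>This is the value at 0 of \<open>lagrange_prod_diff\<close>, with the common sign
  \<open>m\<close> cancelled.\<close>

lemma lagrange_sum_div:
  fixes y w :: "'b \<Rightarrow> 'a::field"
  assumes fin: "finite I" and inj: "inj_on y I" and nz: "\<And>i. i \<in> I \<Longrightarrow> y i \<noteq> 0"
  shows "(\<Sum>i\<in>I. (\<Prod>j\<in>I. y i - w j) / (\<Prod>j\<in>I-{i}. y i - y j) / y i) = 1 - (\<Prod>i\<in>I. w i / y i)"
proof -
  define m where "m = (-1::'a) ^ card I"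
  define S where "S = (\<Sum>i\<in>I. (\<Prod>j\<in>I. y i - w j) / (\<Prod>j\<in>I-{i}. y i - y j) / y i)"
  have m: "m \<noteq> 0" by (simp add: m_def)
  have pm: "(\<Prod>j\<in>J. - z j) = (-1) ^ card J * (\<Prod>j\<in>J. z j)" for J and z :: "'b \<Rightarrow> 'a"
    by (simp add: prod.distrib[symmetric] flip: prod_constant)
  have Y: "(\<Prod>j\<in>I. y j) \<noteq> 0" using nz fin by simp
  have "m * (\<Prod>j\<in>I. w j) - m * (\<Prod>j\<in>I. y j) =
     (\<Sum>i\<in>I. (\<Prod>j\<in>I. y i - w j) / (\<Prod>j\<in>I-{i}. y i - y j) * (\<Prod>j\<in>I-{i}. - y j))"
    using arg_cong[OF lagrange_prod_diff[OF fin inj, of w], of "\<lambda>p. poly p 0"]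
    by (simp add: poly_prod poly_sum pm m_def)
  also have "\<dots> = (\<Sum>i\<in>I. (\<Prod>j\<in>I. y i - w j) / (\<Prod>j\<in>I-{i}. y i - y j) / y i * (- m * (\<Prod>j\<in>I. y j)))"
  proof (rule sum.cong)
    fix i assume i: "i \<in> I"
    have "(\<Prod>j\<in>I. - y j) = - y i * (\<Prod>j\<in>I-{i}. - y j)"
      by (rule prod.remove[OF fin i])
    then have "(\<Prod>j\<in>I-{i}. - y j) = - m * (\<Prod>j\<in>I. y j) / y i"
      using nz[OF i] pm[of y I] by (simp add: m_def field_simps)
    then show "(\<Prod>j\<in>I. y i - w j) / (\<Prod>j\<in>I-{i}. y i - y j) * (\<Prod>j\<in>I-{i}. - y j)
      = (\<Prod>j\<in>I. y i - w j) / (\<Prod>j\<in>I-{i}. y i - y j) / y i * (- m * (\<Prod>j\<in>I. y j))"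
      by simp
  qed simp
  also have "\<dots> = S * (- m * (\<Prod>j\<in>I. y j))"
    by (simp only: S_def sum_distrib_right)
  finally have "m * ((\<Prod>j\<in>I. w j) - (\<Prod>j\<in>I. y j)) = m * (- S * (\<Prod>j\<in>I. y j))"
    by (simp add: algebra_simps)
  then have "(\<Prod>j\<in>I. w j) - (\<Prod>j\<in>I. y j) = - S * (\<Prod>j\<in>I. y j)"
    using m by (metis mult_left_cancel)
  then have "S = 1 - (\<Prod>j\<in>I. w j) / (\<Prod>j\<in>I. y j)"
    using Y by (simp add: field_simps)
  then show ?thesis by (simp add: S_def prod_dividef)
qed

text \<open>Passing to reciprocals reduces this to \<open>lagrange_sum_diff\<close> at the nodes
  \<open>1 / y i\<close>. Each quotient with index j different from i contributes a factor
  \<open>w j / y j\<close>, and the lone numerator factor \<open>y i - w i\<close> absorbs the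
  square of \<open>y i\<close>.\<close>

lemma lagrange_sum_div_square:
  fixes y w :: "'b \<Rightarrow> 'a::field"
  assumes fin: "finite I" and inj: "inj_on y I"
    and nz: "\<And>i. i \<in> I \<Longrightarrow> y i \<noteq> 0" and wnz: "\<And>i. i \<in> I \<Longrightarrow> w i \<noteq> 0"
  shows "(\<Sum>i\<in>I. (\<Prod>j\<in>I. y i - w j) / (\<Prod>j\<in>I-{i}. y i - y j) / (y i)\<^sup>2)
    = (\<Prod>i\<in>I. w i / y i) * ((\<Sum>i\<in>I. 1 / w i) - (\<Sum>i\<in>I. 1 / y i))"
proof -
  have inj': "inj_on (\<lambda>i. 1 / y i) I"
    using inj nz by (auto simp: inj_on_def field_simps)
  have step: "(\<Prod>j\<in>I. y i - w j) / (\<Prod>j\<in>I-{i}. y i - y j) / (y i)\<^sup>2 =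
     - (\<Prod>i\<in>I. w i / y i) * ((\<Prod>j\<in>I. 1 / y i - 1 / w j) / (\<Prod>j\<in>I-{i}. 1 / y i - 1 / y j))"
    if i: "i \<in> I" for i
  proof -
    have "(\<Prod>j\<in>I. y i - w j) / (\<Prod>j\<in>I-{i}. y i - y j)
      = (y i - w i) * (\<Prod>j\<in>I-{i}. (y i - w j) / (y i - y j))"
      by (simp add: prod.remove[OF fin i] prod_dividef)
    also have "(\<Prod>j\<in>I-{i}. (y i - w j) / (y i - y j))
       = (\<Prod>j\<in>I-{i}. w j / y j * ((1 / y i - 1 / w j) / (1 / y i - 1 / y j)))"
    proof (rule prod.cong)
      fix j assume j: "j \<in> I - {i}"
      then have "y i \<noteq> y j" "y i \<noteq> 0" "y j \<noteq> 0" "w j \<noteq> 0"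
        using inj i nz wnz by (auto simp: inj_on_def)
      then show "(y i - w j) / (y i - y j) = w j / y j * ((1 / y i - 1 / w j) / (1 / y i - 1 / y j))"
        by (simp add: divide_simps) (simp add: algebra_simps)
    qed simp
    also have "\<dots> = (\<Prod>j\<in>I-{i}. w j / y j) * ((\<Prod>j\<in>I-{i}. 1 / y i - 1 / w j) / (\<Prod>j\<in>I-{i}. 1 / y i - 1 / y j))"
      by (simp add: prod.distrib prod_dividef)
    finally have *: "(\<Prod>j\<in>I. y i - w j) / (\<Prod>j\<in>I-{i}. y i - y j) / (y i)\<^sup>2 =
       (y i - w i) / (y i)\<^sup>2 * ((\<Prod>j\<in>I-{i}. w j / y j) * ((\<Prod>j\<in>I-{i}. 1 / y i - 1 / w j) / (\<Prod>j\<in>I-{i}. 1 / y i - 1 / y j)))"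
      by simp
    have "(y i - w i) / (y i)\<^sup>2 = - (w i / y i) * (1 / y i - 1 / w i)"
      using nz[OF i] wnz[OF i] by (simp add: field_simps power2_eq_square)
    then show ?thesis
      unfolding * prod.remove[OF fin i, of "\<lambda>j. w j / y j"] prod.remove[OF fin i, of "\<lambda>j. 1 / y i - 1 / w j"]
      by simp
  qed
  have "(\<Sum>i\<in>I. (\<Prod>j\<in>I. y i - w j) / (\<Prod>j\<in>I-{i}. y i - y j) / (y i)\<^sup>2) =
    (\<Sum>i\<in>I. - (\<Prod>i\<in>I. w i / y i) * ((\<Prod>j\<in>I. 1 / y i - 1 / w j) / (\<Prod>j\<in>I-{i}. 1 / y i - 1 / y j)))"
    by (rule sum.cong[OF refl]) (rule step)
  also have "\<dots> = - (\<Prod>i\<in>I. w i / y i) * ((\<Sum>i\<in>I. 1 / y i) - (\<Sum>i\<in>I. 1 / w i))"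
    unfolding sum_distrib_left[symmetric] lagrange_sum_diff[OF fin inj', of "\<lambda>i. 1 / w i"] ..
  finally show ?thesis by (simp add: algebra_simps)
qed

text \<open>Interpolation of the polynomial with factors 1 - X / t_j at the nodes x_k, read off at X
  = 0, where it equals 1. In the Pieri rule there are n factors and n + 1 nodes.\<close>

lemma lagrange_at_zero:
  fixes x :: "'b \<Rightarrow> 'a::field" and t :: "'c \<Rightarrow> 'a"
  assumes "finite K" "inj_on x K" "finite J" "card J < card K"
    and nz: "\<And>k. k \<in> K \<Longrightarrow> x k \<noteq> 0"
  shows "(\<Sum>k\<in>K. (\<Prod>j\<in>J. 1 - x k / t j) / (\<Prod>j\<in>K-{k}. 1 - x k / x j)) = 1"
proof -
  define p where "p = (\<Prod>j\<in>J. [:1, - 1 / t j:])"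
  have "degree p \<le> card J" unfolding p_def
    by (rule degree_prod_linear_le) (use assms in auto)
  then have "degree p < card K" using assms by simp
  from arg_cong[OF lagrange_interpolation[OF assms(1,2) this], of "\<lambda>p. poly p 0"]
  have "1 = (\<Sum>k\<in>K. (\<Prod>j\<in>J. 1 - x k / t j) / (\<Prod>j\<in>K-{k}. x k - x j) * (\<Prod>j\<in>K-{k}. - x j))"
    by (simp add: p_def poly_prod poly_sum)
  also have "\<dots> = (\<Sum>k\<in>K. (\<Prod>j\<in>J. 1 - x k / t j) / (\<Prod>j\<in>K-{k}. 1 - x k / x j))"
  proof (rule sum.cong)
    fix k assume k: "k \<in> K"
    have "(\<Prod>j\<in>K-{k}. x k - x j) = (\<Prod>j\<in>K-{k}. (- x j) * (1 - x k / x j))"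
      by (rule prod.cong) (use nz in \<open>auto simp: field_simps\<close>)
    also have "\<dots> = (\<Prod>j\<in>K-{k}. - x j) * (\<Prod>j\<in>K-{k}. 1 - x k / x j)"
      by (rule prod.distrib)
    moreover have "(\<Prod>j\<in>K-{k}. - x j) \<noteq> 0" using nz assms by auto
    ultimately show "(\<Prod>j\<in>J. 1 - x k / t j) / (\<Prod>j\<in>K-{k}. x k - x j) * (\<Prod>j\<in>K-{k}. - x j)
       = (\<Prod>j\<in>J. 1 - x k / t j) / (\<Prod>j\<in>K-{k}. 1 - x k / x j)"
      by simp
  qed simp
  finally show ?thesis by simp
qed

section \<open>Branching coefficients of type A\<close>

definition shift :: "'a::field \<Rightarrow> (nat \<Rightarrow> nat) \<Rightarrow> (nat \<Rightarrow> 'a) \<Rightarrow> nat \<Rightarrow> 'a" where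
  "shift q \<theta> s = (\<lambda>i. s i / q ^ \<theta> i)"

text \<open>All integer powers of \<open>q\<close> are excluded so that the condition survives
  multiplying each parameter by its own power of \<open>q\<close> (\<open>generic_scale\<close>), as
  the branching and the Pieri rule do. It also keeps the Lagrange nodes distinct.\<close>

definition generic :: "nat \<Rightarrow> 'a::field \<Rightarrow> (nat \<Rightarrow> 'a) \<Rightarrow> bool" where
  "generic n q s \<longleftrightarrow> q \<noteq> 0 \<and> (\<forall>k>0. q ^ k \<noteq> 1) \<and> (\<forall>i\<in>{1..n}. s i \<noteq> 0) \<and>
     (\<forall>i\<in>{1..n}. \<forall>j\<in>{1..n}. i \<noteq> j \<longrightarrow> (\<forall>m::int. s i \<noteq> q powi m * s j))"

lemma genericD:
  assumes "generic n q s"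
  shows "q \<noteq> 0" "k > 0 \<Longrightarrow> q ^ k \<noteq> 1" "i \<in> {1..n} \<Longrightarrow> s i \<noteq> 0"
    "\<lbrakk>i \<in> {1..n}; j \<in> {1..n}; i \<noteq> j\<rbrakk> \<Longrightarrow> s i \<noteq> q powi m * s j"
    "\<lbrakk>i \<in> {1..n}; j \<in> {1..n}; i \<noteq> j\<rbrakk> \<Longrightarrow> s i \<noteq> s j"
    "\<lbrakk>i \<in> {1..n}; j \<in> {1..n}; i \<noteq> j\<rbrakk> \<Longrightarrow> s i \<noteq> q * s j"
proof -
  show *: "\<lbrakk>i \<in> {1..n}; j \<in> {1..n}; i \<noteq> j\<rbrakk> \<Longrightarrow> s i \<noteq> q powi m * s j" for m
    using assms by (simp add: generic_def)
  show "\<lbrakk>i \<in> {1..n}; j \<in> {1..n}; i \<noteq> j\<rbrakk> \<Longrightarrow> s i \<noteq> s j" using *[of 0] by simp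
  show "\<lbrakk>i \<in> {1..n}; j \<in> {1..n}; i \<noteq> j\<rbrakk> \<Longrightarrow> s i \<noteq> q * s j" using *[of 1] by simp
qed (use assms in \<open>auto simp: generic_def\<close>)

lemma generic_scale:
  assumes g: "generic n q s" and s': "\<And>i. i \<in> {1..n} \<Longrightarrow> \<exists>m::int. s' i = q powi m * s i"
  shows "generic n q s'"
proof -
  have q: "q \<noteq> 0" using genericD(1)[OF g] .
  have "s' i \<noteq> q powi m * s' j" if ij: "i \<in> {1..n}" "j \<in> {1..n}" "i \<noteq> j" for i j and m :: int
  proof
    assume eq: "s' i = q powi m * s' j"
    obtain a b :: int where "s' i = q powi a * s i" "s' j = q powi b * s j" using s' ij by metis
    then have "s i = q powi (m + b - a) * s j"
      using eq q by (simp add: power_int_add power_int_diff field_simps)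
    then show False using genericD(4)[OF g ij] by blast
  qed
  moreover have "s' i \<noteq> 0" if "i \<in> {1..n}" for i
    using s'[OF that] genericD(1,3)[OF g] that by auto
  ultimately show ?thesis using g by (auto simp: generic_def)
qed

lemma generic_shift:
  assumes "generic n q s" shows "generic n q (shift q \<theta> s)"
proof (rule generic_scale[OF assms])
  fix i show "\<exists>m::int. shift q \<theta> s i = q powi m * s i"
    by (rule exI[of _ "- int (\<theta> i)"]) (simp add: shift_def power_int_minus field_simps)
qed

lemma generic_fun_upd:
  assumes "generic n q s" shows "generic n q (s(k := s k / q))"
proof (rule generic_scale[OF assms])
  fix i show "\<exists>m::int. (s(k := s k / q)) i = q powi m * s i"
    by (rule exI[of _ "if i = k then - 1 else 0"]) (simp add: power_int_minus field_simps)
qed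

lemma generic_mono: "generic m q s \<Longrightarrow> n \<le> m \<Longrightarrow> generic n q s"
  by (auto simp: generic_def)

lemma generic_inj_on:
  assumes "generic m q s" "n \<le> m"
  shows "inj_on s {1..n}"
proof (rule inj_onI, rule ccontr)
  fix x y assume "x \<in> {1..n}" "y \<in> {1..n}" "s x = s y" "x \<noteq> y"
  then show False using genericD(5)[OF assms(1), of x y] assms(2) by auto
qed

lemma shift_bump: "shift q (\<theta>(k := Suc (\<theta> k))) s = (shift q \<theta> s)(k := shift q \<theta> s k / q)"
  by (auto simp: shift_def field_simps)

section \<open>Pochhammer symbols and the factors of the coefficients\<close>

lemma qpoch_0 [simp]: "qpoch a q 0 = 1"
  by (simp add: qpoch_def)

lemma qpoch_Suc: "qpoch a q (Suc n) = qpoch a q n * (1 - q ^ n * a)"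
  by (simp add: qpoch_def)

lemma qpoch_Suc_left: "qpoch a q (Suc n) = (1 - a) * qpoch (q * a) q n"
  unfolding qpoch_def prod.lessThan_Suc_shift by (simp add: mult_ac)

text \<open>The factor of a pair i < j that occurs both in \<open>branchA\<close> and in
  \<open>eBA\<close>, at a = \<theta>_i, b = \<theta>_j, x = s_i, y = s_j.\<close>

definition pairw :: "'a::field \<Rightarrow> nat \<Rightarrow> nat \<Rightarrow> 'a \<Rightarrow> 'a \<Rightarrow> 'a" where
  "pairw q a b x y = 1 / (qpoch (q * y / x) q a * qpoch (q powi (int b - int a) * q * x / y) q a)"

text \<open>The last two rules move \<open>x\<close> or \<open>y\<close> along with the exponent so that \<open>x / q ^ a\<close> and
  \<open>y / q ^ b\<close> stay fixed.\<close>

lemma pairw_lower: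
  assumes q: "q \<noteq> 0" and x: "x \<noteq> 0" and y: "y \<noteq> 0" and g: "\<And>m::int. x \<noteq> q powi m * y"
  shows "pairw q a b x y = pairw q (Suc a) b x y *
           ((1 - q ^ Suc a * y / x) * (1 - q powi (int b - int a) * x / y))"
    and "pairw q a b x y = pairw q a (Suc b) x y *
           ((1 - q ^ Suc b * x / y) / (1 - q powi (int b + 1 - int a) * x / y))"
    and "pairw q a b (x / q) y = pairw q (Suc a) b x y * ((1 - q * y / x) * (1 - q ^ b * x / y))"
    and "pairw q a b x (y / q) = pairw q a (Suc b) x y * ((1 - q ^ a * y / x) / (1 - y / x))"
proof -
  have n1: "1 - q powi m * x / y \<noteq> 0" for m
  proof
    assume "1 - q powi m * x / y = 0"
    then have "y = q powi m * x" using y by (simp add: field_simps)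
    then have "x = q powi (- m) * y" using q by (simp add: power_int_minus field_simps)
    then show False using g by blast
  qed
  have n2: "1 - q powi m * y / x \<noteq> 0" for m
    using g[of m] x by (simp add: field_simps)
  have n2': "1 - q ^ m * y / x \<noteq> 0" for m using n2[of "int m"] by simp
  have n1': "1 - q ^ m * x / y \<noteq> 0" for m using n1[of "int m"] by simp
  have e1: "q powi (int b - int (Suc a)) * q * x / y = q powi (int b - int a) * x / y"
    using q by (simp add: power_int_diff power_int_add)
  have e2: "q powi (int b - int a) * q * x / y = q * (q powi (int b - int a) * x / y)"
    by simp
  have e3: "q powi (int (Suc b) - int a) * q * x / y = q * (q powi (int b - int a) * q * x / y)"
    using q by (simp add: power_int_diff power_int_add)
  have e3': "q powi (int b + 1 - int a) * x / y = q powi (int b - int a) * q * x / y"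
    using q by (simp add: power_int_diff power_int_add)
  have e4: "q ^ a * (q powi (int b - int a) * q * x / y) = q ^ Suc b * x / y"
    using q by (simp add: power_int_diff)
  have e4': "q ^ a * (q powi (int b - int a) * x / y) = q ^ b * x / y"
    using q by (simp add: power_int_diff)
  have cancel: "1 / (A * B) = 1 / (A * u * (v * B)) * (u * v)"
     "1 / (A * B) = 1 / (u * A * (B * v)) * (u * v)" if "u \<noteq> 0" "v \<noteq> 0" for A B u v :: 'a
    using that by simp_all
  \<comment> \<open>For two symbols of equal length whose arguments differ by one factor
    \<open>q\<close>: they share everything except the first factor \<open>u\<close> of
    \<open>B\<close> and the last factor \<open>v\<close> of \<open>B'\<close>.\<close>
  have move: "1 / (A * B) = 1 / (A * B') * (v / u)" "1 / (B * A) = 1 / (B' * A) * (v / u)"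
    if "u * B' = B * v" "u \<noteq> 0" "v \<noteq> 0" for A B B' u v :: 'a
  proof -
    have B: "B = u * B' / v" using that by simp
    show "1 / (A * B) = 1 / (A * B') * (v / u)" "1 / (B * A) = 1 / (B' * A) * (v / u)"
      unfolding B by (simp_all add: mult_ac)
  qed
  have a1: "qpoch (q * y / x) q (Suc a) = qpoch (q * y / x) q a * (1 - q ^ Suc a * y / x)"
    by (simp add: qpoch_Suc mult_ac)
  \<comment> \<open>Raising \<open>a\<close> lengthens the symbol and lowers its argument by one
    power of \<open>q\<close>, so the new factor stands in front.\<close>
  have a2: "qpoch (q powi (int b - int (Suc a)) * q * x / y) q (Suc a)
     = (1 - q powi (int b - int a) * x / y) * qpoch (q powi (int b - int a) * q * x / y) q a"
    unfolding e1 qpoch_Suc_left e2 ..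
  show "pairw q a b x y = pairw q (Suc a) b x y *
           ((1 - q ^ Suc a * y / x) * (1 - q powi (int b - int a) * x / y))"
    unfolding pairw_def a1 a2 by (rule cancel(1)[OF n2' n1])
  have b1: "(1 - q powi (int b - int a) * q * x / y) * qpoch (q powi (int (Suc b) - int a) * q * x / y) q a
     = qpoch (q powi (int b - int a) * q * x / y) q a * (1 - q ^ Suc b * x / y)"
    unfolding e3 qpoch_Suc_left[symmetric] qpoch_Suc e4 ..
  have b2: "1 - q powi (int b - int a) * q * x / y \<noteq> 0" using n1[of "int b + 1 - int a"] e3' by simp
  show "pairw q a b x y = pairw q a (Suc b) x y *
           ((1 - q ^ Suc b * x / y) / (1 - q powi (int b + 1 - int a) * x / y))"
    unfolding pairw_def e3' by (rule move(1)[OF b1 b2 n1'])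
  have c1: "qpoch (q * y / x) q (Suc a) = (1 - q * y / x) * qpoch (q * y / (x / q)) q a"
    unfolding qpoch_Suc_left by (simp add: mult_ac)
  have c2: "qpoch (q powi (int b - int (Suc a)) * q * x / y) q (Suc a)
     = qpoch (q powi (int b - int a) * q * (x / q) / y) q a * (1 - q ^ b * x / y)"
    unfolding e1 qpoch_Suc e4' using q by simp
  show "pairw q a b (x / q) y = pairw q (Suc a) b x y * ((1 - q * y / x) * (1 - q ^ b * x / y))"
    unfolding pairw_def c1 c2 using n2'[of 1] by (intro cancel(2) n1') simp
  have d1: "(1 - y / x) * qpoch (q * y / x) q a = qpoch (y / x) q a * (1 - q ^ a * y / x)"
    using qpoch_Suc_left[of "y / x" q a] qpoch_Suc[of "y / x" q a] by simp
  have d2: "q * (y / q) / x = y / x" using q by simp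
  have d3: "q powi (int b - int a) * q * x / (y / q) = q powi (int (Suc b) - int a) * q * x / y"
    using q by (simp add: power_int_diff power_int_add)
  have d4: "1 - y / x \<noteq> 0" using n2[of 0] by simp
  show "pairw q a b x (y / q) = pairw q a (Suc b) x y * ((1 - q ^ a * y / x) / (1 - y / x))"
    unfolding pairw_def d2 d3 by (rule move(2)[OF d1 d4 n2'])
qed

definition pairprod :: "nat \<Rightarrow> 'a::field \<Rightarrow> (nat \<Rightarrow> 'a) \<Rightarrow> (nat \<Rightarrow> nat) \<Rightarrow> 'a" where
  "pairprod n q s \<theta> = (\<Prod>i\<in>{1..n}. \<Prod>j\<in>{i<..n}. pairw q (\<theta> i) (\<theta> j) (s i) (s j))"

text \<open>The coefficients of the expansion of \<open>1 / x\<^sub>n\<close> times an \<open>A\<close>-type Toda function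
  into Toda functions with one parameter divided by \<open>q\<close>.\<close>

definition pieri :: "nat \<Rightarrow> 'a::field \<Rightarrow> (nat \<Rightarrow> 'a) \<Rightarrow> nat \<Rightarrow> 'a" where
  "pieri n q s k = (\<Prod>j\<in>{k<..n}. q * s k * s j / ((s k - q * s j) * (s j - s k)))"

text \<open>This is the part k = n + 1 of c^Toda in rank n + 1 with last column \<theta>, where the
  inner sums over a are empty. The second symbols with j = i and the first symbols with
  \<open>s (Suc n)\<close> stand alone; the others combine to \<open>pairw\<close>. See
  \<open>cToda_append_col\<close>.\<close>

definition branchA :: "nat \<Rightarrow> 'a::field \<Rightarrow> (nat \<Rightarrow> 'a) \<Rightarrow> (nat \<Rightarrow> nat) \<Rightarrow> 'a" where
  "branchA n q s \<theta> = (\<Prod>i\<in>{1..n}. q ^ ((n - i + 1) * \<theta> i) /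
       (qpoch q q (\<theta> i) * qpoch (q * s (Suc n) / s i) q (\<theta> i))) * pairprod n q s \<theta>"

text \<open>A change at position k affects only the pairs (k, j) with j > k and (i, k) with i < k,
  and it affects these two kinds differently.\<close>

lemma prod_pairs_through:
  fixes A B :: "nat \<Rightarrow> 'a::comm_monoid_mult"
  assumes k: "k \<in> {1..n}"
  shows "(\<Prod>i\<in>{1..n}. \<Prod>j\<in>{i<..n}. if i = k then A j else if j = k then B i else 1)
    = (\<Prod>j\<in>{k<..n}. A j) * (\<Prod>i\<in>{1..<k}. B i)"
proof -
  have "(\<Prod>i\<in>{1..n}. \<Prod>j\<in>{i<..n}. if i = k then A j else if j = k then B i else 1)
    = (\<Prod>j\<in>{k<..n}. A j) *
      (\<Prod>i\<in>{1..n}-{k}. \<Prod>j\<in>{i<..n}. if i = k then A j else if j = k then B i else 1)"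
    by (subst prod.remove[OF _ k]) simp_all
  also have "(\<Prod>i\<in>{1..n}-{k}. \<Prod>j\<in>{i<..n}. if i = k then A j else if j = k then B i else 1)
    = (\<Prod>i\<in>{1..n}-{k}. if i < k then B i else 1)"
    using k by (intro prod.cong refl) (auto simp: prod.delta)
  also have "\<dots> = (\<Prod>i\<in>{1..<k}. B i)"
    using k by (intro prod.mono_neutral_cong_right) auto
  finally show ?thesis .
qed

lemma prod_remove_split:
  fixes A :: "nat \<Rightarrow> 'a::comm_monoid_mult"
  assumes "k \<in> {1..n}"
  shows "(\<Prod>j\<in>{1..n}-{k}. A j) = (\<Prod>j\<in>{k<..n}. A j) * (\<Prod>i\<in>{1..<k}. A i)"
proof -
  have split: "{1..n}-{k} = {k<..n} \<union> {1..<k}" using assms by auto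
  show ?thesis unfolding split by (rule prod.union_disjoint) auto
qed

lemma prod_change_one:
  fixes f g :: "'b \<Rightarrow> 'a::comm_monoid_mult"
  assumes "finite A" "k \<in> A" "\<And>i. i \<in> A - {k} \<Longrightarrow> f i = g i" "f k = g k * c"
  shows "prod f A = prod g A * c"
proof -
  have "prod f (A - {k}) = prod g (A - {k})" using assms(3) by (rule prod.cong[OF refl])
  then show ?thesis by (simp add: prod.remove[OF assms(1,2)] assms(4) mult_ac)
qed

text \<open>The pairs (i, k) contribute \<open>(t k - s i) / (t k - t i)\<close> by themselves, the
  pairs (k, j) do not. The product in \<open>pieri\<close> runs over just these j and turns their
  contribution into the same quotient times \<open>q\<close>. Positions before and after k then
  enter symmetrically, as an interpolation formula requires.\<close>

lemma pairprod_lower: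
  fixes s :: "nat \<Rightarrow> 'a::field" and \<theta> :: "nat \<Rightarrow> nat"
  assumes g: "generic n q s" and k: "k \<in> {1..n}"
  defines "\<eta> \<equiv> \<theta>(k := Suc (\<theta> k))"
  defines "t \<equiv> shift q \<eta> s"
  shows "pieri n q (shift q \<theta> s) k * pairprod n q s \<theta> =
    pairprod n q s \<eta> * (q ^ (n - k) * (\<Prod>j\<in>{1..n}-{k}. (t k - s j) / (t k - t j)))"
proof -
  have q: "q \<noteq> 0" using genericD[OF g] by simp
  have gt: "generic n q t" unfolding t_def by (rule generic_shift[OF g])
  have tk: "shift q \<theta> s k = q * t k" using q by (simp add: t_def \<eta>_def shift_bump)
  have tj: "shift q \<theta> s j = t j" if "j \<noteq> k" for j using that by (simp add: t_def \<eta>_def shift_bump)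
  have sk: "s k \<noteq> 0" "t k \<noteq> 0" using genericD(3)[OF g k] genericD(3)[OF gt k] by simp_all
  define A where "A j = (1 - s j / t k) * (1 - q * t k / t j)" for j
  define B where "B j = (1 - s j / t k) / (1 - t j / t k)" for j
  have *: "pairw q (\<theta> i) (\<theta> j) (s i) (s j) = pairw q (\<eta> i) (\<eta> j) (s i) (s j) *
      (if i = k then A j else if j = k then B i else 1)"
    if ij: "i \<in> {1..n}" "j \<in> {i<..n}" for i j
  proof -
    have ne: "s i \<noteq> 0" "s j \<noteq> 0" "\<And>m::int. s i \<noteq> q powi m * s j"
      using genericD(3)[OF g, of i] genericD(3)[OF g, of j] genericD(4)[OF g, of i j] ij by auto
    consider "i = k" "j \<noteq> k" | "j = k" "i \<noteq> k" | "i \<noteq> k" "j \<noteq> k" using ij by force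
    then show ?thesis
    proof cases
      case 1
      have "q ^ Suc (\<theta> k) * s j / s k = s j / t k"
        by (simp add: t_def shift_def \<eta>_def)
      moreover have "q powi (int (\<theta> j) - int (\<theta> k)) * s k / s j = q * t k / t j"
        using 1 q by (simp add: t_def shift_def \<eta>_def power_int_diff)
      ultimately show ?thesis
        using pairw_lower(1)[OF q ne, of "\<theta> k" "\<theta> j"] 1 by (simp add: \<eta>_def A_def)
    next
      case 2
      have "q ^ Suc (\<theta> k) * s i / s k = s i / t k"
        by (simp add: t_def shift_def \<eta>_def)
      moreover have "q powi (int (\<theta> k) + 1 - int (\<theta> i)) * s i / s k = t i / t k"
        using 2 q by (simp add: t_def shift_def \<eta>_def power_int_diff power_int_add)
      ultimately show ?thesis
        using pairw_lower(2)[OF q ne, of "\<theta> i" "\<theta> k"] 2 by (simp add: \<eta>_def B_def)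
    qed (simp add: \<eta>_def)
  qed
  have "pairprod n q s \<theta> = (\<Prod>i\<in>{1..n}. \<Prod>j\<in>{i<..n}. pairw q (\<eta> i) (\<eta> j) (s i) (s j) *
      (if i = k then A j else if j = k then B i else 1))"
    unfolding pairprod_def by (intro prod.cong refl *)
  also have "\<dots> = pairprod n q s \<eta> * ((\<Prod>j\<in>{k<..n}. A j) * (\<Prod>i\<in>{1..<k}. B i))"
    by (simp only: prod.distrib pairprod_def prod_pairs_through[OF k])
  finally have "pairprod n q s \<theta> = pairprod n q s \<eta> * ((\<Prod>j\<in>{k<..n}. A j) * (\<Prod>i\<in>{1..<k}. B i))" .
  moreover have P: "pieri n q (shift q \<theta> s) k = (\<Prod>j\<in>{k<..n}. q * (q * t k) * t j / ((q * t k - q * t j) * (t j - q * t k)))"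
    by (simp add: pieri_def tk tj)
  ultimately have "pieri n q (shift q \<theta> s) k * pairprod n q s \<theta> = pairprod n q s \<eta> *
     ((\<Prod>j\<in>{k<..n}. q * (q * t k) * t j / ((q * t k - q * t j) * (t j - q * t k)) * A j) * (\<Prod>i\<in>{1..<k}. B i))"
    by (simp only: P prod.distrib mult_ac)
  also have "(\<Prod>j\<in>{k<..n}. q * (q * t k) * t j / ((q * t k - q * t j) * (t j - q * t k)) * A j)
     = (\<Prod>j\<in>{k<..n}. q * ((t k - s j) / (t k - t j)))"
  proof (rule prod.cong)
    fix j assume "j \<in> {k<..n}"
    then have j: "j \<in> {1..n}" "j \<noteq> k" using k by auto
    have ne: "t k - t j \<noteq> 0" "t j - q * t k \<noteq> 0" "t j \<noteq> 0"
      using genericD(5,6)[OF gt j(1) k] genericD(3)[OF gt j(1)] j by auto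
    have "A j = (t k - s j) / t k * ((t j - q * t k) / t j)"
      using ne sk by (simp add: A_def field_simps)
    moreover have "(q * t k - q * t j) = q * (t k - t j)" by (simp add: algebra_simps)
    ultimately show "q * (q * t k) * t j / ((q * t k - q * t j) * (t j - q * t k)) * A j = q * ((t k - s j) / (t k - t j))"
      using ne sk q by simp
  qed simp
  also have "\<dots> = q ^ (n - k) * (\<Prod>j\<in>{k<..n}. (t k - s j) / (t k - t j))"
    by (simp only: prod.distrib) simp
  also have "(\<Prod>i\<in>{1..<k}. B i) = (\<Prod>j\<in>{1..<k}. (t k - s j) / (t k - t j))"
  proof (rule prod.cong)
    fix j assume "j \<in> {1..<k}"
    then have j: "j \<in> {1..n}" "j \<noteq> k" using k by auto
    have "t k - t j \<noteq> 0" using genericD(5)[OF gt j(1) k] j by auto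
    moreover have "1 - s j / t k = (t k - s j) / t k" "1 - t j / t k = (t k - t j) / t k"
      using sk by (simp_all add: field_simps)
    ultimately show "B j = (t k - s j) / (t k - t j)" using sk by (simp add: B_def)
  qed simp
  finally show ?thesis
    by (simp only: prod_remove_split[OF k] mult.assoc)
qed

text \<open>Serves both types: c is \<open>s (Suc n) / s k\<close> in \<open>branchA_lower\<close>
  and the inverse square of \<open>s k\<close> in \<open>eBA_lower\<close>.\<close>

lemma single_factor_lower:
  fixes q c :: "'a::field"
  assumes "q \<noteq> 0" "q ^ Suc a \<noteq> 1" "1 - q ^ Suc a * c \<noteq> 0"
  shows "q ^ (m * a) / (qpoch q q a * qpoch (q * c) q a) =
    q ^ (m * Suc a) / (qpoch q q (Suc a) * qpoch (q * c) q (Suc a)) * ((1 - q ^ Suc a) * (1 - q ^ Suc a * c) / q ^ m)"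
proof -
  have 1: "qpoch q q (Suc a) = qpoch q q a * (1 - q ^ Suc a)"
    "qpoch (q * c) q (Suc a) = qpoch (q * c) q a * (1 - q ^ Suc a * c)"
    by (simp_all add: qpoch_Suc mult_ac)
  have 2: "q ^ (m * Suc a) = q ^ (m * a) * q ^ m"
    by (simp add: power_add[symmetric] algebra_simps)
  have "E / (X * Y) = E * P / (X * u * (Y * v)) * (u * v / P)"
    if "P \<noteq> 0" "u \<noteq> 0" "v \<noteq> 0" for E X Y P u v :: 'a
    using that by simp
  then show ?thesis unfolding 1 2 using assms by auto
qed

text \<open>The symbol \<open>qpoch q q\<close> supplies the factor \<open>t k - s k\<close> missing
  from \<open>pairprod_lower\<close> and so completes the Lagrange weight at the node
  \<open>t k\<close>. The symbol with \<open>s (Suc n)\<close> leaves the extra factor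
  \<open>t k - s (Suc n)\<close>, and the powers of \<open>q\<close> cancel up to one.\<close>

lemma branchA_lower:
  fixes s :: "nat \<Rightarrow> 'a::field" and \<theta> :: "nat \<Rightarrow> nat"
  assumes g: "generic (Suc n) q s" and k: "k \<in> {1..n}"
  defines "\<eta> \<equiv> \<theta>(k := Suc (\<theta> k))"
  defines "t \<equiv> shift q \<eta> s"
  shows "pieri n q (shift q \<theta> s) k * branchA n q s \<theta> = branchA n q s \<eta> *
    ((t k - s (Suc n)) / (q * (t k)\<^sup>2) * ((\<Prod>j\<in>{1..n}. t k - s j) / (\<Prod>j\<in>{1..n}-{k}. t k - t j)))"
proof -
  have gn: "generic n q s" using generic_mono[OF g] by simp
  have q: "q \<noteq> 0" using genericD[OF g] by simp
  have gt: "generic (Suc n) q t" unfolding t_def by (rule generic_shift[OF g])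
  have sk: "s k \<noteq> 0" "t k \<noteq> 0" using genericD(3)[OF g, of k] genericD(3)[OF gt, of k] k by simp_all
  define u where "u i a = q ^ ((n - i + 1) * a) / (qpoch q q a * qpoch (q * s (Suc n) / s i) q a)" for i a
  have qk: "q ^ Suc (\<theta> k) = s k / t k" using sk q by (simp add: t_def shift_def \<eta>_def)
  have "s k \<noteq> q powi int (Suc (\<theta> k)) * s (Suc n)" using genericD(4)[OF g, of k "Suc n"] k by auto
  then have "1 - q ^ Suc (\<theta> k) * (s (Suc n) / s k) \<noteq> 0"
    using sk by (simp only: power_int_of_nat) (simp add: field_simps)
  then have "u k (\<theta> k) = u k (Suc (\<theta> k)) * ((1 - q ^ Suc (\<theta> k)) * (1 - q ^ Suc (\<theta> k) * (s (Suc n) / s k)) / q ^ (n - k + 1))"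
    using single_factor_lower[OF q genericD(2)[OF g, of "Suc (\<theta> k)"], of "s (Suc n) / s k" "n - k + 1"]
    unfolding u_def times_divide_eq_right by simp
  then have "(\<Prod>i\<in>{1..n}. u i (\<theta> i)) = (\<Prod>i\<in>{1..n}. u i (\<eta> i)) *
      ((1 - q ^ Suc (\<theta> k)) * (1 - q ^ Suc (\<theta> k) * (s (Suc n) / s k)) / q ^ (n - k + 1))"
    by (intro prod_change_one[of _ k] k) (auto simp: \<eta>_def)
  also have "1 - q ^ Suc (\<theta> k) = (t k - s k) / t k"
    unfolding qk using sk by (simp add: field_simps)
  also have "1 - q ^ Suc (\<theta> k) * (s (Suc n) / s k) = (t k - s (Suc n)) / t k"
    unfolding qk using sk by (simp add: field_simps)
  finally have U: "(\<Prod>i\<in>{1..n}. u i (\<theta> i)) = (\<Prod>i\<in>{1..n}. u i (\<eta> i)) *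
      ((t k - s k) / t k * ((t k - s (Suc n)) / t k) / q ^ (n - k + 1))" .
  have "pieri n q (shift q \<theta> s) k * branchA n q s \<theta> =
     (\<Prod>i\<in>{1..n}. u i (\<theta> i)) * (pieri n q (shift q \<theta> s) k * pairprod n q s \<theta>)"
    by (simp add: branchA_def u_def)
  also have "\<dots> = branchA n q s \<eta> * ((t k - s k) / t k * ((t k - s (Suc n)) / t k) / q ^ (n - k + 1) *
      (q ^ (n - k) * (\<Prod>j\<in>{1..n}-{k}. (t k - s j) / (t k - t j))))"
    unfolding pairprod_lower[OF gn k, of \<theta>, folded \<eta>_def, folded t_def] U
    by (simp add: branchA_def u_def mult_ac)
  also have "(t k - s k) / t k * ((t k - s (Suc n)) / t k) / q ^ (n - k + 1) *
      (q ^ (n - k) * (\<Prod>j\<in>{1..n}-{k}. (t k - s j) / (t k - t j)))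
    = (t k - s (Suc n)) / (q * (t k)\<^sup>2) * ((t k - s k) * (\<Prod>j\<in>{1..n}-{k}. (t k - s j) / (t k - t j)))"
  proof -
    have "a / x * (b / x) / (q * Q) * (Q * R) = b / (q * x\<^sup>2) * (a * R)" if "Q \<noteq> 0" for a b x Q R :: 'a
      using that by (simp add: power2_eq_square mult_ac)
    from this[of "q ^ (n - k)"] show ?thesis using q by simp
  qed
  also have "(t k - s k) * (\<Prod>j\<in>{1..n}-{k}. (t k - s j) / (t k - t j)) =
     (\<Prod>j\<in>{1..n}. t k - s j) / (\<Prod>j\<in>{1..n}-{k}. t k - t j)"
    using prod.remove[OF _ k, of "\<lambda>j. t k - s j"] by (simp add: prod_dividef)
  finally show ?thesis .
qed

lemma pairprod_cong:
  assumes "\<And>i. i \<in> {1..n} \<Longrightarrow> s i = s' i"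
  shows "pairprod n q s \<theta> = pairprod n q s' \<theta>"
  unfolding pairprod_def using assms by (intro prod.cong refl) auto

text \<open>The parameter s_k / q with \<theta> and the parameter s_k with \<eta> have the same
  shift \<open>t\<close>, so \<open>t\<close> stays fixed and the \<open>s k\<close> become the
  nodes. The second factor on the right is the weight of \<open>lagrange_at_zero\<close> at
  \<open>s k\<close> for the polynomial with zeros \<open>t j\<close>.\<close>

lemma branchA_shift_lower:
  fixes s :: "nat \<Rightarrow> 'a::field" and \<theta> :: "nat \<Rightarrow> nat"
  assumes g: "generic (Suc n) q s" and k: "k \<in> {1..n}"
  defines "\<eta> \<equiv> \<theta>(k := Suc (\<theta> k))"
  defines "t \<equiv> shift q \<eta> s"
  shows "pieri (Suc n) q s k * branchA n q (s(k := s k / q)) \<theta> = branchA n q s \<eta> *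
    ((\<Prod>j\<in>{1..n}. 1 - s k / t j) / (\<Prod>j\<in>{1..Suc n}-{k}. 1 - s k / s j))"
proof -
  let ?s = "s(k := s k / q)" and ?\<sigma> = "s (Suc n)"
  have q: "q \<noteq> 0" using genericD[OF g] by simp
  have gt: "generic (Suc n) q t" unfolding t_def by (rule generic_shift[OF g])
  have sk: "s k \<noteq> 0" "t k \<noteq> 0" using genericD(3)[OF g, of k] genericD(3)[OF gt, of k] k by simp_all
  have kn: "k \<noteq> Suc n" using k by simp
  define A where "A j = (1 - q * s j / s k) * (1 - s k / t j)" for j
  define B where "B j = (1 - s k / t j) / (1 - s k / s j)" for j
  have ne: "1 - q * s j / s k \<noteq> 0" "1 - s k / s j \<noteq> 0"
    if "j \<in> {1..Suc n}" "j \<noteq> k" for j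
    using genericD(5,6)[OF g, of k j] genericD(3)[OF g that(1)] that k sk by auto
  have *: "pairw q (\<theta> i) (\<theta> j) (?s i) (?s j) = pairw q (\<eta> i) (\<eta> j) (s i) (s j) *
      (if i = k then A j else if j = k then B i else 1)"
    if ij: "i \<in> {1..n}" "j \<in> {i<..n}" for i j
  proof -
    have ne: "s i \<noteq> 0" "s j \<noteq> 0" "\<And>m::int. s i \<noteq> q powi m * s j"
      using genericD(3)[OF g, of i] genericD(3)[OF g, of j] genericD(4)[OF g, of i j] ij by auto
    consider "i = k" "j \<noteq> k" | "j = k" "i \<noteq> k" | "i \<noteq> k" "j \<noteq> k" using ij by force
    then show ?thesis
    proof cases
      case 1
      have "q ^ \<theta> j * s k / s j = s k / t j"
        using 1 by (simp add: t_def shift_def \<eta>_def)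
      then show ?thesis
        using pairw_lower(3)[OF q ne, of "\<theta> k" "\<theta> j"] 1 by (simp add: \<eta>_def A_def)
    next
      case 2
      have "q ^ \<theta> i * s k / s i = s k / t i"
        using 2 by (simp add: t_def shift_def \<eta>_def)
      then show ?thesis
        using pairw_lower(4)[OF q ne, of "\<theta> i" "\<theta> k"] 2 by (simp add: \<eta>_def B_def)
    qed (simp add: \<eta>_def)
  qed
  have "pairprod n q ?s \<theta> = (\<Prod>i\<in>{1..n}. \<Prod>j\<in>{i<..n}. pairw q (\<eta> i) (\<eta> j) (s i) (s j) *
      (if i = k then A j else if j = k then B i else 1))"
    unfolding pairprod_def by (intro prod.cong refl *)
  also have "\<dots> = pairprod n q s \<eta> * ((\<Prod>j\<in>{k<..n}. A j) * (\<Prod>i\<in>{1..<k}. B i))"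
    by (simp only: prod.distrib pairprod_def prod_pairs_through[OF k])
  finally have W: "pairprod n q ?s \<theta> = pairprod n q s \<eta> * ((\<Prod>j\<in>{k<..n}. A j) * (\<Prod>i\<in>{1..<k}. B i))" .
  define u where "u s i a = q ^ ((n - i + 1) * a) / (qpoch q q a * qpoch (q * s (Suc n) / s i) q a)"
    for s :: "nat \<Rightarrow> 'a" and i a
  define c where "c = (1 - s k / t k) * (1 - q * ?\<sigma> / s k) / q ^ (n - k + 1)"
  have uk: "u ?s k (\<theta> k) = u s k (Suc (\<theta> k)) * c"
  proof -
    have qk: "q ^ Suc (\<theta> k) = s k / t k" using sk q by (simp add: t_def shift_def \<eta>_def)
    have 1: "qpoch q q (Suc (\<theta> k)) = qpoch q q (\<theta> k) * (1 - s k / t k)"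
      "qpoch (q * ?\<sigma> / s k) q (Suc (\<theta> k)) = (1 - q * ?\<sigma> / s k) * qpoch (q * ?s (Suc n) / ?s k) q (\<theta> k)"
      unfolding qk[symmetric] qpoch_Suc_left[of "q * ?\<sigma> / s k"] qpoch_Suc[of q] using kn by (simp_all add: mult_ac)
    have 2: "q ^ ((n - k + 1) * Suc (\<theta> k)) = q ^ ((n - k + 1) * \<theta> k) * q ^ (n - k + 1)"
      by (simp add: power_add[symmetric] algebra_simps)
    have "E / (X * Y) = E * P / (X * u * (v * Y)) * (u * v / P)"
      if "P \<noteq> 0" "u \<noteq> 0" "v \<noteq> 0" for E X Y P u v :: 'a
      using that by simp
    moreover have "1 - s k / t k \<noteq> 0" using genericD(2)[OF g, of "Suc (\<theta> k)"] qk by simp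
    moreover have "1 - q * ?\<sigma> / s k \<noteq> 0" using ne(1)[of "Suc n"] kn by simp
    ultimately show ?thesis unfolding u_def 1 2 c_def using q by auto
  qed
  have U: "(\<Prod>i\<in>{1..n}. u ?s i (\<theta> i)) = (\<Prod>i\<in>{1..n}. u s i (\<eta> i)) * c"
    by (rule prod_change_one[of _ k]) (use uk k kn in \<open>auto simp: \<eta>_def u_def\<close>)
  have "pieri (Suc n) q s k = (\<Prod>j\<in>{k<..Suc n}. q * (1 / ((1 - q * s j / s k) * (1 - s k / s j))))"
    unfolding pieri_def
  proof (rule prod.cong)
    fix j assume "j \<in> {k<..Suc n}"
    then have j: "j \<in> {1..Suc n}" "j \<noteq> k" using k by auto
    then have sj: "s j \<noteq> 0" using genericD(3)[OF g] by blast
    have "s k - q * s j = s k * (1 - q * s j / s k)" "s j - s k = s j * (1 - s k / s j)"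
      using sk sj by (simp_all add: field_simps)
    then show "q * s k * s j / ((s k - q * s j) * (s j - s k)) = q * (1 / ((1 - q * s j / s k) * (1 - s k / s j)))"
      using sk sj by simp
  qed simp
  also have "\<dots> = q ^ (n - k + 1) * (\<Prod>j\<in>{k<..Suc n}. 1 / ((1 - q * s j / s k) * (1 - s k / s j)))"
    using k by (simp only: prod.distrib) (simp add: Suc_diff_le)
  \<comment> \<open>The factor j = n + 1 is split off because it belongs to no pair; it meets the
    symbol with \<open>s (Suc n)\<close>, which entered through \<open>c\<close>.\<close>
  also have "(\<Prod>j\<in>{k<..Suc n}. 1 / ((1 - q * s j / s k) * (1 - s k / s j))) =
     (\<Prod>j\<in>{k<..n}. 1 / ((1 - q * s j / s k) * (1 - s k / s j))) * (1 / ((1 - q * ?\<sigma> / s k) * (1 - s k / ?\<sigma>)))"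
  proof -
    have *: "{k<..Suc n} = insert (Suc n) {k<..n}" using k by auto
    show ?thesis unfolding * by (subst prod.insert) simp_all
  qed
  finally have P: "pieri (Suc n) q s k = q ^ (n - k + 1) *
     ((\<Prod>j\<in>{k<..n}. 1 / ((1 - q * s j / s k) * (1 - s k / s j))) * (1 / ((1 - q * ?\<sigma> / s k) * (1 - s k / ?\<sigma>))))" .
  \<comment> \<open>Again \<open>pieri\<close> turns the factor of the pairs (k, j) into that of the
    pairs (i, k).\<close>
  have PA: "(\<Prod>j\<in>{k<..n}. 1 / ((1 - q * s j / s k) * (1 - s k / s j))) * (\<Prod>j\<in>{k<..n}. A j) = (\<Prod>j\<in>{k<..n}. B j)"
    unfolding prod.distrib[symmetric]
  proof (rule prod.cong)
    fix j assume "j \<in> {k<..n}"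
    then have "1 - q * s j / s k \<noteq> 0" using ne(1)[of j] k by simp
    moreover have "1 / (u * v) * (u * w) = w / v" if "u \<noteq> 0" for u v w :: 'a using that by simp
    ultimately show "1 / ((1 - q * s j / s k) * (1 - s k / s j)) * A j = B j"
      unfolding A_def B_def by blast
  qed simp
  have "pieri (Suc n) q s k * branchA n q ?s \<theta> = pieri (Suc n) q s k * ((\<Prod>i\<in>{1..n}. u ?s i (\<theta> i)) * pairprod n q ?s \<theta>)"
    by (simp add: branchA_def u_def)
  also have "\<dots> = branchA n q s \<eta> * ((q ^ (n - k + 1) * (1 / ((1 - q * ?\<sigma> / s k) * (1 - s k / ?\<sigma>))) * c) *
     (((\<Prod>j\<in>{k<..n}. 1 / ((1 - q * s j / s k) * (1 - s k / s j))) * (\<Prod>j\<in>{k<..n}. A j)) * (\<Prod>i\<in>{1..<k}. B i)))"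
    unfolding U W P by (simp add: branchA_def u_def mult_ac)
  also have "q ^ (n - k + 1) * (1 / ((1 - q * ?\<sigma> / s k) * (1 - s k / ?\<sigma>))) * c = (1 - s k / t k) / (1 - s k / ?\<sigma>)"
  proof -
    have "P * (1 / (v * w)) * (u * v / P) = u / w" if "P \<noteq> 0" "v \<noteq> 0" for P u v w :: 'a
      using that by simp
    moreover have "1 - q * ?\<sigma> / s k \<noteq> 0" using ne(1)[of "Suc n"] kn by simp
    ultimately show ?thesis unfolding c_def using q by auto
  qed
  also have "((\<Prod>j\<in>{k<..n}. 1 / ((1 - q * s j / s k) * (1 - s k / s j))) * (\<Prod>j\<in>{k<..n}. A j)) * (\<Prod>i\<in>{1..<k}. B i)
     = (\<Prod>j\<in>{1..n}-{k}. B j)"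
    unfolding PA prod_remove_split[OF k] ..
  also have "(1 - s k / t k) / (1 - s k / ?\<sigma>) * (\<Prod>j\<in>{1..n}-{k}. B j) =
     (\<Prod>j\<in>{1..n}. 1 - s k / t j) / (\<Prod>j\<in>{1..Suc n}-{k}. 1 - s k / s j)"
  proof -
    have 1: "{1..Suc n}-{k} = insert (Suc n) ({1..n}-{k})" using kn by auto
    have "(\<Prod>j\<in>{1..Suc n}-{k}. 1 - s k / s j) = (1 - s k / ?\<sigma>) * (\<Prod>j\<in>{1..n}-{k}. 1 - s k / s j)"
      unfolding 1 by (subst prod.insert) simp_all
    moreover have "(\<Prod>j\<in>{1..n}. 1 - s k / t j) = (1 - s k / t k) * (\<Prod>j\<in>{1..n}-{k}. 1 - s k / t j)"
      by (rule prod.remove[OF _ k]) simp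
    ultimately show ?thesis by (simp add: B_def prod_dividef)
  qed
  finally show ?thesis .
qed

text \<open>This is the weight at the remaining node \<open>s (Suc n)\<close>. That parameter is not
  among the first n, so no entry of \<eta> moves and only the symbols with \<open>s (Suc n)\<close>
  change; each telescopes to a quotient of two linear factors.\<close>

lemma branchA_shift_last:
  fixes s :: "nat \<Rightarrow> 'a::field" and \<eta> :: "nat \<Rightarrow> nat"
  assumes g: "generic (Suc n) q s"
  defines "t \<equiv> shift q \<eta> s"
  shows "branchA n q (s(Suc n := s (Suc n) / q)) \<eta> = branchA n q s \<eta> *
    ((\<Prod>j\<in>{1..n}. 1 - s (Suc n) / t j) / (\<Prod>j\<in>{1..n}. 1 - s (Suc n) / s j))"
proof -
  let ?\<sigma> = "s (Suc n)"
  have q: "q \<noteq> 0" using genericD[OF g] by simp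
  have gt: "generic (Suc n) q t" unfolding t_def by (rule generic_shift[OF g])
  have "q ^ ((n - i + 1) * \<eta> i) / (qpoch q q (\<eta> i) * qpoch (q * (?\<sigma> / q) / s i) q (\<eta> i)) =
     q ^ ((n - i + 1) * \<eta> i) / (qpoch q q (\<eta> i) * qpoch (q * ?\<sigma> / s i) q (\<eta> i)) *
     ((1 - ?\<sigma> / t i) / (1 - ?\<sigma> / s i))" if i: "i \<in> {1..n}" for i
  proof -
    have si: "s i \<noteq> 0" "s i \<noteq> ?\<sigma>"
      using genericD(3)[OF g, of i] genericD(5)[OF g, of i "Suc n"] i by auto
    have "s i \<noteq> q powi (int (\<eta> i)) * ?\<sigma>" using i by (intro genericD(4)[OF g]) auto
    then have ti: "1 - ?\<sigma> / t i \<noteq> 0"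
      unfolding t_def shift_def using si by (simp add: field_simps)
    have "1 - ?\<sigma> / s i \<noteq> 0" using si by simp
    moreover have "q ^ \<eta> i * (?\<sigma> / s i) = ?\<sigma> / t i" by (simp add: t_def shift_def)
    then have "(1 - ?\<sigma> / s i) * qpoch (q * ?\<sigma> / s i) q (\<eta> i) = qpoch (?\<sigma> / s i) q (\<eta> i) * (1 - ?\<sigma> / t i)"
      using qpoch_Suc_left[of "?\<sigma> / s i" q "\<eta> i"] qpoch_Suc[of "?\<sigma> / s i" q "\<eta> i"] by simp
    moreover have "E / (A * B) = E / (A * B') * (v / u)" if "u * B' = B * v" "u \<noteq> 0" "v \<noteq> 0" for E A B B' u v :: 'a
    proof -
      have B: "B = u * B' / v" using that by simp
      show ?thesis unfolding B by (simp add: mult_ac)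
    qed
    moreover have "q * (?\<sigma> / q) / s i = ?\<sigma> / s i" using q by simp
    ultimately show ?thesis using ti by (simp only:)
  qed
  then have "(\<Prod>i\<in>{1..n}. q ^ ((n - i + 1) * \<eta> i) / (qpoch q q (\<eta> i) * qpoch (q * (?\<sigma> / q) / s i) q (\<eta> i))) =
    (\<Prod>i\<in>{1..n}. q ^ ((n - i + 1) * \<eta> i) / (qpoch q q (\<eta> i) * qpoch (q * ?\<sigma> / s i) q (\<eta> i)) *
     ((1 - ?\<sigma> / t i) / (1 - ?\<sigma> / s i)))"
    by (rule prod.cong[OF refl])
  also have "\<dots> = (\<Prod>i\<in>{1..n}. q ^ ((n - i + 1) * \<eta> i) / (qpoch q q (\<eta> i) * qpoch (q * ?\<sigma> / s i) q (\<eta> i))) *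
    ((\<Prod>j\<in>{1..n}. 1 - ?\<sigma> / t j) / (\<Prod>j\<in>{1..n}. 1 - ?\<sigma> / s j))"
    by (simp only: prod.distrib prod_dividef)
  moreover have "pairprod n q (s(Suc n := ?\<sigma> / q)) \<eta> = pairprod n q s \<eta>"
    by (rule pairprod_cong) auto
  moreover have "branchA n q (s(Suc n := ?\<sigma> / q)) \<eta> =
     (\<Prod>i\<in>{1..n}. q ^ ((n - i + 1) * \<eta> i) / (qpoch q q (\<eta> i) * qpoch (q * (?\<sigma> / q) / s i) q (\<eta> i)))
     * pairprod n q (s(Suc n := ?\<sigma> / q)) \<eta>"
    unfolding branchA_def by (rule arg_cong2[of _ _ _ _ "(*)"]) (auto intro!: prod.cong)
  ultimately show ?thesis by (simp add: branchA_def mult_ac)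
qed

section \<open>Summed recursions for the type A coefficients\<close>

lemma bump_lower: "\<eta> k \<noteq> 0 \<Longrightarrow> (\<eta>(k := \<eta> k - 1))(k := Suc ((\<eta>(k := \<eta> k - 1)) k)) = (\<eta> :: nat \<Rightarrow> nat)"
  by auto

lemma sum_branchA_shift:
  fixes s :: "nat \<Rightarrow> 'a::field" and \<eta> :: "nat \<Rightarrow> nat"
  assumes g: "generic (Suc n) q s"
  shows "(\<Sum>k\<in>{1..n}. if \<eta> k = 0 then 0 else
      pieri (Suc n) q s k * branchA n q (s(k := s k / q)) (\<eta>(k := \<eta> k - 1)))
    + branchA n q (s(Suc n := s (Suc n) / q)) \<eta> = branchA n q s \<eta>"
proof -
  define t where "t = shift q \<eta> s"
  define L where "L k = (\<Prod>j\<in>{1..n}. 1 - s k / t j) / (\<Prod>j\<in>{1..Suc n}-{k}. 1 - s k / s j)" for k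
  have "(if \<eta> k = 0 then 0 else pieri (Suc n) q s k * branchA n q (s(k := s k / q)) (\<eta>(k := \<eta> k - 1)))
     = branchA n q s \<eta> * L k" if k: "k \<in> {1..n}" for k
  proof (cases "\<eta> k = 0")
    case True
    \<comment> \<open>For \<open>\<eta> k = 0\<close> the weight vanishes by itself, since
      \<open>t k = s k\<close>. The absent summand can therefore be included in the interpolation
      sum.\<close>
    then have "1 - s k / t k = 0" using genericD(3)[OF g, of k] k by (simp add: t_def shift_def)
    then have "L k = 0" unfolding L_def using k by (auto intro!: prod_zero)
    then show ?thesis using True by simp
  next
    case False
    show ?thesis
      using branchA_shift_lower[OF g k, of "\<eta>(k := \<eta> k - 1)", unfolded bump_lower[of \<eta> k, OF False]] False
      by (simp add: L_def t_def)
  qed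
  moreover have "branchA n q (s(Suc n := s (Suc n) / q)) \<eta> = branchA n q s \<eta> * L (Suc n)"
  proof -
    have "{1..Suc n} - {Suc n} = {1..n}" by auto
    then show ?thesis using branchA_shift_last[OF g, of \<eta>] by (simp only: L_def t_def)
  qed
  ultimately have "(\<Sum>k\<in>{1..n}. if \<eta> k = 0 then 0 else
      pieri (Suc n) q s k * branchA n q (s(k := s k / q)) (\<eta>(k := \<eta> k - 1)))
    + branchA n q (s(Suc n := s (Suc n) / q)) \<eta> = branchA n q s \<eta> * (\<Sum>k\<in>{1..Suc n}. L k)"
    by (simp add: sum_distrib_left distrib_left)
  also have "(\<Sum>k\<in>{1..Suc n}. L k) = 1"
    unfolding L_def
    by (rule lagrange_at_zero) (use genericD(3)[OF g] generic_inj_on[OF g] in auto)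
  finally show ?thesis by (simp only: mult_1_right)
qed

lemma prod_shift_ratio:
  assumes "\<And>i. i \<in> {1..n} \<Longrightarrow> s i \<noteq> 0" "q \<noteq> (0::'a::field)"
  shows "(\<Prod>i\<in>{1..n}. s i / shift q \<eta> s i) = q ^ (\<Sum>i\<in>{1..n}. \<eta> i)"
proof -
  have "(\<Prod>i\<in>{1..n}. s i / shift q \<eta> s i) = (\<Prod>i\<in>{1..n}. q ^ \<eta> i)"
    using assms by (intro prod.cong) (auto simp: shift_def)
  then show ?thesis by (simp add: power_sum)
qed

lemma branchA_lower_term:
  fixes s :: "nat \<Rightarrow> 'a::field" and \<eta> :: "nat \<Rightarrow> nat"
  assumes g: "generic (Suc n) q s" and k: "k \<in> {1..n}"
  defines "t \<equiv> shift q \<eta> s"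
  shows "(if \<eta> k = 0 then 0 else pieri n q (shift q (\<eta>(k := \<eta> k - 1)) s) k * branchA n q s (\<eta>(k := \<eta> k - 1)))
     = branchA n q s \<eta> / q * ((t k - s (Suc n)) / (t k)\<^sup>2 * ((\<Prod>j\<in>{1..n}. t k - s j) / (\<Prod>j\<in>{1..n}-{k}. t k - t j)))"
proof (cases "\<eta> k = 0")
  case True
  then have "t k - s k = 0" by (simp add: t_def shift_def)
  then have "(\<Prod>j\<in>{1..n}. t k - s j) = 0" using k by (auto intro!: prod_zero)
  then show ?thesis using True by (simp only:) simp
next
  case False
  show ?thesis
    using branchA_lower[OF g k, of "\<eta>(k := \<eta> k - 1)", unfolded bump_lower[of \<eta> k, OF False]] False
    by (simp add: t_def)
qed

text \<open>The factor \<open>t k - s (Suc n)\<close> over the square of \<open>t k\<close> splits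
  into two inverse powers of \<open>t k\<close>, which are summed by \<open>lagrange_sum_div\<close>
  and \<open>lagrange_sum_div_square\<close>. The power \<open>q ^ M\<close> is what the shift of
  x_{n+1} gives on terms of degree \<open>M\<close> in x_{n+1}.\<close>

lemma sum_branchA_minus:
  fixes s :: "nat \<Rightarrow> 'a::field" and \<eta> :: "nat \<Rightarrow> nat"
  assumes g: "generic (Suc n) q s"
  defines "t \<equiv> shift q \<eta> s" and "M \<equiv> \<Sum>i\<in>{1..n}. \<eta> i"
  shows "(\<Sum>k\<in>{1..n}. if \<eta> k = 0 then 0 else
      pieri n q (shift q (\<eta>(k := \<eta> k - 1)) s) k * branchA n q s (\<eta>(k := \<eta> k - 1)))
    = branchA n q s \<eta> / q * (1 - q ^ M - s (Suc n) * (q ^ M * ((\<Sum>i\<in>{1..n}. 1 / s i) - (\<Sum>i\<in>{1..n}. 1 / t i))))"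
proof -
  have q: "q \<noteq> 0" using genericD[OF g] by simp
  have gt: "generic (Suc n) q t" unfolding t_def by (rule generic_shift[OF g])
  have nz: "s i \<noteq> 0" "t i \<noteq> 0" if "i \<in> {1..n}" for i
    using genericD(3)[OF g, of i] genericD(3)[OF gt, of i] that by auto
  have inj: "inj_on t {1..n}" using generic_inj_on[OF gt] by simp
  define L where "L k = (\<Prod>j\<in>{1..n}. t k - s j) / (\<Prod>j\<in>{1..n}-{k}. t k - t j)" for k
  have "(\<Sum>k\<in>{1..n}. if \<eta> k = 0 then 0 else
      pieri n q (shift q (\<eta>(k := \<eta> k - 1)) s) k * branchA n q s (\<eta>(k := \<eta> k - 1))) =
    (\<Sum>k\<in>{1..n}. branchA n q s \<eta> / q * (L k / t k - s (Suc n) * (L k / (t k)\<^sup>2)))"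
  proof (rule sum.cong[OF refl])
    fix k assume k: "k \<in> {1..n}"
    have "(t k - s (Suc n)) / (t k)\<^sup>2 * L k = L k / t k - s (Suc n) * (L k / (t k)\<^sup>2)"
      using nz[OF k] by (simp add: field_simps power2_eq_square)
    then show "(if \<eta> k = 0 then 0 else pieri n q (shift q (\<eta>(k := \<eta> k - 1)) s) k * branchA n q s (\<eta>(k := \<eta> k - 1)))
       = branchA n q s \<eta> / q * (L k / t k - s (Suc n) * (L k / (t k)\<^sup>2))"
      using branchA_lower_term[OF g k, of \<eta>] unfolding L_def t_def by metis
  qed
  also have "\<dots> = branchA n q s \<eta> / q * ((\<Sum>k\<in>{1..n}. L k / t k) - s (Suc n) * (\<Sum>k\<in>{1..n}. L k / (t k)\<^sup>2))"
    by (simp only: sum_distrib_left sum_subtractf right_diff_distrib)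
  also have "(\<Sum>k\<in>{1..n}. L k / t k) = 1 - q ^ M"
    unfolding L_def M_def using prod_shift_ratio[of n s q \<eta>] lagrange_sum_div[OF _ inj nz(2), of s] nz q
    by (simp add: t_def)
  also have "(\<Sum>k\<in>{1..n}. L k / (t k)\<^sup>2) = q ^ M * ((\<Sum>i\<in>{1..n}. 1 / s i) - (\<Sum>i\<in>{1..n}. 1 / t i))"
    unfolding L_def M_def using prod_shift_ratio[of n s q \<eta>] lagrange_sum_div_square[OF _ inj nz(2), of s] nz q
    by (simp add: t_def)
  finally show ?thesis .
qed

text \<open>The additional factor equals \<open>q * t k\<close> and lowers both inverse powers of
  \<open>t k\<close> by one, so the two sums are now \<open>lagrange_sum_diff\<close> and
  \<open>lagrange_sum_div\<close>.\<close>

lemma sum_branchA_plus: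
  fixes s :: "nat \<Rightarrow> 'a::field" and \<eta> :: "nat \<Rightarrow> nat"
  assumes g: "generic (Suc n) q s"
  defines "t \<equiv> shift q \<eta> s" and "M \<equiv> \<Sum>i\<in>{1..n}. \<eta> i"
  shows "(\<Sum>k\<in>{1..n}. if \<eta> k = 0 then 0 else shift q (\<eta>(k := \<eta> k - 1)) s k *
      pieri n q (shift q (\<eta>(k := \<eta> k - 1)) s) k * branchA n q s (\<eta>(k := \<eta> k - 1)))
    = branchA n q s \<eta> * ((\<Sum>i\<in>{1..n}. t i) - (\<Sum>i\<in>{1..n}. s i) - s (Suc n) * (1 - q ^ M))"
proof -
  have q: "q \<noteq> 0" using genericD[OF g] by simp
  have gt: "generic (Suc n) q t" unfolding t_def by (rule generic_shift[OF g])
  have nz: "s i \<noteq> 0" "t i \<noteq> 0" if "i \<in> {1..n}" for i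
    using genericD(3)[OF g, of i] genericD(3)[OF gt, of i] that by auto
  have inj: "inj_on t {1..n}" using generic_inj_on[OF gt] by simp
  define L where "L k = (\<Prod>j\<in>{1..n}. t k - s j) / (\<Prod>j\<in>{1..n}-{k}. t k - t j)" for k
  have "(\<Sum>k\<in>{1..n}. if \<eta> k = 0 then 0 else shift q (\<eta>(k := \<eta> k - 1)) s k *
      pieri n q (shift q (\<eta>(k := \<eta> k - 1)) s) k * branchA n q s (\<eta>(k := \<eta> k - 1))) =
    (\<Sum>k\<in>{1..n}. branchA n q s \<eta> * (L k - s (Suc n) * (L k / t k)))"
  proof (rule sum.cong[OF refl])
    fix k assume k: "k \<in> {1..n}"
    have 1: "(if \<eta> k = 0 then 0 else shift q (\<eta>(k := \<eta> k - 1)) s k *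
        pieri n q (shift q (\<eta>(k := \<eta> k - 1)) s) k * branchA n q s (\<eta>(k := \<eta> k - 1)))
      = q * t k * (if \<eta> k = 0 then 0 else
        pieri n q (shift q (\<eta>(k := \<eta> k - 1)) s) k * branchA n q s (\<eta>(k := \<eta> k - 1)))"
    proof (cases "\<eta> k")
      case (Suc m)
      have "shift q (\<eta>(k := m)) s k = q * t k" using q Suc by (simp add: t_def shift_def)
      then show ?thesis using Suc by simp
    qed simp
    have "q * t k * (branchA n q s \<eta> / q * ((t k - s (Suc n)) / (t k)\<^sup>2 * L k)) =
      branchA n q s \<eta> * (L k - s (Suc n) * (L k / t k))"
      using nz[OF k] q by (simp add: field_simps power2_eq_square)
    then show "(if \<eta> k = 0 then 0 else shift q (\<eta>(k := \<eta> k - 1)) s k *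
        pieri n q (shift q (\<eta>(k := \<eta> k - 1)) s) k * branchA n q s (\<eta>(k := \<eta> k - 1)))
       = branchA n q s \<eta> * (L k - s (Suc n) * (L k / t k))"
      unfolding 1 branchA_lower_term[OF g k, of \<eta>] L_def t_def .
  qed
  also have "\<dots> = branchA n q s \<eta> * ((\<Sum>k\<in>{1..n}. L k) - s (Suc n) * (\<Sum>k\<in>{1..n}. L k / t k))"
    by (simp only: sum_distrib_left sum_subtractf right_diff_distrib)
  also have "(\<Sum>k\<in>{1..n}. L k / t k) = 1 - q ^ M"
    unfolding L_def M_def using prod_shift_ratio[of n s q \<eta>] lagrange_sum_div[OF _ inj nz(2), of s] nz q
    by (simp add: t_def)
  also have "(\<Sum>k\<in>{1..n}. L k) = (\<Sum>i\<in>{1..n}. t i) - (\<Sum>i\<in>{1..n}. s i)"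
    unfolding L_def using lagrange_sum_diff[OF _ inj, of s] by simp
  finally show ?thesis .
qed

section \<open>Branching coefficients of type B\<close>

text \<open>The additional condition, with i = j included, keeps the symbols in q / (s_i s_j) and q
  / s_k^2 nonzero and separates the nodes t_i + 1 / t_i, two of which coincide only if t_i = t_j or
  t_i t_j = 1.\<close>

definition genericB :: "nat \<Rightarrow> 'a::field \<Rightarrow> (nat \<Rightarrow> 'a) \<Rightarrow> bool" where
  "genericB n q s \<longleftrightarrow> generic n q s \<and> (\<forall>i\<in>{1..n}. \<forall>j\<in>{1..n}. \<forall>m::int. s i * s j \<noteq> q powi m)"

lemma genericB_shift:
  assumes "genericB n q s" shows "genericB n q (shift q \<theta> s)"
proof -
  have g: "generic n q s" using assms by (simp add: genericB_def)
  then have q: "q \<noteq> 0" by (simp add: generic_def)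
  have "shift q \<theta> s i * shift q \<theta> s j \<noteq> q powi m" if ij: "i \<in> {1..n}" "j \<in> {1..n}" for i j and m :: int
  proof
    assume "shift q \<theta> s i * shift q \<theta> s j = q powi m"
    then have "s i * s j = q powi (m + int (\<theta> i) + int (\<theta> j))"
      using q by (simp add: shift_def power_int_add field_simps)
    then show False using assms ij unfolding genericB_def by blast
  qed
  then show ?thesis using generic_shift[OF g] by (simp add: genericB_def)
qed

definition crossw :: "'a::field \<Rightarrow> nat \<Rightarrow> nat \<Rightarrow> 'a \<Rightarrow> 'a" where
  "crossw q a b z = qpoch z q (a + b) / (qpoch z q a * qpoch z q b)"

text \<open>By this symmetry one lowering rule covers both positions of k in a pair, in contrast to
  \<open>pairw\<close>.\<close>

lemma crossw_commute: "crossw q a b z = crossw q b a z"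
  by (simp add: crossw_def add.commute mult.commute)

lemma crossw_lower:
  assumes "1 - q ^ a * z \<noteq> 0" "1 - q ^ (a + b) * z \<noteq> 0"
  shows "crossw q a b z = crossw q (Suc a) b z * ((1 - q ^ a * z) / (1 - q ^ (a + b) * z))"
proof -
  have "E / (X * Y) = E * v / (X * u * Y) * (u / v)" if "u \<noteq> 0" "v \<noteq> 0" for E X Y u v :: 'a
    using that by simp
  from this[OF assms] show ?thesis unfolding crossw_def add_Suc qpoch_Suc .
qed

definition crossprod :: "nat \<Rightarrow> 'a::field \<Rightarrow> (nat \<Rightarrow> 'a) \<Rightarrow> (nat \<Rightarrow> nat) \<Rightarrow> 'a" where
  "crossprod n q s \<theta> = (\<Prod>i\<in>{1..n}. \<Prod>j\<in>{i<..n}. crossw q (\<theta> i) (\<theta> j) (q / (s i * s j)))"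

lemma eBA_factor:
  "eBA n \<theta> s q = (\<Prod>k\<in>{1..n}. q ^ ((n - k + 1) * \<theta> k) / (qpoch q q (\<theta> k) * qpoch (q * (1 / (s k)\<^sup>2)) q (\<theta> k)))
     * (pairprod n q s \<theta> * crossprod n q s \<theta>)"
  by (simp add: eBA_def pairprod_def crossprod_def pairw_def crossw_def flip: prod.distrib)

lemma crossprod_lower:
  fixes s :: "nat \<Rightarrow> 'a::field" and \<theta> :: "nat \<Rightarrow> nat"
  assumes g: "genericB n q s" and k: "k \<in> {1..n}"
  defines "\<eta> \<equiv> \<theta>(k := Suc (\<theta> k))"
  defines "t \<equiv> shift q \<eta> s"
  shows "crossprod n q s \<theta> = crossprod n q s \<eta> * (\<Prod>j\<in>{1..n}-{k}. (1 - 1 / (t k * s j)) / (1 - 1 / (t k * t j)))"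
proof -
  have g': "generic n q s" using g by (simp add: genericB_def)
  have q: "q \<noteq> 0" using genericD[OF g'] by simp
  define C where "C j = (1 - 1 / (t k * s j)) / (1 - 1 / (t k * t j))" for j
  have low: "crossw q (\<theta> k) (\<theta> j) (q / (s k * s j)) = crossw q (\<eta> k) (\<eta> j) (q / (s k * s j)) * C j"
    if j: "j \<in> {1..n}" "j \<noteq> k" for j
  proof -
    have ne: "s k \<noteq> 0" "s j \<noteq> 0" using genericD(3)[OF g'] j k by auto
    have gen: "1 - q ^ m * (q / (s k * s j)) \<noteq> 0" for m
    proof
      assume "1 - q ^ m * (q / (s k * s j)) = 0"
      then have "s k * s j = q powi int (Suc m)" using ne by (simp only: power_int_of_nat) (simp add: field_simps)
      then show False using g j k unfolding genericB_def by blast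
    qed
    have "q ^ \<theta> k * (q / (s k * s j)) = 1 / (t k * s j)"
      by (simp add: t_def shift_def \<eta>_def)
    moreover have "q ^ (\<theta> k + \<theta> j) * (q / (s k * s j)) = 1 / (t k * t j)"
      using j by (simp add: t_def shift_def \<eta>_def power_add)
    ultimately show ?thesis
      using crossw_lower[OF gen gen, of "\<theta> k" "\<theta> j"] j by (simp add: C_def \<eta>_def)
  qed
  have *: "crossw q (\<theta> i) (\<theta> j) (q / (s i * s j)) = crossw q (\<eta> i) (\<eta> j) (q / (s i * s j)) *
      (if i = k then C j else if j = k then C i else 1)"
    if ij: "i \<in> {1..n}" "j \<in> {i<..n}" for i j
  proof -
    consider "i = k" "j \<noteq> k" | "j = k" "i \<noteq> k" | "i \<noteq> k" "j \<noteq> k" using ij by force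
    then show ?thesis
    proof cases
      case 1
      then show ?thesis using low[of j] ij by auto
    next
      case 2
      then show ?thesis using low[of i] ij
        by (simp add: crossw_commute[of q "\<theta> i"] crossw_commute[of q "\<eta> i"] mult.commute[of "s i"])
    qed (simp add: \<eta>_def)
  qed
  have "crossprod n q s \<theta> = (\<Prod>i\<in>{1..n}. \<Prod>j\<in>{i<..n}. crossw q (\<eta> i) (\<eta> j) (q / (s i * s j)) *
      (if i = k then C j else if j = k then C i else 1))"
    unfolding crossprod_def by (intro prod.cong refl *)
  also have "\<dots> = crossprod n q s \<eta> * (\<Prod>j\<in>{1..n}-{k}. C j)"
    by (simp only: prod.distrib crossprod_def prod_pairs_through[OF k] prod_remove_split[OF k])
  finally show ?thesis by (simp only: C_def)
qed

text \<open>The factorization y_k - w_j = (t_k - s_j) (1 - 1 / (t_k s_j)) merges the factors of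
  \<open>pairprod_lower\<close> and \<open>crossprod_lower\<close>; with t_j for s_j it gives the
  denominators. The two single symbols supply j = k in the same way, and the 1 / t_k left over is
  cancelled by the prefactor \<open>shift q \<theta> s k\<close>.\<close>

lemma eBA_lower:
  fixes s :: "nat \<Rightarrow> 'a::field" and \<theta> :: "nat \<Rightarrow> nat"
  assumes g: "genericB n q s" and k: "k \<in> {1..n}"
  defines "\<eta> \<equiv> \<theta>(k := Suc (\<theta> k))"
  defines "t \<equiv> shift q \<eta> s"
  defines "y \<equiv> \<lambda>i. t i + 1 / t i" and "w \<equiv> \<lambda>i. s i + 1 / s i"
  shows "shift q \<theta> s k * pieri n q (shift q \<theta> s) k * eBA n \<theta> s q = eBA n \<eta> s q *
    ((\<Prod>j\<in>{1..n}. y k - w j) / (\<Prod>j\<in>{1..n}-{k}. y k - y j))"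
proof -
  have g': "generic n q s" using g by (simp add: genericB_def)
  have q: "q \<noteq> 0" using genericD[OF g'] by simp
  have gt: "generic n q t" unfolding t_def by (rule generic_shift[OF g'])
  have nz: "s i \<noteq> 0" "t i \<noteq> 0" if "i \<in> {1..n}" for i
    using genericD(3)[OF g' that] genericD(3)[OF gt that] by simp_all
  define u where "u i a = q ^ ((n - i + 1) * a) / (qpoch q q a * qpoch (q * (1 / (s i)\<^sup>2)) q a)" for i a
  have qk: "q ^ Suc (\<theta> k) = s k / t k" using nz[OF k] q by (simp add: t_def shift_def \<eta>_def)
  have "s k * s k \<noteq> q powi int (Suc (\<theta> k))" using g k unfolding genericB_def by blast
  then have "1 - q ^ Suc (\<theta> k) * (1 / (s k)\<^sup>2) \<noteq> 0"
    using nz[OF k] by (simp only: power_int_of_nat) (simp add: field_simps power2_eq_square)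
  then have "u k (\<theta> k) = u k (Suc (\<theta> k)) * ((1 - q ^ Suc (\<theta> k)) * (1 - q ^ Suc (\<theta> k) * (1 / (s k)\<^sup>2)) / q ^ (n - k + 1))"
    unfolding u_def by (intro single_factor_lower q genericD(2)[OF g']) simp
  then have "(\<Prod>i\<in>{1..n}. u i (\<theta> i)) = (\<Prod>i\<in>{1..n}. u i (\<eta> i)) *
      ((1 - q ^ Suc (\<theta> k)) * (1 - q ^ Suc (\<theta> k) * (1 / (s k)\<^sup>2)) / q ^ (n - k + 1))"
    by (intro prod_change_one[of _ k] k) (auto simp: \<eta>_def)
  also have "(1 - q ^ Suc (\<theta> k)) * (1 - q ^ Suc (\<theta> k) * (1 / (s k)\<^sup>2)) = (y k - w k) / t k"
    unfolding qk y_def w_def using nz[OF k] by (simp add: field_simps power2_eq_square)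
  finally have U: "(\<Prod>i\<in>{1..n}. u i (\<theta> i)) = (\<Prod>i\<in>{1..n}. u i (\<eta> i)) * ((y k - w k) / t k / q ^ (n - k + 1))" .
  have tk: "shift q \<theta> s k = q * t k" using q by (simp add: t_def \<eta>_def shift_bump)
  have R: "(\<Prod>j\<in>{1..n}-{k}. (t k - s j) / (t k - t j)) * (\<Prod>j\<in>{1..n}-{k}. (1 - 1 / (t k * s j)) / (1 - 1 / (t k * t j)))
     = (\<Prod>j\<in>{1..n}-{k}. (y k - w j) / (y k - y j))"
    unfolding prod.distrib[symmetric]
  proof (rule prod.cong)
    fix j assume "j \<in> {1..n}-{k}"
    then have "(t k - s j) * (1 - 1 / (t k * s j)) = y k - w j" "(t k - t j) * (1 - 1 / (t k * t j)) = y k - y j"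
      using nz[OF k] nz[of j] by (simp_all add: y_def w_def field_simps)
    then show "(t k - s j) / (t k - t j) * ((1 - 1 / (t k * s j)) / (1 - 1 / (t k * t j))) = (y k - w j) / (y k - y j)"
      by (simp only: times_divide_times_eq)
  qed simp
  have E: "eBA n \<zeta> s q = (\<Prod>i\<in>{1..n}. u i (\<zeta> i)) * (pairprod n q s \<zeta> * crossprod n q s \<zeta>)" for \<zeta>
    by (simp only: eBA_factor u_def)
  have "shift q \<theta> s k * pieri n q (shift q \<theta> s) k * eBA n \<theta> s q = q * t k *
     ((\<Prod>i\<in>{1..n}. u i (\<theta> i)) * ((pieri n q (shift q \<theta> s) k * pairprod n q s \<theta>) * crossprod n q s \<theta>))"
    unfolding E tk by (simp only: mult_ac)
  also have "\<dots> = eBA n \<eta> s q * (q * t k * ((y k - w k) / t k / q ^ (n - k + 1)) * q ^ (n - k) *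
      ((\<Prod>j\<in>{1..n}-{k}. (t k - s j) / (t k - t j)) * (\<Prod>j\<in>{1..n}-{k}. (1 - 1 / (t k * s j)) / (1 - 1 / (t k * t j)))))"
    unfolding pairprod_lower[OF g' k, of \<theta>, folded \<eta>_def, folded t_def]
      crossprod_lower[OF g k, of \<theta>, folded \<eta>_def, folded t_def] U E by (simp only: mult_ac)
  also have "q * t k * ((y k - w k) / t k / q ^ (n - k + 1)) * q ^ (n - k) = y k - w k"
  proof -
    have "q * x * (a / x / (Q * q)) * Q = a" if "x \<noteq> 0" "Q \<noteq> 0" for x a Q
      using that q by simp
    then show ?thesis unfolding power_add power_one_right using q nz[OF k] by auto
  qed
  also have "(y k - w k) * ((\<Prod>j\<in>{1..n}-{k}. (t k - s j) / (t k - t j)) * (\<Prod>j\<in>{1..n}-{k}. (1 - 1 / (t k * s j)) / (1 - 1 / (t k * t j))))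
    = (\<Prod>j\<in>{1..n}. y k - w j) / (\<Prod>j\<in>{1..n}-{k}. y k - y j)"
    unfolding R prod.remove[OF finite_atLeastAtMost k, of "\<lambda>j. y k - w j"] by (simp add: prod_dividef)
  finally show ?thesis .
qed

text \<open>By \<open>lagrange_sum_diff\<close> at the nodes t_i + 1 / t_i. The difference on the
  right is the excess of the two type A eigenvalues at the shifted parameters over the type B
  eigenvalue, which the boundary term has to remove.\<close>

lemma sum_eBA:
  fixes s :: "nat \<Rightarrow> 'a::field" and \<eta> :: "nat \<Rightarrow> nat"
  assumes g: "genericB n q s"
  defines "t \<equiv> shift q \<eta> s"
  shows "(\<Sum>k\<in>{1..n}. if \<eta> k = 0 then 0 else shift q (\<eta>(k := \<eta> k - 1)) s k *
      pieri n q (shift q (\<eta>(k := \<eta> k - 1)) s) k * eBA n (\<eta>(k := \<eta> k - 1)) s q)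
    = eBA n \<eta> s q * ((\<Sum>i\<in>{1..n}. t i + 1 / t i) - (\<Sum>i\<in>{1..n}. s i + 1 / s i))"
proof -
  have gt: "genericB n q t" unfolding t_def by (rule genericB_shift[OF g])
  then have gt': "generic n q t" by (simp add: genericB_def)
  define y where "y i = t i + 1 / t i" for i
  define w where "w i = s i + 1 / s i" for i
  have inj: "inj_on y {1..n}"
  proof (rule inj_onI, rule ccontr)
    fix i j assume ij: "i \<in> {1..n}" "j \<in> {1..n}" "y i = y j" "i \<noteq> j"
    have nz: "t i \<noteq> 0" "t j \<noteq> 0" using genericD(3)[OF gt'] ij by auto
    have "(t i - t j) * (t i * t j - 1) = (y i - y j) * (t i * t j)"
      using nz by (simp add: y_def field_simps)
    then have "t i = t j \<or> t i * t j = q powi 0" using ij by auto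
    then show False using genericD(5)[OF gt' ij(1,2,4)] gt ij unfolding genericB_def by blast
  qed
  define L where "L k = (\<Prod>j\<in>{1..n}. y k - w j) / (\<Prod>j\<in>{1..n}-{k}. y k - y j)" for k
  have "(if \<eta> k = 0 then 0 else shift q (\<eta>(k := \<eta> k - 1)) s k *
      pieri n q (shift q (\<eta>(k := \<eta> k - 1)) s) k * eBA n (\<eta>(k := \<eta> k - 1)) s q) = eBA n \<eta> s q * L k"
    if k: "k \<in> {1..n}" for k
  proof (cases "\<eta> k = 0")
    case True
    then have "y k - w k = 0" by (simp add: y_def w_def t_def shift_def)
    then have "L k = 0" unfolding L_def using k by (auto intro!: prod_zero)
    then show ?thesis using True by simp
  next
    case False
    show ?thesis
      using eBA_lower[OF g k, of "\<eta>(k := \<eta> k - 1)", unfolded bump_lower[of \<eta> k, OF False]] False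
      by (simp add: L_def t_def y_def w_def)
  qed
  then have "(\<Sum>k\<in>{1..n}. if \<eta> k = 0 then 0 else shift q (\<eta>(k := \<eta> k - 1)) s k *
      pieri n q (shift q (\<eta>(k := \<eta> k - 1)) s) k * eBA n (\<eta>(k := \<eta> k - 1)) s q)
    = (\<Sum>k\<in>{1..n}. eBA n \<eta> s q * L k)"
    by (rule sum.cong[OF refl])
  also have "\<dots> = eBA n \<eta> s q * ((\<Sum>i\<in>{1..n}. y i) - (\<Sum>i\<in>{1..n}. w i))"
    unfolding sum_distrib_left[symmetric] L_def lagrange_sum_diff[OF finite_atLeastAtMost inj] ..
  finally show ?thesis by (simp only: y_def w_def)
qed

section \<open>Branching of the type A series\<close>

text \<open>The degree is an integer, so exponents can be inserted directly and degree
  \<open>m - 1\<close> at \<open>m = 0\<close> gives the empty set, as the boundary terms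
  require.\<close>

definition weakcomp :: "nat \<Rightarrow> int \<Rightarrow> (nat \<Rightarrow> nat) set" where
  "weakcomp n m = {\<theta> \<in> Vset n. int (\<Sum>k\<in>{1..n}. \<theta> k) = m}"

lemma finite_weakcomp: "finite (weakcomp n m)"
proof (rule finite_subset)
  show "weakcomp n m \<subseteq> {\<theta>. \<forall>k. (k \<in> {1..n} \<longrightarrow> \<theta> k \<in> {..nat m}) \<and> (k \<notin> {1..n} \<longrightarrow> \<theta> k = 0)}"
  proof (rule subsetI, rule CollectI, rule allI, rule conjI, rule_tac[!] impI)
    fix \<theta> k assume \<theta>: "\<theta> \<in> weakcomp n m"
    show "\<theta> k = 0" if "k \<notin> {1..n}" using that \<theta> by (auto simp: weakcomp_def Vset_def)
    assume "k \<in> {1..n}"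
    then have "\<theta> k \<le> (\<Sum>k\<in>{1..n}. \<theta> k)" by (intro member_le_sum) auto
    then show "\<theta> k \<in> {..nat m}" using \<theta> by (auto simp: weakcomp_def simp del: of_nat_sum)
  qed
qed (rule finite_set_of_finite_funs; simp)

text \<open>For each k, raising the entry at k is a bijection onto the \<eta> of degree m + 1 with
  nonzero entry at k. Collecting by \<eta> turns an expansion in shifted functions into a recursion
  for the coefficients.\<close>

lemma sum_bump:
  fixes \<phi> :: "nat \<Rightarrow> (nat \<Rightarrow> nat) \<Rightarrow> 'a::comm_ring"
  shows "(\<Sum>\<theta>\<in>weakcomp n m. \<Sum>k\<in>{1..n}. \<phi> k \<theta> * \<psi> (\<theta>(k := Suc (\<theta> k)))) =
    (\<Sum>\<eta>\<in>weakcomp n (m + 1). (\<Sum>k\<in>{1..n}. if \<eta> k = 0 then 0 else \<phi> k (\<eta>(k := \<eta> k - 1))) * \<psi> \<eta>)"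
proof -
  have "(\<Sum>\<theta>\<in>weakcomp n m. \<phi> k \<theta> * \<psi> (\<theta>(k := Suc (\<theta> k)))) =
    (\<Sum>\<eta>\<in>weakcomp n (m + 1). (if \<eta> k = 0 then 0 else \<phi> k (\<eta>(k := \<eta> k - 1))) * \<psi> \<eta>)" if k: "k \<in> {1..n}" for k
  proof -
    have bump: "\<theta>(k := Suc (\<theta> k)) \<in> weakcomp n (m + 1)" if "\<theta> \<in> weakcomp n m" for \<theta>
    proof -
      have "(\<Sum>i\<in>{1..n}. (\<theta>(k := Suc (\<theta> k))) i) = Suc (\<Sum>i\<in>{1..n}. \<theta> i)"
        using k by (subst (1 2) sum.remove[of _ k]) auto
      then show ?thesis using that k by (auto simp: weakcomp_def Vset_def simp del: of_nat_sum)
    qed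
    have lower: "\<eta>(k := \<eta> k - 1) \<in> weakcomp n m" if "\<eta> \<in> weakcomp n (m + 1)" "\<eta> k \<noteq> 0" for \<eta>
    proof -
      have "Suc (\<Sum>i\<in>{1..n}. (\<eta>(k := \<eta> k - 1)) i) = (\<Sum>i\<in>{1..n}. \<eta> i)"
        using k that(2) by (subst (1 2) sum.remove[of _ k]) auto
      then show ?thesis using that k by (auto simp: weakcomp_def Vset_def simp del: of_nat_sum)
    qed
    have "(\<Sum>\<theta>\<in>weakcomp n m. \<phi> k \<theta> * \<psi> (\<theta>(k := Suc (\<theta> k)))) =
       (\<Sum>\<eta>\<in>{\<eta> \<in> weakcomp n (m + 1). \<eta> k \<noteq> 0}. \<phi> k (\<eta>(k := \<eta> k - 1)) * \<psi> \<eta>)"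
      by (rule sum.reindex_bij_witness[of _ "\<lambda>\<eta>. \<eta>(k := \<eta> k - 1)" "\<lambda>\<theta>. \<theta>(k := Suc (\<theta> k))"])
         (auto simp: bump lower[unfolded One_nat_def] simp del: fun_upd_apply simp add: fun_upd_same)
    also have "\<dots> = (\<Sum>\<eta>\<in>weakcomp n (m + 1). (if \<eta> k = 0 then 0 else \<phi> k (\<eta>(k := \<eta> k - 1))) * \<psi> \<eta>)"
      by (rule sum.mono_neutral_cong_left) (auto simp: finite_weakcomp)
    finally show ?thesis .
  qed
  then have "(\<Sum>k\<in>{1..n}. \<Sum>\<theta>\<in>weakcomp n m. \<phi> k \<theta> * \<psi> (\<theta>(k := Suc (\<theta> k)))) =
    (\<Sum>k\<in>{1..n}. \<Sum>\<eta>\<in>weakcomp n (m + 1). (if \<eta> k = 0 then 0 else \<phi> k (\<eta>(k := \<eta> k - 1))) * \<psi> \<eta>)"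
    by (rule sum.cong[OF refl])
  then show ?thesis
    unfolding sum_distrib_right by (subst (1 2) sum.swap)
qed

section \<open>Strictly upper triangular matrices with one more column\<close>

definition Mset_at :: "nat \<Rightarrow> (nat \<Rightarrow> int) \<Rightarrow> (nat \<Rightarrow> nat \<Rightarrow> nat) set" where
  "Mset_at n e = {\<Theta> \<in> Mset n. xexpA n \<Theta> = e}"

definition append_col :: "nat \<Rightarrow> (nat \<Rightarrow> nat) \<Rightarrow> (nat \<Rightarrow> nat \<Rightarrow> nat) \<Rightarrow> nat \<Rightarrow> nat \<Rightarrow> nat" where
  "append_col n \<theta> \<Theta> = (\<lambda>i j. if j = Suc n then \<theta> i else \<Theta> i j)"

lemma xexpA_append_col:
  assumes \<Theta>: "\<Theta> \<in> Mset n" and \<theta>: "\<theta> \<in> Vset n"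
  shows "xexpA (Suc n) (append_col n \<theta> \<Theta>) k =
    (if k = Suc n then int (\<Sum>i\<in>{1..n}. \<theta> i) else xexpA n \<Theta> k - int (\<theta> k))"
proof -
  have *: "{i<..Suc n} = insert (Suc n) {i<..n}" if "i \<in> {1..n}" for i using that by auto
  have "xexpA (Suc n) (append_col n \<theta> \<Theta>) k =
     (\<Sum>i\<in>{1..n}. \<Sum>j\<in>{i<..Suc n}. int (append_col n \<theta> \<Theta> i j) * xr i j k)"
    by (simp add: xexpA_def)
  also have "\<dots> = (\<Sum>i\<in>{1..n}. (\<Sum>j\<in>{i<..n}. int (\<Theta> i j) * xr i j k) + int (\<theta> i) * xr i (Suc n) k)"
    by (rule sum.cong[OF refl]) (auto simp: * append_col_def intro!: sum.cong)
  also have "\<dots> = xexpA n \<Theta> k + (\<Sum>i\<in>{1..n}. int (\<theta> i) * xr i (Suc n) k)"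
    by (simp add: sum.distrib xexpA_def)
  finally have eq: "xexpA (Suc n) (append_col n \<theta> \<Theta>) k = xexpA n \<Theta> k + (\<Sum>i\<in>{1..n}. int (\<theta> i) * xr i (Suc n) k)" .
  show ?thesis
  proof (cases "k = Suc n")
    case True
    have "xexpA n \<Theta> (Suc n) = 0" unfolding xexpA_def xr_def
      by (intro sum.neutral ballI) auto
    moreover have "(\<Sum>i\<in>{1..n}. int (\<theta> i) * xr i (Suc n) (Suc n)) = (\<Sum>i\<in>{1..n}. int (\<theta> i))"
      by (intro sum.cong) (auto simp: xr_def)
    ultimately show ?thesis using eq True by simp
  next
    case False
    have "(\<Sum>i\<in>{1..n}. int (\<theta> i) * xr i (Suc n) k) = (\<Sum>i\<in>{1..n}. if i = k then - int (\<theta> k) else 0)"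
      using False by (intro sum.cong) (auto simp: xr_def)
    also have "\<dots> = - int (\<theta> k)" using \<theta> by (auto simp: Vset_def)
    finally show ?thesis using eq False by simp
  qed
qed

text \<open>The exponent of x_{n+1} is the sum of the last column. The smaller matrix does not
  involve x_{n+1}, so its exponent function is 0 there, which is why \<open>e\<close> is reset at
  \<open>Suc n\<close>.\<close>

lemma append_col_in_Mset_at_iff:
  assumes "\<Theta> \<in> Mset n" "\<theta> \<in> Vset n"
  shows "append_col n \<theta> \<Theta> \<in> Mset_at (Suc n) e \<longleftrightarrow>
    \<theta> \<in> weakcomp n (e (Suc n)) \<and> \<Theta> \<in> Mset_at n (\<lambda>k. (e(Suc n := 0)) k + int (\<theta> k))"
proof -
  have M: "append_col n \<theta> \<Theta> \<in> Mset (Suc n)"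
    using assms by (auto simp: Mset_def Vset_def append_col_def)
  have z: "xexpA n \<Theta> (Suc n) = 0" unfolding xexpA_def xr_def
    by (intro sum.neutral ballI) auto
  have t: "\<theta> (Suc n) = 0" using assms by (simp add: Vset_def)
  have "xexpA (Suc n) (append_col n \<theta> \<Theta>) = e \<longleftrightarrow>
     int (\<Sum>i\<in>{1..n}. \<theta> i) = e (Suc n) \<and> (\<forall>k. k \<noteq> Suc n \<longrightarrow> xexpA n \<Theta> k - int (\<theta> k) = e k)"
    unfolding fun_eq_iff xexpA_append_col[OF assms] by (metis (full_types))
  also have "\<dots> \<longleftrightarrow> int (\<Sum>i\<in>{1..n}. \<theta> i) = e (Suc n) \<and> xexpA n \<Theta> = (\<lambda>k. (e(Suc n := 0)) k + int (\<theta> k))"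
    using z t by (auto simp: fun_eq_iff)
  finally show ?thesis using M assms by (simp add: Mset_at_def weakcomp_def)
qed

lemma Mset_at_Suc:
  "Mset_at (Suc n) e = (\<lambda>(\<theta>, \<Theta>). append_col n \<theta> \<Theta>) `
     (SIGMA \<theta>:weakcomp n (e (Suc n)). Mset_at n (\<lambda>k. (e(Suc n := 0)) k + int (\<theta> k)))" (is "_ = ?f ` ?S")
proof
  show "?f ` ?S \<subseteq> Mset_at (Suc n) e"
    using append_col_in_Mset_at_iff by (auto simp: weakcomp_def Mset_at_def)
  show "Mset_at (Suc n) e \<subseteq> ?f ` ?S"
  proof
    fix \<Omega> assume \<Omega>: "\<Omega> \<in> Mset_at (Suc n) e"
    define \<theta> where "\<theta> i = \<Omega> i (Suc n)" for i
    define \<Theta> where "\<Theta> i j = (if j = Suc n then 0 else \<Omega> i j)" for i j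
    have 1: "\<Theta> \<in> Mset n" "\<theta> \<in> Vset n" "\<Omega> = append_col n \<theta> \<Theta>"
      using \<Omega> by (auto simp: \<Theta>_def \<theta>_def Mset_at_def Mset_def Vset_def append_col_def fun_eq_iff)
    then show "\<Omega> \<in> ?f ` ?S"
      using append_col_in_Mset_at_iff[OF 1(1,2), of e] \<Omega> by (intro image_eqI[of _ _ "(\<theta>, \<Theta>)"]) auto
  qed
qed

lemma append_col_inj:
  "inj_on (\<lambda>(\<theta>, \<Theta>). append_col n \<theta> \<Theta>) (SIGMA \<theta>:A. Mset_at n (f \<theta>))"
proof (rule inj_onI, clarify)
  fix \<theta> \<Theta> \<theta>' \<Theta>'
  assume S: "\<Theta> \<in> Mset_at n (f \<theta>)" "\<Theta>' \<in> Mset_at n (f \<theta>')"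
    and eq: "append_col n \<theta> \<Theta> = append_col n \<theta>' \<Theta>'"
  have "\<theta> = \<theta>'"
  proof
    fix i show "\<theta> i = \<theta>' i" using fun_cong[OF fun_cong[OF eq, of i], of "Suc n"] by (simp add: append_col_def)
  qed
  moreover have "\<Theta> = \<Theta>'"
  proof (intro ext)
    fix i j show "\<Theta> i j = \<Theta>' i j"
      using fun_cong[OF fun_cong[OF eq, of i], of j] S
      by (cases "j = Suc n") (auto simp: append_col_def Mset_at_def Mset_def)
  qed
  ultimately show "\<theta> = \<theta>' \<and> \<Theta> = \<Theta>'" by simp
qed

text \<open>The degree in x_{n+1} bounds the last column, so induction on n applies. Finiteness
  makes the \<open>Sum_any\<close> in \<open>fA\<close> an actual sum rather than its default value
  0.\<close>

lemma finite_Mset_at: "finite (Mset_at n e)"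
proof (induction n arbitrary: e)
  case 0
  have "Mset_at 0 e \<subseteq> {\<lambda>_ _. 0}" by (auto simp: Mset_at_def Mset_def fun_eq_iff)
  then show ?case by (rule finite_subset) simp
next
  case (Suc n)
  then show ?case unfolding Mset_at_Suc by (intro finite_imageI finite_SigmaI finite_weakcomp)
qed

lemma fA_eq_sum: "fA n s q e = (\<Sum>\<Theta>\<in>Mset_at n e. cToda n \<Theta> s q)"
proof -
  have "fA n s q e = (\<Sum>\<Theta>\<in>Mset_at n e. if \<Theta> \<in> Mset n \<and> xexpA n \<Theta> = e then cToda n \<Theta> s q else 0)"
    unfolding fA_def by (rule Sum_any.expand_superset[OF finite_Mset_at]) (auto simp: Mset_at_def)
  then show ?thesis by (simp add: Mset_at_def)
qed

lemma cToda_cong: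
  assumes "\<And>i. i \<in> {1..n} \<Longrightarrow> s i = s' i"
  shows "cToda n \<Theta> s q = cToda n \<Theta> s' q"
  unfolding cToda_def using assms by (intro prod.cong refl) auto

lemma fA_cong:
  assumes "\<And>i. i \<in> {1..n} \<Longrightarrow> s i = s' i"
  shows "fA n s q = fA n s' q"
  by (rule ext) (unfold fA_eq_sum, intro sum.cong refl cToda_cong assms)

text \<open>For k at most n the sums over a > k gain the term a = n + 1, a power of \<open>q\<close>
  that is absorbed by passing from \<open>s\<close> to \<open>shift q \<theta> s\<close>. For k = n
  + 1 these sums are empty and \<open>branchA\<close> remains.\<close>

lemma cToda_append_col:
  fixes s :: "nat \<Rightarrow> 'a::field"
  assumes q: "q \<noteq> 0" and s: "\<And>i. i \<in> {1..n} \<Longrightarrow> s i \<noteq> 0"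
  shows "cToda (Suc n) (append_col n \<theta> \<Theta>) s q = branchA n q s \<theta> * cToda n \<Theta> (shift q \<theta> s) q"
proof (cases "n = 0")
  case True
  then show ?thesis by (simp add: cToda_def branchA_def pairprod_def)
next
  case False
  define T where "T N \<Theta> s k = (\<Prod>i\<in>{1..k-1}. \<Prod>j\<in>{i..k-1}.
      (1 / qpoch (q powi (\<Sum>a\<in>{k<..N}. int (\<Theta> i a) - int (\<Theta> (j+1) a)) * q * s (j+1) / s i) q (\<Theta> i k))
    * (q ^ \<Theta> i k / qpoch (q powi (int (\<Theta> j k) - int (\<Theta> i k)
          - (\<Sum>a\<in>{k<..N}. int (\<Theta> i a) - int (\<Theta> j a))) * q * s i / s j) q (\<Theta> i k)))"
    for N \<Theta> and s :: "nat \<Rightarrow> 'a" and k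
  let ?\<Omega> = "append_col n \<theta> \<Theta>"
  have c: "cToda N \<Theta> s q = (\<Prod>k\<in>{2..N}. T N \<Theta> s k)" for N \<Theta> s
    by (simp add: cToda_def T_def)
  have "{2..Suc n} = insert (Suc n) {2..n}" using False by auto
  then have "cToda (Suc n) ?\<Omega> s q = T (Suc n) ?\<Omega> s (Suc n) * (\<Prod>k\<in>{2..n}. T (Suc n) ?\<Omega> s k)"
    by (simp add: c)
  also have "(\<Prod>k\<in>{2..n}. T (Suc n) ?\<Omega> s k) = (\<Prod>k\<in>{2..n}. T n \<Theta> (shift q \<theta> s) k)"
  proof (rule prod.cong[OF refl])
    fix k assume k: "k \<in> {2..n}"
    have kc: "?\<Omega> i k = \<Theta> i k" for i using k by (simp add: append_col_def)
    have "{k<..Suc n} = insert (Suc n) {k<..n}" using k by auto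
    then have sm: "(\<Sum>a\<in>{k<..Suc n}. int (?\<Omega> i a) - int (?\<Omega> j a)) =
       (\<Sum>a\<in>{k<..n}. int (\<Theta> i a) - int (\<Theta> j a)) + int (\<theta> i) - int (\<theta> j)" for i j
      by (auto simp: append_col_def intro!: sum.cong)
    have A: "q powi (S + int (\<theta> i) - int (\<theta> j)) * q * s j / s i = q powi S * q * shift q \<theta> s j / shift q \<theta> s i" for S i j
      using q by (simp add: shift_def power_int_add power_int_diff)
    have B: "q powi (R - (S + int (\<theta> i) - int (\<theta> j))) * q * s i / s j = q powi (R - S) * q * shift q \<theta> s i / shift q \<theta> s j" for R S i j
      using q by (simp add: shift_def power_int_add power_int_diff)
    show "T (Suc n) ?\<Omega> s k = T n \<Theta> (shift q \<theta> s) k"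
      unfolding T_def kc sm A B ..
  qed
  also have "T (Suc n) ?\<Omega> s (Suc n) = branchA n q s \<theta>"
  proof -
    have "T (Suc n) ?\<Omega> s (Suc n) = (\<Prod>i\<in>{1..n}. \<Prod>j\<in>{i..n}.
      (1 / qpoch (q * s (Suc j) / s i) q (\<theta> i)) * (q ^ \<theta> i * (1 / qpoch (q powi (int (\<theta> j) - int (\<theta> i)) * q * s i / s j) q (\<theta> i))))"
      by (simp add: T_def append_col_def)
    also have "\<dots> = (\<Prod>i\<in>{1..n}. (q ^ ((n - i + 1) * \<theta> i) / (qpoch q q (\<theta> i) * qpoch (q * s (Suc n) / s i) q (\<theta> i))) *
       (\<Prod>j\<in>{i<..n}. pairw q (\<theta> i) (\<theta> j) (s i) (s j)))"
    proof (rule prod.cong[OF refl])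
      fix i assume i: "i \<in> {1..n}"
      define A where "A j = 1 / qpoch (q * s j / s i) q (\<theta> i)" for j
      define B where "B j = 1 / qpoch (q powi (int (\<theta> j) - int (\<theta> i)) * q * s i / s j) q (\<theta> i)" for j
      \<comment> \<open>The first symbols carry the index j + 1, the second ones j. After
        reindexing, \<open>A (Suc n)\<close> and \<open>B i\<close> have no partner and become the
        two single symbols of \<open>branchA\<close>.\<close>
      have "(\<Prod>j\<in>{i..n}. A (Suc j)) = (\<Prod>j\<in>{Suc i..Suc n}. A j)"
        by (rule prod.shift_bounds_cl_Suc_ivl[symmetric])
      also have "{Suc i..Suc n} = insert (Suc n) {i<..n}" using i by auto
      finally have PA: "(\<Prod>j\<in>{i..n}. A (Suc j)) = A (Suc n) * (\<Prod>j\<in>{i<..n}. A j)" by simp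
      have "{i..n} = insert i {i<..n}" using i by auto
      then have PB: "(\<Prod>j\<in>{i..n}. B j) = B i * (\<Prod>j\<in>{i<..n}. B j)" by simp
      have Bi: "B i = 1 / qpoch q q (\<theta> i)" using s[OF i] by (simp add: B_def)
      have PQ: "(\<Prod>j\<in>{i..n}. q ^ \<theta> i) = q ^ ((n - i + 1) * \<theta> i)"
        using i by (simp add: Suc_diff_le power_add mult.commute[of "\<theta> i"] flip: power_mult)
      have AB: "(\<Prod>j\<in>{i<..n}. A j) * (\<Prod>j\<in>{i<..n}. B j) = (\<Prod>j\<in>{i<..n}. pairw q (\<theta> i) (\<theta> j) (s i) (s j))"
        unfolding prod.distrib[symmetric] by (simp add: A_def B_def pairw_def)
      have "(\<Prod>j\<in>{i..n}. A (Suc j) * (q ^ \<theta> i * B j)) =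
         q ^ ((n - i + 1) * \<theta> i) * B i * A (Suc n) * ((\<Prod>j\<in>{i<..n}. A j) * (\<Prod>j\<in>{i<..n}. B j))"
        unfolding prod.distrib PA PB PQ by (simp only: mult_ac)
      then show "(\<Prod>j\<in>{i..n}. (1 / qpoch (q * s (Suc j) / s i) q (\<theta> i)) * (q ^ \<theta> i * (1 / qpoch (q powi (int (\<theta> j) - int (\<theta> i)) * q * s i / s j) q (\<theta> i)))) =
        (q ^ ((n - i + 1) * \<theta> i) / (qpoch q q (\<theta> i) * qpoch (q * s (Suc n) / s i) q (\<theta> i))) *
         (\<Prod>j\<in>{i<..n}. pairw q (\<theta> i) (\<theta> j) (s i) (s j))"
        unfolding AB Bi unfolding A_def B_def by simp
    qed
    also have "\<dots> = branchA n q s \<theta>" by (simp only: prod.distrib branchA_def pairprod_def)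
    finally show ?thesis .
  qed
  finally show ?thesis by (simp only: c)
qed

text \<open>The coefficient at x^e of x^(-\<theta>) f^A(x | q^(-\<theta>) s), the functions in which
  everything is expanded.\<close>

definition twisted :: "nat \<Rightarrow> 'a::field \<Rightarrow> (nat \<Rightarrow> 'a) \<Rightarrow> (nat \<Rightarrow> nat) \<Rightarrow> (nat \<Rightarrow> int) \<Rightarrow> 'a" where
  "twisted n q s \<theta> e = fA n (shift q \<theta> s) q (\<lambda>k. e k + int (\<theta> k))"

lemma fA_Suc:
  fixes s :: "nat \<Rightarrow> 'a::field"
  assumes "q \<noteq> 0" "\<And>i. i \<in> {1..n} \<Longrightarrow> s i \<noteq> 0"
  shows "fA (Suc n) s q e = (\<Sum>\<theta>\<in>weakcomp n (e (Suc n)). branchA n q s \<theta> * twisted n q s \<theta> (e(Suc n := 0)))"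
proof -
  have "fA (Suc n) s q e = (\<Sum>(\<theta>, \<Theta>)\<in>(SIGMA \<theta>:weakcomp n (e (Suc n)). Mset_at n (\<lambda>k. (e(Suc n := 0)) k + int (\<theta> k))).
      cToda (Suc n) (append_col n \<theta> \<Theta>) s q)"
    unfolding fA_eq_sum Mset_at_Suc sum.reindex[OF append_col_inj] by (simp add: case_prod_unfold o_def)
  also have "\<dots> = (\<Sum>\<theta>\<in>weakcomp n (e (Suc n)). \<Sum>\<Theta>\<in>Mset_at n (\<lambda>k. (e(Suc n := 0)) k + int (\<theta> k)).
      cToda (Suc n) (append_col n \<theta> \<Theta>) s q)"
    by (rule sum.Sigma[symmetric]) (auto simp: finite_weakcomp finite_Mset_at)
  also have "\<dots> = (\<Sum>\<theta>\<in>weakcomp n (e (Suc n)). branchA n q s \<theta> * twisted n q s \<theta> (e(Suc n := 0)))"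
    by (simp only: cToda_append_col[OF assms] twisted_def fA_eq_sum sum_distrib_left)
  finally show ?thesis .
qed

section \<open>Pieri rule and eigenvalue equations\<close>

text \<open>The operator with terms s_i (1 - x_{i+1} / x_i) T_i, where x_{n+1} is read as 0. The
  exponent \<open>e i + 1\<close> is that of x_i before the multiplication by x_{i+1} / x_i.\<close>

definition plusA :: "nat \<Rightarrow> (nat \<Rightarrow> 'a::field) \<Rightarrow> 'a \<Rightarrow> ((nat \<Rightarrow> int) \<Rightarrow> 'a) \<Rightarrow> (nat \<Rightarrow> int) \<Rightarrow> 'a" where
  "plusA n s q F e = (\<Sum>i\<in>{1..n}. s i * q powi (e i)) * F e
     - (\<Sum>i\<in>{1..<n}. s i * q powi (e i + 1) * F (\<lambda>k. e k - xr i (i+1) k))"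

text \<open>The operator with terms (1 - x_i / x_{i-1}) / s_i times the inverse of T_i, where x_1 /
  x_0 is read as 0; the second sum is indexed by i - 1.\<close>

definition minusA :: "nat \<Rightarrow> (nat \<Rightarrow> 'a::field) \<Rightarrow> 'a \<Rightarrow> ((nat \<Rightarrow> int) \<Rightarrow> 'a) \<Rightarrow> (nat \<Rightarrow> int) \<Rightarrow> 'a" where
  "minusA n s q F e = (\<Sum>i\<in>{1..n}. q powi (- e i) / s i) * F e
     - (\<Sum>i\<in>{1..<n}. q powi (1 - e (Suc i)) / s (Suc i) * F (\<lambda>k. e k - xr i (i+1) k))"

text \<open>Linearity, with \<open>e\<close> and \<open>e'\<close> kept apart because
  \<open>F\<close> may involve one more variable than the \<open>G \<theta>\<close>. They agree in
  the first n exponents, the only ones that enter the factors of the operator.\<close>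

lemma plusA_sum:
  assumes "F e = (\<Sum>\<theta>\<in>A. c \<theta> * G \<theta> e')"
    and "\<And>i. i \<in> {1..<n} \<Longrightarrow> F (\<lambda>k. e k - xr i (i+1) k) = (\<Sum>\<theta>\<in>A. c \<theta> * G \<theta> (\<lambda>k. e' k - xr i (i+1) k))"
    and "\<And>i. i \<in> {1..n} \<Longrightarrow> e i = e' i"
  shows "plusA n s q F e = (\<Sum>\<theta>\<in>A. c \<theta> * plusA n s q (G \<theta>) e')"
proof -
  have "(\<Sum>i\<in>{1..n}. s i * q powi (e i)) = (\<Sum>i\<in>{1..n}. s i * q powi (e' i))"
    by (rule sum.cong[OF refl]) (simp only: assms(3))
  moreover have "(\<Sum>i\<in>{1..<n}. s i * q powi (e i + 1) * F (\<lambda>k. e k - xr i (i+1) k)) =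
     (\<Sum>i\<in>{1..<n}. s i * q powi (e' i + 1) * (\<Sum>\<theta>\<in>A. c \<theta> * G \<theta> (\<lambda>k. e' k - xr i (i+1) k)))"
  proof (rule sum.cong[OF refl])
    fix i assume i: "i \<in> {1..<n}"
    then have "e i = e' i" "e (Suc i) = e' (Suc i)" by (auto intro!: assms(3))
    then show "s i * q powi (e i + 1) * F (\<lambda>k. e k - xr i (i+1) k) =
      s i * q powi (e' i + 1) * (\<Sum>\<theta>\<in>A. c \<theta> * G \<theta> (\<lambda>k. e' k - xr i (i+1) k))"
      unfolding assms(2)[OF i] by simp
  qed
  ultimately have "plusA n s q F e = (\<Sum>i\<in>{1..n}. s i * q powi (e' i)) * (\<Sum>\<theta>\<in>A. c \<theta> * G \<theta> e')
    - (\<Sum>i\<in>{1..<n}. s i * q powi (e' i + 1) * (\<Sum>\<theta>\<in>A. c \<theta> * G \<theta> (\<lambda>k. e' k - xr i (i+1) k)))"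
    unfolding plusA_def assms(1) by (simp only:)
  also have "(\<Sum>i\<in>{1..<n}. s i * q powi (e' i + 1) * (\<Sum>\<theta>\<in>A. c \<theta> * G \<theta> (\<lambda>k. e' k - xr i (i+1) k)))
    = (\<Sum>\<theta>\<in>A. \<Sum>i\<in>{1..<n}. c \<theta> * (s i * q powi (e' i + 1) * G \<theta> (\<lambda>k. e' k - xr i (i+1) k)))"
    unfolding sum_distrib_left by (subst sum.swap) (simp only: mult_ac)
  finally show ?thesis
    unfolding plusA_def right_diff_distrib sum_subtractf sum_distrib_left[symmetric]
    by (simp only: mult.left_commute[of "c _"] sum_distrib_left)
qed

lemma minusA_sum:
  assumes "F e = (\<Sum>\<theta>\<in>A. c \<theta> * G \<theta> e')"
    and "\<And>i. i \<in> {1..<n} \<Longrightarrow> F (\<lambda>k. e k - xr i (i+1) k) = (\<Sum>\<theta>\<in>A. c \<theta> * G \<theta> (\<lambda>k. e' k - xr i (i+1) k))"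
    and "\<And>i. i \<in> {1..n} \<Longrightarrow> e i = e' i"
  shows "minusA n s q F e = (\<Sum>\<theta>\<in>A. c \<theta> * minusA n s q (G \<theta>) e')"
proof -
  have "(\<Sum>i\<in>{1..n}. q powi (- e i) / s i) = (\<Sum>i\<in>{1..n}. q powi (- e' i) / s i)"
    by (rule sum.cong[OF refl]) (simp only: assms(3))
  moreover have "(\<Sum>i\<in>{1..<n}. q powi (1 - e (Suc i)) / s (Suc i) * F (\<lambda>k. e k - xr i (i+1) k)) =
     (\<Sum>i\<in>{1..<n}. q powi (1 - e' (Suc i)) / s (Suc i) * (\<Sum>\<theta>\<in>A. c \<theta> * G \<theta> (\<lambda>k. e' k - xr i (i+1) k)))"
  proof (rule sum.cong[OF refl])
    fix i assume i: "i \<in> {1..<n}"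
    then have "e i = e' i" "e (Suc i) = e' (Suc i)" by (auto intro!: assms(3))
    then show "q powi (1 - e (Suc i)) / s (Suc i) * F (\<lambda>k. e k - xr i (i+1) k) =
      q powi (1 - e' (Suc i)) / s (Suc i) * (\<Sum>\<theta>\<in>A. c \<theta> * G \<theta> (\<lambda>k. e' k - xr i (i+1) k))"
      unfolding assms(2)[OF i] by simp
  qed
  ultimately have "minusA n s q F e = (\<Sum>i\<in>{1..n}. q powi (- e' i) / s i) * (\<Sum>\<theta>\<in>A. c \<theta> * G \<theta> e')
    - (\<Sum>i\<in>{1..<n}. q powi (1 - e' (Suc i)) / s (Suc i) * (\<Sum>\<theta>\<in>A. c \<theta> * G \<theta> (\<lambda>k. e' k - xr i (i+1) k)))"
    unfolding minusA_def assms(1) by (simp only:)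
  also have "(\<Sum>i\<in>{1..<n}. q powi (1 - e' (Suc i)) / s (Suc i) * (\<Sum>\<theta>\<in>A. c \<theta> * G \<theta> (\<lambda>k. e' k - xr i (i+1) k)))
    = (\<Sum>\<theta>\<in>A. \<Sum>i\<in>{1..<n}. c \<theta> * (q powi (1 - e' (Suc i)) / s (Suc i) * G \<theta> (\<lambda>k. e' k - xr i (i+1) k)))"
    unfolding sum_distrib_left by (subst sum.swap) (simp only: mult_ac)
  finally show ?thesis
    unfolding minusA_def right_diff_distrib sum_subtractf sum_distrib_left[symmetric]
    by (simp only: mult.left_commute[of "c _"] sum_distrib_left)
qed

text \<open>Stated for all generic \<open>s\<close>, since the induction on the rank applies it at
  shifted parameters.\<close>

definition eigen_plus :: "nat \<Rightarrow> 'a::field \<Rightarrow> bool" where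
  "eigen_plus n q \<longleftrightarrow> (\<forall>s e. generic n q s \<longrightarrow> plusA n s q (fA n s q) e = (\<Sum>i\<in>{1..n}. s i) * fA n s q e)"

definition eigen_minus :: "nat \<Rightarrow> 'a::field \<Rightarrow> bool" where
  "eigen_minus n q \<longleftrightarrow> (\<forall>s e. generic n q s \<longrightarrow> minusA n s q (fA n s q) e = (\<Sum>i\<in>{1..n}. 1 / s i) * fA n s q e)"

text \<open>Moving T_i past x^(-\<theta>) produces q^(-\<theta>_i), so conjugation by this monomial
  replaces \<open>s\<close> by \<open>shift q \<theta> s\<close>.\<close>

lemma twisted_plus:
  assumes "eigen_plus n q" and g: "generic n q s"
  shows "plusA n s q (twisted n q s \<theta>) e = (\<Sum>i\<in>{1..n}. shift q \<theta> s i) * twisted n q s \<theta> e"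
proof -
  have q: "q \<noteq> 0" using genericD[OF g] by simp
  have "s i * q powi m = shift q \<theta> s i * q powi (m + int (\<theta> i))" for i m
    using q by (simp add: shift_def power_int_add)
  note * = this[of _ "e _"] this[of _ "e _ + 1"]
  have "plusA n s q (twisted n q s \<theta>) e = plusA n (shift q \<theta> s) q (fA n (shift q \<theta> s) q) (\<lambda>k. e k + int (\<theta> k))"
    unfolding plusA_def twisted_def * by (simp add: algebra_simps)
  then show ?thesis
    using assms(1) generic_shift[OF g] unfolding eigen_plus_def twisted_def by simp
qed

lemma twisted_minus:
  assumes "eigen_minus n q" and g: "generic n q s"
  shows "minusA n s q (twisted n q s \<theta>) e = (\<Sum>i\<in>{1..n}. 1 / shift q \<theta> s i) * twisted n q s \<theta> e"
proof -
  have q: "q \<noteq> 0" using genericD[OF g] by simp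
  have *: "q powi (- e i) / s i = q powi (- (e i + int (\<theta> i))) / shift q \<theta> s i"
    "q powi (1 - e i) / s i = q powi (1 - (e i + int (\<theta> i))) / shift q \<theta> s i" for i
    using q by (simp_all add: shift_def power_int_add power_int_diff power_int_minus)
  have "minusA n s q (twisted n q s \<theta>) e = minusA n (shift q \<theta> s) q (fA n (shift q \<theta> s) q) (\<lambda>k. e k + int (\<theta> k))"
    unfolding minusA_def twisted_def * by (simp add: algebra_simps)
  then show ?thesis
    using assms(1) generic_shift[OF g] unfolding eigen_minus_def twisted_def by simp
qed

section \<open>The Pieri rule\<close>

lemma twisted_fun_upd:
  assumes "q \<noteq> 0"
  shows "twisted n q (s(k := s k / q)) \<theta> (e(k := e k + 1)) = twisted n q s (\<theta>(k := Suc (\<theta> k))) e"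
proof -
  have "shift q \<theta> (s(k := s k / q)) = shift q (\<theta>(k := Suc (\<theta> k))) s"
    by (auto simp: shift_def fun_eq_iff)
  moreover have "(\<lambda>i. (e(k := e k + 1)) i + int (\<theta> i)) = (\<lambda>i. e i + int ((\<theta>(k := Suc (\<theta> k))) i))"
    by auto
  ultimately show ?thesis unfolding twisted_def by simp
qed

lemma twisted_0: "twisted n q s (\<lambda>_. 0) e = fA n s q e"
  by (simp add: twisted_def shift_def)

lemma twisted_unit:
  "q \<noteq> 0 \<Longrightarrow> fA n (s(k := s k / q)) q (e(k := e k + 1)) = twisted n q s ((\<lambda>_. 0)(k := Suc 0)) e"
  using twisted_fun_upd[of q n s k "\<lambda>_. 0" e] by (simp add: twisted_0)

text \<open>Both sides are branched. The terms with k at most n keep the degree in x_{n+1} and raise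
  an entry of \<theta>; in the term k = n + 1 the degree itself is higher by one and the functions
  of rank n are unchanged. Everything is then expanded in the same functions, and
  \<open>sum_branchA_shift\<close> compares the coefficients.\<close>

lemma fA_pieri_Suc:
  assumes g: "generic (Suc n) q s"
  shows "fA (Suc n) s q (e(Suc n := e (Suc n) + 1)) =
    (\<Sum>k\<in>{1..Suc n}. pieri (Suc n) q s k * fA (Suc n) (s(k := s k / q)) q (e(k := e k + 1)))"
proof -
  let ?m = "e (Suc n)" and ?e = "e(Suc n := 0)" and ?sl = "s(Suc n := s (Suc n) / q)"
  let ?tw = "\<lambda>\<eta>. twisted n q s \<eta> ?e"
  have q: "q \<noteq> 0" using genericD[OF g] by simp
  have rec: "fA (Suc n) s' q e = (\<Sum>\<theta>\<in>weakcomp n (e (Suc n)). branchA n q s' \<theta> * twisted n q s' \<theta> (e(Suc n := 0)))"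
    if "generic (Suc n) q s'" for s' e
    using genericD(3)[OF that] by (intro fA_Suc q) simp
  have last: "fA (Suc n) ?sl q (e(Suc n := ?m + 1)) = (\<Sum>\<eta>\<in>weakcomp n (?m + 1). branchA n q ?sl \<eta> * ?tw \<eta>)"
  proof -
    have "fA n (shift q \<eta> ?sl) q = fA n (shift q \<eta> s) q" for \<eta>
      by (rule fA_cong) (auto simp: shift_def)
    then show ?thesis unfolding rec[OF generic_fun_upd[OF g]] by (simp add: twisted_def del: fun_upd_apply add: fun_upd_same)
  qed
  have other: "fA (Suc n) (s(k := s k / q)) q (e(k := e k + 1)) =
     (\<Sum>\<theta>\<in>weakcomp n ?m. branchA n q (s(k := s k / q)) \<theta> * ?tw (\<theta>(k := Suc (\<theta> k))))" if k: "k \<in> {1..n}" for k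
  proof -
    have "(e(k := e k + 1))(Suc n := 0) = ?e(k := ?e k + 1)" using k by auto
    moreover have "(e(k := e k + 1)) (Suc n) = ?m" using k by auto
    ultimately show ?thesis unfolding rec[OF generic_fun_upd[OF g]] by (simp only: twisted_fun_upd[OF q])
  qed
  have "(\<Sum>k\<in>{1..n}. pieri (Suc n) q s k * fA (Suc n) (s(k := s k / q)) q (e(k := e k + 1))) =
    (\<Sum>k\<in>{1..n}. \<Sum>\<theta>\<in>weakcomp n ?m. (pieri (Suc n) q s k * branchA n q (s(k := s k / q)) \<theta>) * ?tw (\<theta>(k := Suc (\<theta> k))))"
    by (rule sum.cong[OF refl]) (simp only: other sum_distrib_left mult.assoc)
  also have "\<dots> = (\<Sum>\<theta>\<in>weakcomp n ?m. \<Sum>k\<in>{1..n}. (pieri (Suc n) q s k * branchA n q (s(k := s k / q)) \<theta>) * ?tw (\<theta>(k := Suc (\<theta> k))))"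
    by (rule sum.swap)
  also have "\<dots> = (\<Sum>\<eta>\<in>weakcomp n (?m + 1). (\<Sum>k\<in>{1..n}. if \<eta> k = 0 then 0 else
      pieri (Suc n) q s k * branchA n q (s(k := s k / q)) (\<eta>(k := \<eta> k - 1))) * ?tw \<eta>)"
    by (rule sum_bump)
  finally have "(\<Sum>k\<in>{1..n}. pieri (Suc n) q s k * fA (Suc n) (s(k := s k / q)) q (e(k := e k + 1)))
     + fA (Suc n) ?sl q (e(Suc n := ?m + 1)) =
    (\<Sum>\<eta>\<in>weakcomp n (?m + 1). ((\<Sum>k\<in>{1..n}. if \<eta> k = 0 then 0 else
      pieri (Suc n) q s k * branchA n q (s(k := s k / q)) (\<eta>(k := \<eta> k - 1))) + branchA n q ?sl \<eta>) * ?tw \<eta>)"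
    unfolding last by (simp only: sum.distrib distrib_right)
  also have "\<dots> = fA (Suc n) s q (e(Suc n := ?m + 1))"
    unfolding sum_branchA_shift[OF g] using rec[OF g, of "e(Suc n := ?m + 1)"] by simp
  \<comment> \<open>For k = n + 1 the product in \<open>pieri\<close> is empty.\<close>
  also have "fA (Suc n) ?sl q (e(Suc n := ?m + 1)) = pieri (Suc n) q s (Suc n) * fA (Suc n) ?sl q (e(Suc n := ?m + 1))"
    by (simp add: pieri_def)
  finally show ?thesis by (simp del: fun_upd_apply add: sum.cl_ivl_Suc)
qed

lemma fA_pieri:
  assumes "generic n q s" "n \<ge> 1"
  shows "fA n s q (e(n := e n + 1)) = (\<Sum>k\<in>{1..n}. pieri n q s k * fA n (s(k := s k / q)) q (e(k := e k + 1)))"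
  using fA_pieri_Suc[of "n - 1" q s e] assms by simp

lemma twisted_pieri:
  assumes "generic n q s" "n \<ge> 1"
  shows "twisted n q s \<theta> (e(n := e n + 1)) =
    (\<Sum>k\<in>{1..n}. pieri n q (shift q \<theta> s) k * twisted n q s (\<theta>(k := Suc (\<theta> k))) e)"
proof -
  have upd: "(\<lambda>i. (e(k := e k + 1)) i + int (\<theta> i)) = (\<lambda>i. e i + int (\<theta> i))(k := (\<lambda>i. e i + int (\<theta> i)) k + 1)"
    "(\<lambda>i. e i + int ((\<theta>(k := Suc (\<theta> k))) i)) = (\<lambda>i. e i + int (\<theta> i))(k := (\<lambda>i. e i + int (\<theta> i)) k + 1)" for k
    by auto
  show ?thesis
    unfolding twisted_def upd shift_bump by (rule fA_pieri[OF generic_shift[OF assms(1)] assms(2)])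
qed

text \<open>Commuting the operator \<open>plusA\<close> with multiplication by \<open>1 / x\<^sub>n\<close> turns the expansion of
  \<open>1 / x\<^sub>n\<close> into one of \<open>(1 / x\<^sub>n) T\<^sub>n\<close>.\<close>

lemma fA_pieri_plus:
  assumes g: "generic n q s" and n: "n \<ge> 1" and ev: "eigen_plus n q"
  shows "s n * q powi (e n + 1) * fA n s q (e(n := e n + 1)) =
    (\<Sum>k\<in>{1..n}. s k * pieri n q s k * fA n (s(k := s k / q)) q (e(k := e k + 1)))"
proof -
  have q: "q \<noteq> 0" "q \<noteq> 1" using genericD(1)[OF g] genericD(2)[OF g, of 1] by auto
  let ?S = "\<Sum>i\<in>{1..n}. s i"
  define u :: "nat \<Rightarrow> nat \<Rightarrow> nat" where "u k = (\<lambda>_. 0)(k := Suc 0)" for k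
  define G where "G e = fA n s q (e(n := e n + 1))" for e
  have G: "G e = (\<Sum>k\<in>{1..n}. pieri n q s k * twisted n q s (u k) e)" for e
    unfolding G_def u_def fA_pieri[OF g n] twisted_unit[OF q(1)] ..
  have "plusA n s q G e = (\<Sum>k\<in>{1..n}. pieri n q s k * plusA n s q (twisted n q s (u k)) e)"
    by (rule plusA_sum) (simp_all only: G)
  also have "\<dots> = (\<Sum>k\<in>{1..n}. pieri n q s k * ((?S + (s k / q - s k)) * twisted n q s (u k) e))"
  proof (rule sum.cong[OF refl])
    fix k assume k: "k \<in> {1..n}"
    \<comment> \<open>Dividing \<open>s k\<close> by \<open>q\<close> changes the type A eigenvalue
      by \<open>s k\<close> times \<open>1 / q - 1\<close>, a factor common to all k.\<close>
    have "(\<Sum>i\<in>{1..n}. shift q (u k) s i) = ?S + (s k / q - s k)"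
      using k by (subst (1 2) sum.remove[of _ k]) (auto simp: u_def shift_def intro!: sum.cong)
    then show "pieri n q s k * plusA n s q (twisted n q s (u k)) e = pieri n q s k * ((?S + (s k / q - s k)) * twisted n q s (u k) e)"
      unfolding twisted_plus[OF ev g] by simp
  qed
  also have "\<dots> = ?S * G e + (1 / q - 1) * (\<Sum>k\<in>{1..n}. s k * pieri n q s k * twisted n q s (u k) e)"
    unfolding G sum_distrib_left sum.distrib[symmetric] by (rule sum.cong) (simp_all add: algebra_simps)
  finally have 1: "plusA n s q G e = ?S * G e + (1 / q - 1) * (\<Sum>k\<in>{1..n}. s k * pieri n q s k * twisted n q s (u k) e)" .
  let ?e = "e(n := e n + 1)"
  \<comment> \<open>Only T_n fails to commute with multiplication by 1 / x_n, and in
    \<open>plusA\<close> it occurs just once, on the diagonal, so the commutator is this single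
    term.\<close>
  have "plusA n s q G e = plusA n s q (fA n s q) ?e + (s n * q powi (e n) - s n * q powi (e n + 1)) * G e"
  proof -
    have f1: "(\<Sum>i\<in>{1..n}. s i * q powi (e i)) = (\<Sum>i\<in>{1..n}. s i * q powi (?e i)) + (s n * q powi (e n) - s n * q powi (e n + 1))"
      using n by (subst (1 2) sum.remove[of _ n]) (auto intro!: sum.cong)
    have f2: "(\<Sum>i\<in>{1..<n}. s i * q powi (e i + 1) * G (\<lambda>k. e k - xr i (i+1) k)) =
      (\<Sum>i\<in>{1..<n}. s i * q powi (?e i + 1) * fA n s q (\<lambda>k. ?e k - xr i (i+1) k))"
    proof (rule sum.cong[OF refl])
      fix i assume i: "i \<in> {1..<n}"
      have "(\<lambda>k. e k - xr i (i+1) k)(n := (\<lambda>k. e k - xr i (i+1) k) n + 1) = (\<lambda>k. ?e k - xr i (i+1) k)"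
        by auto
      then show "s i * q powi (e i + 1) * G (\<lambda>k. e k - xr i (i+1) k) =
        s i * q powi (?e i + 1) * fA n s q (\<lambda>k. ?e k - xr i (i+1) k)"
        using i unfolding G_def by simp
    qed
    show ?thesis unfolding plusA_def f1 f2 unfolding G_def by (simp only: distrib_right) simp
  qed
  also have "plusA n s q (fA n s q) ?e = ?S * G e"
    using ev g unfolding eigen_plus_def G_def by blast
  finally have "(s n * q powi (e n) - s n * q powi (e n + 1)) * G e =
     (1 / q - 1) * (\<Sum>k\<in>{1..n}. s k * pieri n q s k * twisted n q s (u k) e)" using 1 by simp
  moreover have "s n * q powi (e n) - s n * q powi (e n + 1) = (1 / q - 1) * (s n * q powi (e n + 1))"
    using q by (simp add: power_int_add field_simps)
  \<comment> \<open>Both evaluations of the commutator contain this factor, which is now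
    cancelled.\<close>
  moreover have "1 / q - 1 \<noteq> 0" using q by (simp add: field_simps)
  ultimately have "s n * q powi (e n + 1) * G e = (\<Sum>k\<in>{1..n}. s k * pieri n q s k * twisted n q s (u k) e)"
    by (simp only: mult.assoc mult_cancel_left) simp
  then show ?thesis unfolding G_def u_def twisted_unit[OF q(1)] .
qed

lemma twisted_pieri_plus:
  assumes g: "generic n q s" and n: "n \<ge> 1" and ev: "eigen_plus n q"
  shows "s n * q powi (e n + 1) * twisted n q s \<theta> (e(n := e n + 1)) =
    (\<Sum>k\<in>{1..n}. shift q \<theta> s k * pieri n q (shift q \<theta> s) k * twisted n q s (\<theta>(k := Suc (\<theta> k))) e)"
proof -
  have upd: "(\<lambda>i. (e(k := e k + 1)) i + int (\<theta> i)) = (\<lambda>i. e i + int (\<theta> i))(k := (\<lambda>i. e i + int (\<theta> i)) k + 1)"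
    "(\<lambda>i. e i + int ((\<theta>(k := Suc (\<theta> k))) i)) = (\<lambda>i. e i + int (\<theta> i))(k := (\<lambda>i. e i + int (\<theta> i)) k + 1)" for k
    by auto
  have "s n * q powi (e n + 1) = shift q \<theta> s n * q powi ((\<lambda>i. e i + int (\<theta> i)) n + 1)"
    using genericD(1)[OF g] by (simp add: shift_def power_int_add)
  then show ?thesis
    unfolding twisted_def upd shift_bump using fA_pieri_plus[OF generic_shift[OF g] n ev] by simp
qed

section \<open>Support of the type A series and induction on the rank\<close>

lemma sum_xr:
  assumes "1 \<le> i" "i < j"
  shows "(\<Sum>k\<in>{1..m}. xr i j k) = (if j \<le> m then 1 else 0) - (if i \<le> m then 1 else 0)"
  using assms by (auto simp: xr_def sum_subtractf)

text \<open>A factor x_j / x_i with i < j has partial exponent sums 0 or -1 and total exponent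
  0.\<close>

lemma fA_support:
  assumes "fA n s q e \<noteq> 0"
  shows "k \<notin> {1..n} \<Longrightarrow> e k = 0" "(\<Sum>k\<in>{1..m}. e k) \<le> 0" "(\<Sum>k\<in>{1..n}. e k) = 0"
proof -
  obtain \<Theta> where e: "e = xexpA n \<Theta>"
    using assms unfolding fA_eq_sum Mset_at_def by (metis (mono_tags, lifting) mem_Collect_eq sum.neutral)
  show "k \<notin> {1..n} \<Longrightarrow> e k = 0"
    unfolding e xexpA_def by (intro sum.neutral ballI) (auto simp: xr_def)
  have eq: "(\<Sum>k\<in>{1..m}. e k) = (\<Sum>i\<in>{1..n}. \<Sum>j\<in>{i<..n}. int (\<Theta> i j) * (\<Sum>k\<in>{1..m}. xr i j k))" for m
    unfolding e xexpA_def sum_distrib_left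
    by (subst sum.swap) (intro sum.cong refl sum.swap)
  show "(\<Sum>k\<in>{1..m}. e k) \<le> 0"
    unfolding eq by (intro sum_nonpos) (auto simp: sum_xr[unfolded One_nat_def] intro!: mult_nonneg_nonpos)
  show "(\<Sum>k\<in>{1..n}. e k) = 0"
    unfolding eq by (intro sum.neutral ballI) (auto simp: sum_xr[unfolded One_nat_def])
qed

text \<open>In one variable the support forces \<open>e 1 = 0\<close>, where the operator is
  multiplication by \<open>s 1\<close>.\<close>

lemma eigen_plus_1: "eigen_plus (Suc 0) q"
  unfolding eigen_plus_def plusA_def using fA_support(3)[of "Suc 0"] by fastforce

lemma eigen_minus_1: "eigen_minus (Suc 0) q"
  unfolding eigen_minus_def minusA_def using fA_support(3)[of "Suc 0"] by fastforce

text \<open>These are the coefficients that the operators of rank n + 1 read at \<open>e\<close>.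
  Neighbours within the first n variables keep the degree in x_{n+1}; the last one lowers it by one
  and amounts to multiplication by 1 / x_n in rank n.\<close>

lemma fA_Suc_neighbours:
  fixes s :: "nat \<Rightarrow> 'a::field" and e :: "nat \<Rightarrow> int"
  assumes g: "generic (Suc n) q s" and n: "n \<ge> 1"
  defines "F \<equiv> fA (Suc n) s q" and "e0 \<equiv> e(Suc n := 0)"
  shows "F e = (\<Sum>\<theta>\<in>weakcomp n (e (Suc n)). branchA n q s \<theta> * twisted n q s \<theta> e0)"
    and "i \<in> {1..<n} \<Longrightarrow> F (\<lambda>k. e k - xr i (i+1) k) =
      (\<Sum>\<theta>\<in>weakcomp n (e (Suc n)). branchA n q s \<theta> * twisted n q s \<theta> (\<lambda>k. e0 k - xr i (i+1) k))"
    and "F (\<lambda>k. e k - xr n (Suc n) k) =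
      (\<Sum>\<theta>\<in>weakcomp n (e (Suc n) - 1). branchA n q s \<theta> * twisted n q s \<theta> (e0(n := e0 n + 1)))"
proof -
  have rec: "F e = (\<Sum>\<theta>\<in>weakcomp n (e (Suc n)). branchA n q s \<theta> * twisted n q s \<theta> (e(Suc n := 0)))" for e
    unfolding F_def using genericD(1,3)[OF g] by (intro fA_Suc) simp_all
  then show "F e = (\<Sum>\<theta>\<in>weakcomp n (e (Suc n)). branchA n q s \<theta> * twisted n q s \<theta> e0)"
    by (simp only: e0_def)
  show "F (\<lambda>k. e k - xr i (i+1) k) =
      (\<Sum>\<theta>\<in>weakcomp n (e (Suc n)). branchA n q s \<theta> * twisted n q s \<theta> (\<lambda>k. e0 k - xr i (i+1) k))" if "i \<in> {1..<n}"
  proof -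
    have "(\<lambda>k. e k - xr i (i+1) k)(Suc n := 0) = (\<lambda>k. e0 k - xr i (i+1) k)"
      using that by (auto simp: e0_def xr_def fun_eq_iff)
    moreover have "xr i (i+1) (Suc n) = 0" using that by (simp add: xr_def)
    ultimately show ?thesis unfolding rec by simp
  qed
  have "(\<lambda>k. e k - xr n (Suc n) k)(Suc n := 0) = e0(n := e0 n + 1)"
    by (auto simp: e0_def xr_def fun_eq_iff)
  moreover have "xr n (Suc n) (Suc n) = 1" by (simp add: xr_def)
  ultimately show "F (\<lambda>k. e k - xr n (Suc n) k) =
      (\<Sum>\<theta>\<in>weakcomp n (e (Suc n) - 1). branchA n q s \<theta> * twisted n q s \<theta> (e0(n := e0 n + 1)))"
    unfolding rec by simp
qed

lemma weakcomp_powi: "\<eta> \<in> weakcomp n m \<Longrightarrow> q powi m = q ^ (\<Sum>k\<in>{1..n}. \<eta> k)"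
  unfolding weakcomp_def using power_int_of_nat by blast

lemma eigen_plus_Suc:
  assumes ev: "eigen_plus n q" and n: "n \<ge> 1"
  shows "eigen_plus (Suc n) (q :: 'a::field)"
  unfolding eigen_plus_def
proof (intro allI impI)
  fix s :: "nat \<Rightarrow> 'a" and e :: "nat \<Rightarrow> int" assume g: "generic (Suc n) q s"
  have gn: "generic n q s" using generic_mono[OF g] by simp
  let ?F = "fA (Suc n) s q" and ?m = "e (Suc n)" and ?S = "\<Sum>i\<in>{1..n}. s i" and ?\<sigma> = "s (Suc n)"
  define e0 where "e0 = e(Suc n := 0)"
  define T where "T \<eta> = (\<Sum>i\<in>{1..n}. shift q \<eta> s i)" for \<eta>
  define tw where "tw \<eta> = twisted n q s \<eta> e0" for \<eta>
  note F = fA_Suc_neighbours[OF g n, where e = e, folded e0_def]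
  have "plusA n s q ?F e = (\<Sum>\<theta>\<in>weakcomp n ?m. branchA n q s \<theta> * plusA n s q (twisted n q s \<theta>) e0)"
    by (rule plusA_sum) (use F(1,2) in \<open>auto simp: e0_def\<close>)
  then have A: "plusA n s q ?F e = (\<Sum>\<eta>\<in>weakcomp n ?m. branchA n q s \<eta> * T \<eta> * tw \<eta>)"
    unfolding twisted_plus[OF ev gn] T_def tw_def by (simp only: mult.assoc)
  have "s n * q powi (e n + 1) * ?F (\<lambda>k. e k - xr n (Suc n) k) =
    (\<Sum>\<theta>\<in>weakcomp n (?m - 1). branchA n q s \<theta> * (s n * q powi (e0 n + 1) * twisted n q s \<theta> (e0(n := e0 n + 1))))"
    unfolding F(3) sum_distrib_left by (rule sum.cong) (simp_all add: e0_def del: fun_upd_apply add: fun_upd_other)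
  also have "\<dots> = (\<Sum>\<theta>\<in>weakcomp n (?m - 1). \<Sum>k\<in>{1..n}.
      (shift q \<theta> s k * pieri n q (shift q \<theta> s) k * branchA n q s \<theta>) * tw (\<theta>(k := Suc (\<theta> k))))"
    unfolding twisted_pieri_plus[OF gn n ev] sum_distrib_left tw_def by (simp only: mult_ac)
  also have "\<dots> = (\<Sum>\<eta>\<in>weakcomp n (?m - 1 + 1). (\<Sum>k\<in>{1..n}. if \<eta> k = 0 then 0 else
      shift q (\<eta>(k := \<eta> k - 1)) s k * pieri n q (shift q (\<eta>(k := \<eta> k - 1)) s) k * branchA n q s (\<eta>(k := \<eta> k - 1))) * tw \<eta>)"
    by (rule sum_bump)
  also have "\<dots> = (\<Sum>\<eta>\<in>weakcomp n ?m. branchA n q s \<eta> * (T \<eta> - ?S - ?\<sigma> * (1 - q powi ?m)) * tw \<eta>)"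
    unfolding sum_branchA_plus[OF g] T_def
    by (rule sum.cong) (simp_all only: diff_add_cancel weakcomp_powi[of _ n ?m q])
  finally have B: "s n * q powi (e n + 1) * ?F (\<lambda>k. e k - xr n (Suc n) k) =
    (\<Sum>\<eta>\<in>weakcomp n ?m. branchA n q s \<eta> * (T \<eta> - ?S - ?\<sigma> * (1 - q powi ?m)) * tw \<eta>)" .
  have C: "?F e = (\<Sum>\<eta>\<in>weakcomp n ?m. branchA n q s \<eta> * tw \<eta>)" using F(1) by (simp only: tw_def)
  have "{1..<Suc n} = insert n {1..<n}" using n by auto
  then have "plusA (Suc n) s q ?F e = plusA n s q ?F e + ?\<sigma> * q powi ?m * ?F e
      - s n * q powi (e n + 1) * ?F (\<lambda>k. e k - xr n (Suc n) k)"
    by (simp add: plusA_def algebra_simps)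
  \<comment> \<open>In front of each function stands T + \<sigma> q^m - (T - S - \<sigma> (1 - q^m))
    = S + \<sigma>: the shifted eigenvalue and the power of \<open>q\<close> both drop out.\<close>
  also have "\<dots> = (\<Sum>\<eta>\<in>weakcomp n ?m. (?S + ?\<sigma>) * (branchA n q s \<eta> * tw \<eta>))"
    unfolding A B unfolding C sum_distrib_left sum.distrib[symmetric] sum_subtractf[symmetric]
    by (rule sum.cong) (simp_all add: algebra_simps)
  also have "\<dots> = (\<Sum>i\<in>{1..Suc n}. s i) * ?F e"
    unfolding C sum_distrib_left[symmetric] by simp
  finally show "plusA (Suc n) s q ?F e = (\<Sum>i\<in>{1..Suc n}. s i) * ?F e" .
qed

text \<open>In contrast to \<open>eigen_plus_Suc\<close>, the shift in the boundary term is the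
  inverse of T_{n+1}, a scalar on each power of x_{n+1}. What remains is multiplication by 1 / x_n,
  which the plain Pieri rule expands.\<close>

lemma eigen_minus_Suc:
  assumes ev: "eigen_minus n q" and n: "n \<ge> 1"
  shows "eigen_minus (Suc n) (q :: 'a::field)"
  unfolding eigen_minus_def
proof (intro allI impI)
  fix s :: "nat \<Rightarrow> 'a" and e :: "nat \<Rightarrow> int" assume g: "generic (Suc n) q s"
  have gn: "generic n q s" using generic_mono[OF g] by simp
  have q: "q \<noteq> 0" using genericD[OF g] by simp
  let ?F = "fA (Suc n) s q" and ?m = "e (Suc n)" and ?S = "\<Sum>i\<in>{1..n}. 1 / s i" and ?\<sigma> = "s (Suc n)"
  have \<sigma>: "?\<sigma> \<noteq> 0" using genericD(3)[OF g] by simp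
  define e0 where "e0 = e(Suc n := 0)"
  define T where "T \<eta> = (\<Sum>i\<in>{1..n}. 1 / shift q \<eta> s i)" for \<eta>
  define tw where "tw \<eta> = twisted n q s \<eta> e0" for \<eta>
  note F = fA_Suc_neighbours[OF g n, where e = e, folded e0_def]
  have "minusA n s q ?F e = (\<Sum>\<theta>\<in>weakcomp n ?m. branchA n q s \<theta> * minusA n s q (twisted n q s \<theta>) e0)"
    by (rule minusA_sum) (use F(1,2) in \<open>auto simp: e0_def\<close>)
  then have A: "minusA n s q ?F e = (\<Sum>\<eta>\<in>weakcomp n ?m. branchA n q s \<eta> * T \<eta> * tw \<eta>)"
    unfolding twisted_minus[OF ev gn] T_def tw_def by (simp only: mult.assoc)
  have "?F (\<lambda>k. e k - xr n (Suc n) k) = (\<Sum>\<theta>\<in>weakcomp n (?m - 1). \<Sum>k\<in>{1..n}.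
      (pieri n q (shift q \<theta> s) k * branchA n q s \<theta>) * tw (\<theta>(k := Suc (\<theta> k))))"
    unfolding F(3) twisted_pieri[OF gn n] sum_distrib_left tw_def by (simp only: mult_ac)
  also have "\<dots> = (\<Sum>\<eta>\<in>weakcomp n (?m - 1 + 1). (\<Sum>k\<in>{1..n}. if \<eta> k = 0 then 0 else
      pieri n q (shift q (\<eta>(k := \<eta> k - 1)) s) k * branchA n q s (\<eta>(k := \<eta> k - 1))) * tw \<eta>)"
    by (rule sum_bump)
  also have "\<dots> = (\<Sum>\<eta>\<in>weakcomp n ?m. branchA n q s \<eta> / q * (1 - q powi ?m - ?\<sigma> * (q powi ?m * (?S - T \<eta>))) * tw \<eta>)"
    unfolding sum_branchA_minus[OF g] T_def
    by (rule sum.cong) (simp_all only: diff_add_cancel weakcomp_powi[of _ n ?m q])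
  finally have B: "?F (\<lambda>k. e k - xr n (Suc n) k) =
    (\<Sum>\<eta>\<in>weakcomp n ?m. branchA n q s \<eta> / q * (1 - q powi ?m - ?\<sigma> * (q powi ?m * (?S - T \<eta>))) * tw \<eta>)" .
  have C: "?F e = (\<Sum>\<eta>\<in>weakcomp n ?m. branchA n q s \<eta> * tw \<eta>)" using F(1) by (simp only: tw_def)
  have "{1..<Suc n} = insert n {1..<n}" using n by auto
  then have "minusA (Suc n) s q ?F e = minusA n s q ?F e + q powi (- ?m) / ?\<sigma> * ?F e
      - q powi (1 - ?m) / ?\<sigma> * ?F (\<lambda>k. e k - xr n (Suc n) k)"
    by (simp add: minusA_def algebra_simps)
  also have "\<dots> = (\<Sum>\<eta>\<in>weakcomp n ?m. (?S + 1 / ?\<sigma>) * (branchA n q s \<eta> * tw \<eta>))"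
    unfolding A B unfolding C sum_distrib_left sum.distrib[symmetric] sum_subtractf[symmetric]
  proof (rule sum.cong[OF refl])
    fix \<eta>
    define Q where "Q = q powi ?m"
    have Q: "Q \<noteq> 0" "q powi (- ?m) = 1 / Q" "q powi (1 - ?m) = q / Q"
      using q by (simp_all add: Q_def power_int_minus power_int_diff field_simps)
    have "b * t * w + 1 / Q / ?\<sigma> * (b * w) - q / Q / ?\<sigma> * (b / q * (1 - Q - ?\<sigma> * (Q * (S - t))) * w)
       = (S + 1 / ?\<sigma>) * (b * w)" for b t w S
      using Q(1) q \<sigma> by (simp add: field_simps)
    then show "branchA n q s \<eta> * T \<eta> * tw \<eta> + q powi (- ?m) / ?\<sigma> * (branchA n q s \<eta> * tw \<eta>) -
       q powi (1 - ?m) / ?\<sigma> * (branchA n q s \<eta> / q * (1 - q powi ?m - ?\<sigma> * (q powi ?m * (?S - T \<eta>))) * tw \<eta>)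
       = (?S + 1 / ?\<sigma>) * (branchA n q s \<eta> * tw \<eta>)"
      unfolding Q(2,3) Q_def[symmetric] by blast
  qed
  also have "\<dots> = (\<Sum>i\<in>{1..Suc n}. 1 / s i) * ?F e"
    unfolding C sum_distrib_left[symmetric] by simp
  finally show "minusA (Suc n) s q ?F e = (\<Sum>i\<in>{1..Suc n}. 1 / s i) * ?F e" .
qed

lemma eigen_plus: "n \<ge> 1 \<Longrightarrow> eigen_plus n q"
  by (induction n rule: dec_induct) (simp_all add: eigen_plus_1 eigen_plus_Suc)

lemma eigen_minus: "n \<ge> 1 \<Longrightarrow> eigen_minus n q"
  by (induction n rule: dec_induct) (simp_all add: eigen_minus_1 eigen_minus_Suc)

section \<open>The expansion as a solution of the type B equation\<close>

definition branchB_series :: "nat \<Rightarrow> (nat \<Rightarrow> 'a::field) \<Rightarrow> 'a \<Rightarrow> (nat \<Rightarrow> int) \<Rightarrow> 'a" where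
  "branchB_series n s q e = (\<Sum>\<theta>\<in>weakcomp n (- (\<Sum>k\<in>{1..n}. e k)). eBA n \<theta> s q * twisted n q s \<theta> e)"

text \<open>Beyond the two type A operators, type B contains only the boundary factor -1 / x_n in
  front of T_n; multiplication by 1 / x_n reads the coefficient at
  \<open>e(n := e n + 1)\<close>.\<close>

lemma DB_eq:
  fixes s :: "nat \<Rightarrow> 'a::field"
  assumes n: "n \<ge> 1"
  shows "DB n s q F e = plusA n s q F e + minusA n s q F e - s n * q powi (e n + 1) * F (e(n := e n + 1))"
proof -
  have 1: "{1..n} = insert n {1..n-1}" "{1..<n} = {1..n-1}" using n by auto
  have xinv: "(\<lambda>k. e k - xinv n k) = e(n := e n + 1)" by (auto simp: xinv_def)
  have f1: "(\<Sum>i\<in>{1..n-1}. s i * (Tq q i F e - mulmon (xr i (i+1)) (Tq q i F) e)) =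
    (\<Sum>i\<in>{1..n-1}. s i * q powi (e i) * F e) - (\<Sum>i\<in>{1..n-1}. s i * q powi (e i + 1) * F (\<lambda>k. e k - xr i (i+1) k))"
    unfolding sum_subtractf[symmetric]
    by (rule sum.cong) (simp_all add: Tq_def mulmon_def xr_def algebra_simps)
  have f2: "s n * (Tq q n F e - mulmon (xinv n) (Tq q n F) e) = s n * q powi (e n) * F e - s n * q powi (e n + 1) * F (e(n := e n + 1))"
    unfolding mulmon_def Tq_def xinv by (simp add: xinv_def algebra_simps)
  have f3: "plusA n s q F e = (\<Sum>i\<in>{1..n-1}. s i * q powi (e i) * F e) + s n * q powi (e n) * F e
     - (\<Sum>i\<in>{1..n-1}. s i * q powi (e i + 1) * F (\<lambda>k. e k - xr i (i+1) k))"
    unfolding plusA_def 1(2) unfolding 1(1) sum_distrib_right[symmetric] using n by (subst sum.insert) (auto simp: algebra_simps)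
  have f4: "inverse (s 1) * Tqinv q 1 F e + (\<Sum>i\<in>{2..n}. inverse (s i) * (Tqinv q i F e - mulmon (xr (i-1) i) (Tqinv q i F) e))
     = minusA n s q F e"
  proof -
    have "(\<Sum>i\<in>{2..n}. inverse (s i) * (Tqinv q i F e - mulmon (xr (i-1) i) (Tqinv q i F) e)) =
      (\<Sum>i\<in>{2..n}. q powi (- e i) / s i * F e - q powi (1 - e i) / s i * F (\<lambda>k. e k - xr (i-1) i k))"
      by (rule sum.cong) (auto simp: Tqinv_def mulmon_def xr_def divide_inverse algebra_simps)
    also have "\<dots> = (\<Sum>i\<in>{2..n}. q powi (- e i) / s i * F e) - (\<Sum>i\<in>{2..n}. q powi (1 - e i) / s i * F (\<lambda>k. e k - xr (i-1) i k))"
      by (rule sum_subtractf)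
    also have "(\<Sum>i\<in>{2..n}. q powi (1 - e i) / s i * F (\<lambda>k. e k - xr (i-1) i k)) =
      (\<Sum>i\<in>{1..<n}. q powi (1 - e (Suc i)) / s (Suc i) * F (\<lambda>k. e k - xr i (i+1) k))"
      by (rule sum.reindex_bij_witness[of _ Suc "\<lambda>i. i - 1"]) auto
    moreover have "{1..n} = insert 1 {2..n}" using n by auto
    then have "(\<Sum>i\<in>{1..n}. q powi (- e i) / s i) * F e = q powi (- e 1) / s 1 * F e + (\<Sum>i\<in>{2..n}. q powi (- e i) / s i * F e)"
      by (simp add: distrib_right sum_distrib_right)
    ultimately show ?thesis unfolding minusA_def by (simp add: Tqinv_def field_simps)
  qed
  show ?thesis unfolding DB_def add.assoc f4 unfolding f1 f2 f3 by simp
qed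

lemma branchB_series_eigen:
  fixes s :: "nat \<Rightarrow> 'a::field"
  assumes g: "genericB n q s" and n: "n \<ge> 1"
  shows "DB n s q (branchB_series n s q) e = (\<Sum>i\<in>{1..n}. s i + inverse (s i)) * branchB_series n s q e"
proof -
  have gn: "generic n q s" using g by (simp add: genericB_def)
  let ?F = "branchB_series n s q" and ?m = "- (\<Sum>k\<in>{1..n}. e k)" and ?S = "\<Sum>i\<in>{1..n}. s i + 1 / s i"
  define T where "T \<eta> = (\<Sum>i\<in>{1..n}. shift q \<eta> s i)" for \<eta>
  define T' where "T' \<eta> = (\<Sum>i\<in>{1..n}. 1 / shift q \<eta> s i)" for \<eta>
  define tw where "tw \<eta> = twisted n q s \<eta> e" for \<eta>
  have F: "?F e = (\<Sum>\<eta>\<in>weakcomp n ?m. eBA n \<eta> s q * tw \<eta>)"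
    by (simp only: branchB_series_def tw_def)
  have Fxr: "?F (\<lambda>k. e k - xr i (i+1) k) = (\<Sum>\<theta>\<in>weakcomp n ?m. eBA n \<theta> s q * twisted n q s \<theta> (\<lambda>k. e k - xr i (i+1) k))"
    if "i \<in> {1..<n}" for i
  proof -
    have "(\<Sum>k\<in>{1..n}. e k - xr i (i+1) k) = (\<Sum>k\<in>{1..n}. e k)"
      unfolding sum_subtractf using that by (subst sum_xr) auto
    then show ?thesis by (simp only: branchB_series_def)
  qed
  have "plusA n s q ?F e = (\<Sum>\<theta>\<in>weakcomp n ?m. eBA n \<theta> s q * plusA n s q (twisted n q s \<theta>) e)"
    using F Fxr unfolding tw_def by (rule plusA_sum) simp_all
  then have P: "plusA n s q ?F e = (\<Sum>\<eta>\<in>weakcomp n ?m. eBA n \<eta> s q * T \<eta> * tw \<eta>)"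
    unfolding twisted_plus[OF eigen_plus[OF n] gn] T_def tw_def by (simp only: mult.assoc)
  have "minusA n s q ?F e = (\<Sum>\<theta>\<in>weakcomp n ?m. eBA n \<theta> s q * minusA n s q (twisted n q s \<theta>) e)"
    using F Fxr unfolding tw_def by (rule minusA_sum) simp_all
  then have M: "minusA n s q ?F e = (\<Sum>\<eta>\<in>weakcomp n ?m. eBA n \<eta> s q * T' \<eta> * tw \<eta>)"
    unfolding twisted_minus[OF eigen_minus[OF n] gn] T'_def tw_def by (simp only: mult.assoc)
  have "(\<Sum>k\<in>{1..n}. (e(n := e n + 1)) k) = (\<Sum>k\<in>{1..n}. e k) + 1"
    using n by (subst (1 2) sum.remove[of _ n]) auto
  then have "?F (e(n := e n + 1)) = (\<Sum>\<theta>\<in>weakcomp n (?m - 1). eBA n \<theta> s q * twisted n q s \<theta> (e(n := e n + 1)))"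
    unfolding branchB_series_def by (simp del: fun_upd_apply)
  then have "s n * q powi (e n + 1) * ?F (e(n := e n + 1)) =
    (\<Sum>\<theta>\<in>weakcomp n (?m - 1). eBA n \<theta> s q * (s n * q powi (e n + 1) * twisted n q s \<theta> (e(n := e n + 1))))"
    by (simp only: sum_distrib_left mult_ac)
  also have "\<dots> = (\<Sum>\<theta>\<in>weakcomp n (?m - 1). \<Sum>k\<in>{1..n}.
      (shift q \<theta> s k * pieri n q (shift q \<theta> s) k * eBA n \<theta> s q) * tw (\<theta>(k := Suc (\<theta> k))))"
    unfolding twisted_pieri_plus[OF gn n eigen_plus[OF n]] sum_distrib_left tw_def by (simp only: mult_ac)
  also have "\<dots> = (\<Sum>\<eta>\<in>weakcomp n (?m - 1 + 1). (\<Sum>k\<in>{1..n}. if \<eta> k = 0 then 0 else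
      shift q (\<eta>(k := \<eta> k - 1)) s k * pieri n q (shift q (\<eta>(k := \<eta> k - 1)) s) k * eBA n (\<eta>(k := \<eta> k - 1)) s q) * tw \<eta>)"
    by (rule sum_bump)
  also have "\<dots> = (\<Sum>\<eta>\<in>weakcomp n ?m. eBA n \<eta> s q * (T \<eta> + T' \<eta> - ?S) * tw \<eta>)"
    unfolding sum_eBA[OF g] T_def T'_def by (simp only: diff_add_cancel sum.distrib)
  finally have B: "s n * q powi (e n + 1) * ?F (e(n := e n + 1)) =
    (\<Sum>\<eta>\<in>weakcomp n ?m. eBA n \<eta> s q * (T \<eta> + T' \<eta> - ?S) * tw \<eta>)" .
  \<comment> \<open>Termwise, T + T' - (T + T' - S) = S.\<close>
  have "DB n s q ?F e = (\<Sum>\<eta>\<in>weakcomp n ?m. ?S * (eBA n \<eta> s q * tw \<eta>))"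
    unfolding DB_eq[OF n] P M B sum.distrib[symmetric] sum_subtractf[symmetric]
    by (rule sum.cong) (simp_all add: algebra_simps)
  also have "\<dots> = ?S * ?F e" unfolding F sum_distrib_left ..
  finally show ?thesis by (simp only: inverse_eq_divide)
qed

section \<open>Uniqueness and genericity\<close>

text \<open>The total degree in the generators of the power series ring: the weights
  \<open>n + 1 - k\<close> are chosen such that each x_{i+1} / x_i and 1 / x_n have height
  1.\<close>

definition height :: "nat \<Rightarrow> (nat \<Rightarrow> int) \<Rightarrow> int" where
  "height n e = - (\<Sum>k\<in>{1..n}. int (n + 1 - k) * e k)"

lemma height_diff: "height n (\<lambda>k. e k - f k) = height n e - height n f"
  by (simp add: height_def right_diff_distrib sum_subtractf)

lemma height_xr:
  assumes "i \<in> {1..<n}" shows "height n (xr i (i+1)) = 1"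
proof -
  have "(\<Sum>k\<in>{1..n}. int (n + 1 - k) * xr i (i+1) k) =
    (\<Sum>k\<in>{1..n}. if k = i+1 then int (n - i) else 0) - (\<Sum>k\<in>{1..n}. if k = i then int (n + 1 - i) else 0)"
    unfolding sum_subtractf[symmetric] by (rule sum.cong) (auto simp: xr_def)
  then show ?thesis using assms by (auto simp: height_def of_nat_diff)
qed

lemma height_xinv: "n \<ge> 1 \<Longrightarrow> height n (xinv n) = 1"
proof -
  assume n: "n \<ge> 1"
  have "(\<Sum>k\<in>{1..n}. int (n + 1 - k) * xinv n k) = (\<Sum>k\<in>{1..n}. if k = n then - 1 else 0)"
    by (rule sum.cong) (auto simp: xinv_def)
  then show ?thesis using n by (simp add: height_def)
qed

lemma height_expB:
  assumes "n \<ge> 1" shows "height n (expB n c) \<ge> 0"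
proof -
  have "(\<Sum>k\<in>{1..n}. int (n + 1 - k) * expB n c k) =
    (\<Sum>i\<in>{1..<n}. int (c i) * (\<Sum>k\<in>{1..n}. int (n + 1 - k) * xr i (i+1) k))
     + int (c n) * (\<Sum>k\<in>{1..n}. int (n + 1 - k) * xinv n k)"
    unfolding expB_def distrib_left sum.distrib sum_distrib_left
    by (subst sum.swap) (simp only: mult_ac)
  then have "height n (expB n c) = (\<Sum>i\<in>{1..<n}. int (c i) * height n (xr i (i+1))) + int (c n) * height n (xinv n)"
    by (simp add: height_def sum_negf)
  also have "\<dots> = (\<Sum>i\<in>{1..<n}. int (c i)) + int (c n)"
    using assms by (simp only: height_xr height_xinv mult_1_right cong: sum.cong)
  also have "\<dots> \<ge> 0" by (simp add: sum_nonneg)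
  finally show ?thesis .
qed

lemma expB_outside: "k \<notin> {1..n} \<Longrightarrow> n \<ge> 1 \<Longrightarrow> expB n c k = 0"
  by (auto simp: expB_def xr_def xinv_def intro!: sum.neutral)

text \<open>At a monomial of least height in the support all neighbouring coefficients vanish, so
  the operator acts there by its diagonal factor alone. This factor would equal the eigenvalue,
  which \<open>nres\<close> excludes away from the monomial 1, and at 1 the coefficient is 0 by
  \<open>F0\<close>.\<close>

lemma eigen_B_unique:
  fixes F :: "(nat \<Rightarrow> int) \<Rightarrow> 'a::field"
  assumes n: "n \<ge> 1" and F: "F \<in> LambdaB n" and F0: "F (\<lambda>_. 0) = 0"
    and ev: "\<And>e. DB n s q F e = (\<Sum>i\<in>{1..n}. s i + inverse (s i)) * F e"
    and nres: "\<And>e. (\<And>k. k \<notin> {1..n} \<Longrightarrow> e k = 0) \<Longrightarrow> e \<noteq> (\<lambda>_. 0) \<Longrightarrow>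
      (\<Sum>i\<in>{1..n}. s i * q powi (e i) + q powi (- e i) / s i) \<noteq> (\<Sum>i\<in>{1..n}. s i + inverse (s i))"
  shows "F e = 0"
proof (rule ccontr)
  assume "F e \<noteq> 0"
  then obtain e where e: "F e \<noteq> 0" and least: "\<And>e'. F e' \<noteq> 0 \<Longrightarrow> nat (height n e) \<le> nat (height n e')"
    using ex_has_least_nat[of "\<lambda>e. F e \<noteq> 0" e "\<lambda>e. nat (height n e)"] by blast
  have supp: "\<exists>c. e' = expB n c" if "F e' \<noteq> 0" for e' using F that by (auto simp: LambdaB_def)
  have low: "F (\<lambda>k. e k - f k) = 0" if "height n f = 1" for f
  proof (rule ccontr)
    assume ne: "F (\<lambda>k. e k - f k) \<noteq> 0"
    then have "height n (\<lambda>k. e k - f k) \<ge> 0" using supp height_expB[OF n] by metis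
    moreover have "nat (height n e) \<le> nat (height n (\<lambda>k. e k - f k))" by (rule least[OF ne])
    ultimately show False unfolding height_diff using that by simp
  qed
  have "(\<lambda>k. e k - xinv n k) = e(n := e n + 1)" by (auto simp: xinv_def)
  then have "F (e(n := e n + 1)) = 0" using low[OF height_xinv[OF n]] by simp
  moreover have "F (\<lambda>k. e k - xr i (i+1) k) = 0" if "i \<in> {1..<n}" for i
    using low[OF height_xr[OF that]] .
  ultimately have "DB n s q F e = (\<Sum>i\<in>{1..n}. s i * q powi (e i) + q powi (- e i) / s i) * F e"
    unfolding DB_eq[OF n] plusA_def minusA_def by (simp add: sum.distrib distrib_right)
  then have "(\<Sum>i\<in>{1..n}. s i * q powi (e i) + q powi (- e i) / s i) = (\<Sum>i\<in>{1..n}. s i + inverse (s i))"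
    using ev[of e] e by simp
  moreover have "e \<noteq> (\<lambda>_. 0)" using e F0 by auto
  moreover have "e k = 0" if "k \<notin> {1..n}" for k using supp[OF e] expB_outside[OF that n] by auto
  ultimately show False using nres by blast
qed

section \<open>Laurent monomials in algebraically independent elements\<close>

definition laurent_monom :: "nat \<Rightarrow> (nat \<Rightarrow> 'a::field) \<Rightarrow> (nat \<Rightarrow> int) \<Rightarrow> 'a" where
  "laurent_monom n v m = (\<Prod>k\<le>n. v k powi m k)"

definition unitv :: "nat \<Rightarrow> int \<Rightarrow> nat \<Rightarrow> int" where
  "unitv a x = (\<lambda>k. if k = a then x else 0)"

lemma laurent_monom_unitv: "a \<le> n \<Longrightarrow> laurent_monom n v (unitv a x) = v a powi x"
proof -
  assume a: "a \<le> n"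
  have "laurent_monom n v (unitv a x) = (\<Prod>k\<le>n. if k = a then v a powi x else 1)"
    unfolding laurent_monom_def by (rule prod.cong) (auto simp: unitv_def)
  then show ?thesis using a by simp
qed

lemma laurent_monom_add:
  "(\<And>k. k \<le> n \<Longrightarrow> v k \<noteq> 0) \<Longrightarrow> laurent_monom n v (\<lambda>k. a k + b k) = laurent_monom n v a * laurent_monom n v b"
  by (simp add: laurent_monom_def power_int_add prod.distrib)

lemma alg_indep_neq_0:
  assumes "alg_indep n v" "k \<le> n" shows "v k \<noteq> (0::'a::field)"
proof
  assume z: "v k = 0"
  \<comment> \<open>The polynomial \<open>P\<close> built here is the single variable with index k,
    which would vanish at \<open>v\<close>.\<close>
  define m where "m i = (if i = k then 1 else 0 :: nat)" for i
  define P where "P p = (if p = m then 1 else 0 :: int)" for p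
  have supp: "{p. P p \<noteq> 0} = {m}" by (auto simp: P_def)
  have "int_poly_eval n P v = (\<Sum>p\<in>{m}. of_int (P p) * (\<Prod>i\<le>n. v i ^ p i))"
    unfolding int_poly_eval_def by (rule Sum_any.expand_superset) (auto simp: P_def)
  moreover have "(\<Prod>i\<le>n. v i ^ m i) = 0" using assms(2) z by (intro prod_zero) (auto simp: m_def)
  ultimately have "int_poly_eval n P v = 0" by simp
  moreover have "finite {p. P p \<noteq> 0}" "\<forall>p. P p \<noteq> 0 \<longrightarrow> (\<forall>i>n. p i = 0)"
    using supp assms(2) by (auto simp: P_def m_def)
  ultimately have "P = (\<lambda>_. 0)" using assms(1) unfolding alg_indep_def by blast
  then have "P m = 0" by simp
  then show False by (simp add: P_def)
qed

text \<open>Multiplying by the power \<open>K\<close> of every \<open>v k\<close> makes all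
  exponents nonnegative, and algebraic independence applies to the resulting polynomial.\<close>

lemma alg_indep_laurent:
  fixes v :: "nat \<Rightarrow> 'a::field" and m :: "'b \<Rightarrow> nat \<Rightarrow> int" and c :: "'b \<Rightarrow> int"
  assumes ai: "alg_indep n v" and fin: "finite J" and inj: "inj_on m J"
    and supp: "\<And>j k. j \<in> J \<Longrightarrow> k > n \<Longrightarrow> m j k = 0"
    and zero: "(\<Sum>j\<in>J. of_int (c j) * laurent_monom n v (m j)) = 0" and j: "j \<in> J"
  shows "c j = 0"
proof -
  define K where "K = (\<Sum>j\<in>J. \<Sum>k\<le>n. nat \<bar>m j k\<bar>)"
  have K: "m j k + int K \<ge> 0" if "j \<in> J" "k \<le> n" for j k
  proof -
    have "nat \<bar>m j k\<bar> \<le> (\<Sum>k\<le>n. nat \<bar>m j k\<bar>)" using that by (intro member_le_sum) auto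
    also have "\<dots> \<le> K" unfolding K_def using that fin
      by (intro member_le_sum[of j J "\<lambda>j. \<Sum>k\<le>n. nat \<bar>m j k\<bar>"]) auto
    finally show ?thesis by linarith
  qed
  define \<phi> where "\<phi> j k = (if k \<le> n then nat (m j k + int K) else 0)" for j k
  have inj\<phi>: "inj_on \<phi> J"
  proof (rule inj_onI)
    fix x y assume xy: "x \<in> J" "y \<in> J" "\<phi> x = \<phi> y"
    have "m x k = m y k" for k
    proof (cases "k \<le> n")
      case True
      then have "nat (m x k + int K) = nat (m y k + int K)" using fun_cong[OF xy(3), of k] by (simp add: \<phi>_def)
      then show ?thesis using K[OF xy(1) True] K[OF xy(2) True] by linarith
    qed (use supp xy in auto)
    then have "m x = m y" by (rule ext)
    then show "x = y" using inj xy(1,2) by (auto simp: inj_on_def)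
  qed
  define P where "P p = (if p \<in> \<phi> ` J then c (inv_into J \<phi> p) else 0)" for p
  have P: "P (\<phi> j) = c j" if "j \<in> J" for j using that inj\<phi> by (simp add: P_def)
  have nz: "v k \<noteq> 0" if "k \<le> n" for k using alg_indep_neq_0[OF ai that] .
  have "int_poly_eval n P v = (\<Sum>p\<in>\<phi> ` J. of_int (P p) * (\<Prod>k\<le>n. v k ^ p k))"
    unfolding int_poly_eval_def by (rule Sum_any.expand_superset) (use fin in \<open>auto simp: P_def\<close>)
  also have "\<dots> = (\<Sum>j\<in>J. of_int (c j) * (\<Prod>k\<le>n. v k ^ \<phi> j k))"
    by (simp add: sum.reindex[OF inj\<phi>] P)
  also have "\<dots> = (\<Sum>j\<in>J. (of_int (c j) * laurent_monom n v (m j)) * (\<Prod>k\<le>n. v k powi int K))"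
  proof (rule sum.cong[OF refl])
    fix j assume "j \<in> J"
    have "(\<Prod>k\<le>n. v k ^ \<phi> j k) = (\<Prod>k\<le>n. v k powi m j k * v k powi int K)"
    proof (rule prod.cong[OF refl])
      fix k assume "k \<in> {..n}"
      then have "v k ^ \<phi> j k = v k powi (m j k + int K)"
        using K[OF \<open>j \<in> J\<close>, of k] by (simp add: \<phi>_def power_int_def)
      then show "v k ^ \<phi> j k = v k powi m j k * v k powi int K"
        using nz \<open>k \<in> {..n}\<close> by (simp add: power_int_add)
    qed
    then show "of_int (c j) * (\<Prod>k\<le>n. v k ^ \<phi> j k) = (of_int (c j) * laurent_monom n v (m j)) * (\<Prod>k\<le>n. v k powi int K)"
      by (simp only: prod.distrib laurent_monom_def mult.assoc)
  qed
  also have "\<dots> = 0" unfolding sum_distrib_right[symmetric] zero by simp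
  finally have "int_poly_eval n P v = 0" .
  moreover have "finite {p. P p \<noteq> 0}" by (rule finite_subset[of _ "\<phi> ` J"]) (use fin in \<open>auto simp: P_def\<close>)
  moreover have "\<forall>p. P p \<noteq> 0 \<longrightarrow> (\<forall>i>n. p i = 0)" by (auto simp: P_def \<phi>_def split: if_splits)
  ultimately have "P = (\<lambda>_. 0)" using ai unfolding alg_indep_def by blast
  then show ?thesis using P[OF j] by simp
qed

lemma alg_indep_monom_neq:
  fixes v :: "nat \<Rightarrow> 'a::field"
  assumes "alg_indep n v" "\<And>k. k > n \<Longrightarrow> a k = 0" "\<And>k. k > n \<Longrightarrow> b k = 0" "a \<noteq> b"
  shows "laurent_monom n v a \<noteq> laurent_monom n v b"
proof
  assume eq: "laurent_monom n v a = laurent_monom n v b"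
  have "(1::int) = 0"
    using alg_indep_laurent[OF assms(1), of "{a, b}" "\<lambda>x. x" "\<lambda>x. if x = a then 1 else - 1" a] assms eq
    by auto
  then show False by simp
qed

context
  fixes n :: nat and q :: "'a::field" and s :: "nat \<Rightarrow> 'a" and v :: "nat \<Rightarrow> 'a"
  assumes ai: "alg_indep n v" and v: "v = (\<lambda>k. if k = 0 then q else s k)"
begin

lemma laurent_monom_unitv_q: "laurent_monom n v (unitv 0 x) = q powi x"
  using laurent_monom_unitv[of 0 n v x] v by simp

lemma laurent_monom_unitv_s: "i \<in> {1..n} \<Longrightarrow> laurent_monom n v (unitv i x) = s i powi x"
  using laurent_monom_unitv[of i n v x] v by simp

lemmas laurent_monom_plus = laurent_monom_add[of n v, OF alg_indep_neq_0[OF ai]]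

lemma alg_indep_genericB: "genericB n q s"
  unfolding genericB_def generic_def
proof (intro conjI allI impI ballI)
  show "q \<noteq> 0" using alg_indep_neq_0[OF ai, of 0] v by simp
  show "s i \<noteq> 0" if "i \<in> {1..n}" for i using alg_indep_neq_0[OF ai, of i] v that by simp
  show "q ^ k \<noteq> 1" if "k > 0" for k
  proof -
    have "laurent_monom n v (unitv 0 (int k)) \<noteq> laurent_monom n v (unitv 0 0)"
      using that by (intro alg_indep_monom_neq[OF ai]) (auto simp: unitv_def fun_eq_iff)
    then show ?thesis by (simp add: laurent_monom_unitv_q)
  qed
  show "s i \<noteq> q powi m * s j" if ij: "i \<in> {1..n}" "j \<in> {1..n}" "i \<noteq> j" for i j and m :: int
  proof -
    have "unitv i 1 i \<noteq> unitv 0 m i + unitv j 1 i" using ij by (auto simp: unitv_def)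
    then have "unitv i 1 \<noteq> (\<lambda>k. unitv 0 m k + unitv j 1 k)" by (auto dest: fun_cong)
    then have "laurent_monom n v (unitv i 1) \<noteq> laurent_monom n v (\<lambda>k. unitv 0 m k + unitv j 1 k)"
      by (intro alg_indep_monom_neq[OF ai]) (use ij in \<open>simp_all add: unitv_def\<close>)
    then show ?thesis using ij by (simp add: laurent_monom_plus laurent_monom_unitv_q laurent_monom_unitv_s)
  qed
  show "s i * s j \<noteq> q powi m" if ij: "i \<in> {1..n}" "j \<in> {1..n}" for i j and m :: int
  proof -
    have "unitv i 1 i + unitv j 1 i \<noteq> unitv 0 m i" using ij by (auto simp: unitv_def)
    then have "(\<lambda>k. unitv i 1 k + unitv j 1 k) \<noteq> unitv 0 m" by (auto dest: fun_cong)
    then have "laurent_monom n v (\<lambda>k. unitv i 1 k + unitv j 1 k) \<noteq> laurent_monom n v (unitv 0 m)"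
      by (intro alg_indep_monom_neq[OF ai]) (use ij in \<open>simp_all add: unitv_def\<close>)
    then show ?thesis using ij by (simp add: laurent_monom_plus laurent_monom_unitv_q laurent_monom_unitv_s)
  qed
qed

text \<open>The difference of the sides is a signed sum of Laurent monomials indexed by (i, b, c): b
  gives the sign of the exponent of s_i, and c tells whether the power of \<open>q\<close> is
  present. Indices with e_i = 0 are dropped, since their monomials coincide and cancel. The
  remaining monomials are distinct, and there is at least one because e is not zero.\<close>

lemma alg_indep_nonresonant:
  assumes "\<And>k. k \<notin> {1..n} \<Longrightarrow> e k = 0" "e \<noteq> (\<lambda>_. 0)"
  shows "(\<Sum>i\<in>{1..n}. s i * q powi (e i) + q powi (- e i) / s i) \<noteq> (\<Sum>i\<in>{1..n}. s i + inverse (s i))"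
proof
  assume eq: "(\<Sum>i\<in>{1..n}. s i * q powi (e i) + q powi (- e i) / s i) = (\<Sum>i\<in>{1..n}. s i + inverse (s i))"
  define I where "I = {i \<in> {1..n}. e i \<noteq> 0}"
  define \<epsilon> :: "bool \<Rightarrow> int" where "\<epsilon> b = (if b then 1 else - 1)" for b
  define m where "m = (\<lambda>(i, b, c) k. unitv i (\<epsilon> b) k + unitv 0 (if c then \<epsilon> b * e i else 0) k)"
  define J where "J = I \<times> (UNIV :: (bool \<times> bool) set)"
  obtain i0 where "e i0 \<noteq> 0" using assms(2) by (auto simp: fun_eq_iff)
  then have i0: "i0 \<in> I" using assms(1)[of i0] unfolding I_def by blast
  have inj: "inj_on m J"
  proof (rule inj_onI)
    fix x y assume xy: "x \<in> J" "y \<in> J" "m x = m y"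
    obtain i b c i' b' c' where x: "x = (i, b, c)" and y: "y = (i', b', c')" by (metis prod_cases3)
    note J = xy(1,2)[unfolded x y] and eq = xy(3)[unfolded x y]
    have i: "i \<ge> 1" "e i \<noteq> 0" "i' \<ge> 1" using J by (auto simp: J_def I_def)
    \<comment> \<open>A coordinate i of at least 1 determines i and b; coordinate 0 then determines
      c because e_i is nonzero.\<close>
    have 1: "i = i' \<and> b = b'"
      using fun_cong[OF eq, of i] i by (auto simp: m_def unitv_def \<epsilon>_def split: if_splits)
    have "c = c'"
      using fun_cong[OF eq, of 0] i 1 by (auto simp: m_def unitv_def \<epsilon>_def split: if_splits)
    then show "x = y" using 1 x y by simp
  qed
  have mon: "laurent_monom n v (m (i, b, c)) = s i powi (\<epsilon> b) * q powi (if c then \<epsilon> b * e i else 0)" if "i \<in> I" for i b c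
    using that by (simp add: m_def laurent_monom_plus laurent_monom_unitv_q laurent_monom_unitv_s I_def)
  have "(\<Sum>j\<in>J. of_int (case j of (i, b, c) \<Rightarrow> \<epsilon> c) * laurent_monom n v (m j)) =
    (\<Sum>i\<in>I. \<Sum>b\<in>UNIV. \<Sum>c\<in>UNIV. of_int (\<epsilon> c) * laurent_monom n v (m (i, b, c)))"
    unfolding J_def by (simp add: sum.cartesian_product case_prod_unfold flip: UNIV_Times_UNIV)
  also have "\<dots> = (\<Sum>i\<in>I. (s i * q powi (e i) + q powi (- e i) / s i) - (s i + inverse (s i)))"
    by (rule sum.cong) (simp_all add: mon UNIV_bool \<epsilon>_def power_int_minus field_simps)
  also have "\<dots> = (\<Sum>i\<in>{1..n}. (s i * q powi (e i) + q powi (- e i) / s i) - (s i + inverse (s i)))"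
    by (rule sum.mono_neutral_left) (auto simp: I_def inverse_eq_divide)
  also have "\<dots> = 0" unfolding sum_subtractf eq by simp
  finally have zero: "(\<Sum>j\<in>J. of_int (case j of (i, b, c) \<Rightarrow> \<epsilon> c) * laurent_monom n v (m j)) = 0" .
  have "finite J" by (simp add: J_def I_def)
  moreover have "m j k = 0" if "j \<in> J" "k > n" for j k
    using that by (auto simp: J_def I_def m_def unitv_def)
  moreover have "(i0, True, True) \<in> J" using i0 by (simp add: J_def)
  ultimately have "(case (i0, True, True) of (i, b, c) \<Rightarrow> \<epsilon> c) = 0"
    using alg_indep_laurent[OF ai _ inj _ zero] by blast
  then show False by (simp add: \<epsilon>_def)
qed

end

section \<open>Constant term, support and conclusion\<close>

lemma weakcomp_0: "weakcomp n 0 = {\<lambda>_. 0}"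
proof -
  have "\<theta> = (\<lambda>_. 0)" if "\<theta> \<in> weakcomp n 0" for \<theta>
  proof
    fix k show "\<theta> k = 0"
      using that by (cases "k \<in> {1..n}") (auto simp: weakcomp_def Vset_def simp del: of_nat_sum)
  qed
  then show ?thesis by (auto simp: weakcomp_def Vset_def)
qed

lemma fA_zero:
  fixes s :: "nat \<Rightarrow> 'a::field"
  assumes "q \<noteq> 0" "\<And>i. i \<in> {1..n} \<Longrightarrow> s i \<noteq> 0"
  shows "fA n s q (\<lambda>_. 0) = 1"
  using assms(2)
proof (induction n)
  case 0
  have "Mset_at 0 (\<lambda>_. 0) = {\<lambda>_ _. 0}" by (auto simp: Mset_at_def Mset_def xexpA_def fun_eq_iff)
  then show ?case by (simp add: fA_eq_sum cToda_def)
next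
  case (Suc n)
  have "(\<lambda>_. 0)(Suc n := 0) = (\<lambda>_::nat. 0::int)" by auto
  then have "fA (Suc n) s q (\<lambda>_. 0) = branchA n q s (\<lambda>_. 0) * fA n s q (\<lambda>_. 0)"
    using Suc.prems by (subst fA_Suc) (auto simp: weakcomp_0 twisted_0 assms(1))
  then show ?case using Suc by (simp add: branchA_def pairprod_def pairw_def)
qed

lemma branchB_series_const:
  fixes s :: "nat \<Rightarrow> 'a::field"
  assumes "q \<noteq> 0" "\<And>i. i \<in> {1..n} \<Longrightarrow> s i \<noteq> 0"
  shows "branchB_series n s q (\<lambda>_. 0) = 1"
  using fA_zero[OF assms] by (simp add: branchB_series_def weakcomp_0 twisted_0 eBA_def)

text \<open>Abel summation: with E_i = e_1 + ... + e_i, the monomial is the product of the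
  generators to the powers -E_i, which \<open>neg\<close> makes natural numbers.\<close>

lemma expB_surj:
  assumes out: "\<And>k. k \<notin> {1..n} \<Longrightarrow> e k = 0" and neg: "\<And>m. (\<Sum>k\<in>{1..m}. e k) \<le> 0"
  shows "e = expB n (\<lambda>i. nat (- (\<Sum>k\<in>{1..i}. e k)))"
proof
  fix k
  define E where "E i = (\<Sum>k\<in>{1..i}. e k)" for i
  have c: "int (nat (- E i)) = - E i" for i using neg[of i] by (simp add: E_def)
  have 1: "(\<Sum>i\<in>{1..<n}. - E i * xr i (i+1) k) = (\<Sum>i\<in>{1..<n}. if i = k then E k else 0) - (\<Sum>i\<in>{1..<n}. if i = k - 1 \<and> k > 0 then E (k - 1) else 0)"
    unfolding sum_subtractf[symmetric] by (rule sum.cong) (auto simp: xr_def)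
  have 2: "(\<Sum>i\<in>{1..<n}. if i = k - 1 \<and> k > 0 then E (k - 1) else 0) = (if k > 0 \<and> k - 1 \<in> {1..<n} then E (k - 1) else 0)"
    by (cases "k > 0") (simp_all add: sum.delta)
  have step: "E k = E (k - 1) + e k" if "k \<ge> 1" using that by (cases k) (simp_all add: E_def)
  have E0: "E 0 = 0" by (simp add: E_def)
  have "expB n (\<lambda>i. nat (- E i)) k = (if k \<in> {1..<n} then E k else 0) - (if k > 0 \<and> k - 1 \<in> {1..<n} then E (k - 1) else 0)
     + (if k = n then E n else 0)"
    unfolding expB_def c 1 2 by (simp add: xinv_def)
  also have "\<dots> = e k"
  proof (cases "k \<in> {1..n}")
    case True
    then show ?thesis using step E0 by (cases "k = 1") auto
  next
    case False
    then show ?thesis using out[OF False] E0 by (cases "n = 0") auto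
  qed
  finally show "e k = expB n (\<lambda>i. nat (- (\<Sum>k\<in>{1..i}. e k))) k" by (simp add: E_def)
qed

text \<open>Multiplication by x^(-\<theta>) only lowers the partial sums of the exponents, so they
  remain at most 0 as for f^A, and \<open>expB_surj\<close> applies.\<close>

lemma branchB_series_LambdaB: "branchB_series n s q \<in> LambdaB n"
  unfolding LambdaB_def
proof (rule CollectI, intro allI impI)
  fix e assume "branchB_series n s q e \<noteq> 0"
  then obtain \<theta> where \<theta>: "\<theta> \<in> weakcomp n (- (\<Sum>k\<in>{1..n}. e k))" "twisted n q s \<theta> e \<noteq> 0"
    unfolding branchB_series_def by (metis (no_types, lifting) mult_zero_right sum.neutral)
  note supp = fA_support[OF \<theta>(2)[unfolded twisted_def]]
  have "e k = 0" if "k \<notin> {1..n}" for k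
    using supp(1)[OF that] \<theta>(1) that by (auto simp: weakcomp_def Vset_def)
  moreover have "(\<Sum>k\<in>{1..m}. e k) \<le> 0" for m
  proof -
    have "(\<Sum>k\<in>{1..m}. int (\<theta> k)) \<ge> 0" by (intro sum_nonneg) simp
    then show ?thesis using supp(2)[of m] unfolding sum.distrib by linarith
  qed
  ultimately show "\<exists>c. e = expB n c" using expB_surj by blast
qed

text \<open>Since f^A is homogeneous of degree 0, a nonzero term has |\<theta>| equal to minus the
  total degree of \<open>e\<close>. The formal sum over all \<theta> is thus finite in each
  coefficient.\<close>

lemma branchB_series_eq_Sum_any:
  "branchB_series n s q e = Sum_any (\<lambda>\<theta>. if \<theta> \<in> Vset n
     then eBA n \<theta> s q * fA n (\<lambda>i. s i / q ^ \<theta> i) q (\<lambda>k. e k + int (\<theta> k)) else 0)" (is "_ = Sum_any ?g")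
proof -
  have "{\<theta>. ?g \<theta> \<noteq> 0} \<subseteq> weakcomp n (- (\<Sum>k\<in>{1..n}. e k))"
  proof (rule subsetI, drule CollectD)
    fix \<theta> assume "?g \<theta> \<noteq> 0"
    then have V: "\<theta> \<in> Vset n" and "fA n (\<lambda>i. s i / q ^ \<theta> i) q (\<lambda>k. e k + int (\<theta> k)) \<noteq> 0"
      by (auto split: if_splits)
    from fA_support(3)[OF this(2)] have "(\<Sum>k\<in>{1..n}. e k) + int (\<Sum>k\<in>{1..n}. \<theta> k) = 0"
      by (simp add: sum.distrib)
    then show "\<theta> \<in> weakcomp n (- (\<Sum>k\<in>{1..n}. e k))" using V unfolding weakcomp_def by simp
  qed
  then have "Sum_any ?g = (\<Sum>\<theta>\<in>weakcomp n (- (\<Sum>k\<in>{1..n}. e k)). ?g \<theta>)"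
    by (rule Sum_any.expand_superset[OF finite_weakcomp])
  also have "\<dots> = branchB_series n s q e"
    unfolding branchB_series_def twisted_def shift_def by (rule sum.cong) (auto simp: weakcomp_def)
  finally show ?thesis by simp
qed

theorem theorem2p7:
  fixes N :: nat and q :: "'a::field_char_0" and s :: "nat \<Rightarrow> 'a"
  assumes "N \<ge> 1"
    and "alg_indep N (\<lambda>k. if k = 0 then q else s k)"
  shows "fB N s q =
    (\<lambda>e. Sum_any (\<lambda>\<theta>. if \<theta> \<in> Vset N
            then eBA N \<theta> s q * fA N (\<lambda>i. s i / q ^ \<theta> i) q (\<lambda>k. e k + int (\<theta> k))
            else 0))"
proof -
  let ?B = "branchB_series N s q" and ?E = "\<Sum>i\<in>{1..N}. s i + inverse (s i)"
  have g: "genericB N q s" using alg_indep_genericB[OF assms(2) refl] .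
  then have nz: "q \<noteq> 0" "\<And>i. i \<in> {1..N} \<Longrightarrow> s i \<noteq> 0" by (auto simp: genericB_def generic_def)
  have B: "?B \<in> LambdaB N" "DB N s q ?B = (\<lambda>e. ?E * ?B e)" "?B (\<lambda>_. 0) = 1"
    using branchB_series_LambdaB branchB_series_eigen[OF g assms(1)] branchB_series_const[OF nz] by auto
  have "fB N s q = ?B"
    unfolding fB_def
  proof (rule the_equality)
    show "?B \<in> LambdaB N \<and> DB N s q ?B = (\<lambda>e. ?E * ?B e) \<and> ?B (\<lambda>_. 0) = 1" using B by blast
    fix F assume F: "F \<in> LambdaB N \<and> DB N s q F = (\<lambda>e. ?E * F e) \<and> F (\<lambda>_. 0) = 1"
    \<comment> \<open>The difference of two solutions solves the same linear equation and has
      constant term 0.\<close>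
    define H where "H e = F e - ?B e" for e
    have "H e = 0" for e
    proof (rule eigen_B_unique[OF assms(1), where s = s and q = q])
      show "H \<in> LambdaB N" unfolding LambdaB_def
      proof (rule CollectI, intro allI impI)
        fix e assume "H e \<noteq> 0"
        then have "F e \<noteq> 0 \<or> ?B e \<noteq> 0" by (auto simp: H_def)
        then show "\<exists>c. e = expB N c" using F B(1) unfolding LambdaB_def by blast
      qed
      show "H (\<lambda>_. 0) = 0" using F B(3) by (simp add: H_def)
      show "DB N s q H e = ?E * H e" for e
      proof -
        have "DB N s q H e = DB N s q F e - DB N s q ?B e"
          unfolding DB_eq[OF assms(1)] plusA_def minusA_def H_def right_diff_distrib sum_subtractf by simp
        then show ?thesis using F B(2) by (simp add: H_def right_diff_distrib)
      qed
    qed (rule alg_indep_nonresonant[OF assms(2) refl])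
    then show "F = ?B" by (auto simp: H_def fun_eq_iff)
  qed
  then show ?thesis by (simp only: branchB_series_eq_Sum_any[abs_def])
qed

end
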